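(* Let $C_1>1$ be a sufficiently large absolute constant. Fix $k\ge2$, and let $C(k)=2^kC^{(0)}(k)+1$, where $C^{(0)}(k)$ is a constant large enough that $\mathbb E[|\mathcal N(\mu,\sigma^2)|^k]\le C^{(0)}(k)(|\mu|+\sigma)^k$ for all $\mu,\sigma$. Suppose $\alpha,\epsilon\le1$ and \[ \delta\le\min\left\{\tilde\Omega\left(\frac{\alpha\epsilon}{d}\right)^{C_1},\ \Omega\left(\min\left\{\frac{1}{n\sqrt m},\frac{\sqrt d}{n\sqrt m\sqrt{\log(n\sqrt m/\sqrt d)}}\right\}\right)\right\}. \] Suppose $M$ is a person-level $(\epsilon,\delta)$-DP mechanism that takes as input $X=(X^{(1)},\dots,X^{(n)})$ with $X^{(i)}=(X^{(i)}_1,\dots,X^{(i)}_m)\in\mathbb R^{m\times d}$. Suppose that for every distribution $\mathcal D$ over $\mathbb R^d$ satisfying $\mathbb E_{Y\sim\mathcal D}[|\langle Y-\mathbb E[Y],v\rangle|^k]\le C(k)$ for all $v\in\mathbb S^{d-1}$, when $X^{(i)}_j\sim\mathcal D$ i.i.d. for all $i\in[n],j\in[m]$, we have $\Pr[\|M(X)-\mathbb E_{Y\sim\mathcal D}[Y]\|_2\le\alpha]\ge2/3$. Then \[ n\ge\tilde\Omega\left(\frac{d}{m\alpha^2}+\frac{d}{\sqrt m\alpha\epsilon}+\frac{d}{m\alpha^{k/(k-1)}\epsilon}\right). \]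
   Context: Person-level $(\epsilon,\delta)$-DP: each $X^{(i)}$ is one person's data; for any two inputs differing in at most one $X^{(i)}$ and any output set $S$, $\Pr[M(X)\in S]\le e^\epsilon\Pr[M(X')\in S]+\delta$. *)

theory Defs
  imports "HOL-Probability.Probability"
begin

text \<open>
  The dimension \<open>d\<close> and the sizes \<open>n\<close>, \<open>m\<close> are quantified after the hidden constants, so
  \<open>\<real>\<^sup>d\<close> is the space of functions on \<open>{..<d}\<close> (extensional, i.e. undefined outside
  \<open>{..<d}\<close>) with the product Borel sigma-algebra.
\<close>

definition euclid :: "nat \<Rightarrow> (nat \<Rightarrow> real) measure" where
  "euclid d = PiM {..<d} (\<lambda>_. borel)"

definition dot :: "nat \<Rightarrow> (nat \<Rightarrow> real) \<Rightarrow> (nat \<Rightarrow> real) \<Rightarrow> real" where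
  "dot d x y = (\<Sum>i<d. x i * y i)"

abbreviation norm2 :: "nat \<Rightarrow> (nat \<Rightarrow> real) \<Rightarrow> real" where
  "norm2 d x \<equiv> L2_set x {..<d}"

definition unit_sphere :: "nat \<Rightarrow> (nat \<Rightarrow> real) set" where
  "unit_sphere d = {v \<in> space (euclid d). norm2 d v = 1}"

definition mean :: "(nat \<Rightarrow> real) measure \<Rightarrow> nat \<Rightarrow> real" where
  "mean D i = (\<integral>y. y i \<partial>D)"

text \<open>
  Bochner integrals of non-integrable functions are 0, so existence of the mean and of the
  directional moments is required explicitly.
\<close>

definition bounded_moment :: "nat \<Rightarrow> real \<Rightarrow> real \<Rightarrow> (nat \<Rightarrow> real) measure \<Rightarrow> bool" where
  "bounded_moment d k C D \<longleftrightarrow>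
     D \<in> space (prob_algebra (euclid d)) \<and>
     (\<forall>i<d. integrable D (\<lambda>y. y i)) \<and>
     (\<forall>v\<in>unit_sphere d.
        integrable D (\<lambda>y. \<bar>dot d (\<lambda>i. y i - mean D i) v\<bar> powr k) \<and>
        (\<integral>y. \<bar>dot d (\<lambda>i. y i - mean D i) v\<bar> powr k \<partial>D) \<le> C)"

text \<open>The degenerate case \<open>\<sigma> = 0\<close> follows from \<open>\<sigma> > 0\<close> by letting \<open>\<sigma> \<rightarrow> 0\<close>.\<close>

definition gaussian_moment_const :: "real \<Rightarrow> real \<Rightarrow> bool" where
  "gaussian_moment_const k C0 \<longleftrightarrow>
     (\<forall>\<mu> \<sigma>. \<sigma> > 0 \<longrightarrow>
        (\<integral>x. \<bar>x\<bar> powr k \<partial>density lborel (\<lambda>x. ennreal (normal_density \<mu> \<sigma> x)))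
          \<le> C0 * (\<bar>\<mu>\<bar> + \<sigma>) powr k)"

text \<open>A data set \<open>X\<close> has \<open>X i j\<close> as the \<open>j\<close>-th sample of person \<open>i\<close>.\<close>

type_synonym dataset = "nat \<Rightarrow> nat \<Rightarrow> nat \<Rightarrow> real"

definition data_space :: "nat \<Rightarrow> nat \<Rightarrow> nat \<Rightarrow> dataset measure" where
  "data_space n m d = PiM {..<n} (\<lambda>_. PiM {..<m} (\<lambda>_. euclid d))"

definition iid_data :: "nat \<Rightarrow> nat \<Rightarrow> (nat \<Rightarrow> real) measure \<Rightarrow> dataset measure" where
  "iid_data n m D = PiM {..<n} (\<lambda>_. PiM {..<m} (\<lambda>_. D))"

text \<open>A randomized mechanism is a Markov kernel: \<open>M X\<close> is the distribution of the output on \<open>X\<close>.\<close>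

definition mechanism :: "nat \<Rightarrow> nat \<Rightarrow> nat \<Rightarrow> (dataset \<Rightarrow> (nat \<Rightarrow> real) measure) \<Rightarrow> bool" where
  "mechanism n m d M \<longleftrightarrow> M \<in> data_space n m d \<rightarrow>\<^sub>M prob_algebra (euclid d)"

definition person_level_DP ::
    "nat \<Rightarrow> nat \<Rightarrow> nat \<Rightarrow> real \<Rightarrow> real \<Rightarrow> (dataset \<Rightarrow> (nat \<Rightarrow> real) measure) \<Rightarrow> bool" where
  "person_level_DP n m d \<epsilon> \<delta> M \<longleftrightarrow>
     (\<forall>X\<in>space (data_space n m d). \<forall>X'\<in>space (data_space n m d).
        card {i. i < n \<and> X i \<noteq> X' i} \<le> 1 \<longrightarrow>
        (\<forall>S\<in>sets (euclid d). measure (M X) S \<le> exp \<epsilon> * measure (M X') S + \<delta>))"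

text \<open>The probability is over both the sample and the randomness of the mechanism.\<close>

definition success_prob ::
    "nat \<Rightarrow> nat \<Rightarrow> nat \<Rightarrow> real \<Rightarrow> (dataset \<Rightarrow> (nat \<Rightarrow> real) measure) \<Rightarrow> (nat \<Rightarrow> real) measure \<Rightarrow> real" where
  "success_prob n m d \<alpha> M D =
     measure (Giry_Monad.bind (iid_data n m D) M)
       {y \<in> space (euclid d). norm2 d (\<lambda>i. y i - mean D i) \<le> \<alpha>}"

text \<open>
  A bound \<open>\<Omega>\<close>-tilde of \<open>f\<close> is read as \<open>c * f / (log_factor d \<alpha> \<epsilon>) ^ p\<close> with hidden
  constants \<open>c > 0\<close> and \<open>p\<close>.  For \<open>\<alpha>, \<epsilon> \<le> 1 \<le> d\<close> the factor is at least 1.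
\<close>

definition log_factor :: "nat \<Rightarrow> real \<Rightarrow> real \<Rightarrow> real" where
  "log_factor d \<alpha> \<epsilon> = 1 + ln (real d / (\<alpha> * \<epsilon>))"

text \<open>
  The bound \<open>min {1/(n\<surd>m), \<surd>d/(n\<surd>m \<surd>(log (n\<surd>m/\<surd>d)))}\<close>.  When \<open>n\<surd>m \<le> \<surd>d\<close> the logarithm is
  not positive and the second term is read as infinite, its limit as \<open>n\<surd>m/\<surd>d\<close> decreases to 1.
\<close>

definition delta_bound :: "nat \<Rightarrow> nat \<Rightarrow> nat \<Rightarrow> real" where
  "delta_bound n m d =
     (let N = real n * sqrt (real m) in
      if N \<le> sqrt (real d) then 1 / N
      else min (1 / N) (sqrt (real d) / (N * sqrt (ln (N / sqrt (real d))))))"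

end

theory Submission
  imports Defs
begin

text \<open>
  The hard distribution \<open>D\<^sub>w\<close> on \<open>\<real>\<^sup>d\<close> is \<open>0\<close> with probability \<open>1 - p\<close> and otherwise \<open>s\<close> times a vector of
  independent signs with mean \<open>w\<close>, where \<open>w\<close> ranges over a cube \<open>[-r, r]\<^sup>d\<close>; its mean is \<open>p s w\<close>.
  Averaging over a uniform \<open>w\<close> and integrating by parts with weight \<open>r\<^sup>2 - w\<^sub>j\<^sup>2\<close>, an accurate output must
  have correlation at least of order \<open>r\<^sup>2 d\<close> with the sum of the (rescaled) scores of the \<open>n\<close> persons.
  On the other hand, privacy lets one replace a person by a fresh copy, so the correlation with one
  person's score is at most of order \<open>\<epsilon> \<cdot> |output| \<cdot> min {mp, \<surd>(mp)}\<close> up to the \<open>\<delta>\<close> term, and without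
  privacy the Cauchy-Schwarz inequality bounds the total by \<open>|output| \<cdot> \<surd>(nmpd)\<close>.
  The choice \<open>p = 1\<close> gives the first two terms, and \<open>p \<sim> \<alpha> powr (k / (k - 1))\<close>, \<open>s \<sim> p powr (-1 / k)\<close> the third.
  If \<open>\<alpha>\<close> is of order at least \<open>\<surd>d\<close>, so that the moment bound leaves no room for this family, \<open>d\<close> is
  bounded and group privacy between two point masses gives \<open>n \<epsilon> \<ge> 1/3\<close>, which implies all three terms.
  The \<open>\<delta>\<close> terms are absorbed by \<open>\<delta> = O(1/(n\<surd>m))\<close>, and no logarithmic factor is lost.
\<close>

section \<open>Finite products and finitely supported measures\<close>

text \<open>Accuracy is only guaranteed with probability 2/3, so a third of the time the output may
  point away from \<open>w\<close>. Outputs are therefore cut off at about the norm of the largest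
  mean, which caps the loss from failure, but this loss can still exceed the gain when
  \<open>w\<close> is short. A positive correlation is left only on average over the cube, where the
  squared norm of \<open>w\<close> has mean \<open>r\<^sup>2 * d / 3\<close>. The margin is small,
  hence the odd numerical constants. The prior serves only to pick one \<open>w\<close> with large
  correlation; all later bounds hold at this fixed \<open>w\<close>.

  The atom at 0 separates two scalings. A zero sample carries no information about \<open>w\<close>,
  so the mean absolute score of a sample is of order \<open>p\<close> instead of
  \<open>sqrt p\<close>, while a moment of order \<open>p * s powr k\<close> lets \<open>s\<close>
  grow like \<open>p powr (-1/k)\<close>, with signal \<open>p * s = p powr (1 - 1/k)\<close>.
  Setting this to order \<open>\<alpha>\<close> gives the exponent \<open>k / (k - 1)\<close>.

  All input distributions are finitely supported, so expectations over samples are finite sums;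
  integrals remain only for the output of the mechanism and for the prior.\<close>

lemma sum_PiE_prod_mult:
  fixes q f :: "'i \<Rightarrow> 'a \<Rightarrow> real"
  assumes "finite I" "\<And>i. i \<in> I \<Longrightarrow> finite (A i)"
  shows "(\<Sum>x\<in>PiE I A. (\<Prod>i\<in>I. q i (x i)) * (\<Prod>i\<in>I. f i (x i)))
       = (\<Prod>i\<in>I. \<Sum>a\<in>A i. q i a * f i a)"
  using assms by (simp add: prod_sum_PiE prod.distrib)

text \<open>Independent coordinates with laws \<open>q i\<close> that need not be equal. No sign
  condition is imposed, so the identities below hold for the sign weights at every parameter
  \<open>w\<close>, also outside the cube.\<close>

locale finite_product =
  fixes I :: "'i set" and A :: "'i \<Rightarrow> 'a set" and q :: "'i \<Rightarrow> 'a \<Rightarrow> real"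
  assumes finI: "finite I" and finA: "\<And>i. i \<in> I \<Longrightarrow> finite (A i)"
    and sum1: "\<And>i. i \<in> I \<Longrightarrow> (\<Sum>a\<in>A i. q i a) = 1"
begin

definition wt :: "('i \<Rightarrow> 'a) \<Rightarrow> real" where
  "wt x = (\<Prod>i\<in>I. q i (x i))"

lemma sum_wt_prod:
  "(\<Sum>x\<in>PiE I A. wt x * (\<Prod>i\<in>I. f i (x i))) = (\<Prod>i\<in>I. \<Sum>a\<in>A i. q i a * f i a)"
  unfolding wt_def using finI finA by (rule sum_PiE_prod_mult)

lemma sum_wt: "(\<Sum>x\<in>PiE I A. wt x) = 1"
  using sum_wt_prod[of "\<lambda>_ _. 1"] by (simp add: sum1)

lemma sum_wt_marginal:
  assumes "k \<in> I"
  shows "(\<Sum>x\<in>PiE I A. wt x * f (x k)) = (\<Sum>a\<in>A k. q k a * f a)"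
proof -
  have 1: "(\<Prod>i\<in>I. if i = k then f (x i) else 1) = f (x k)" for x :: "'i \<Rightarrow> 'a"
    using assms finI by (simp add: prod.delta)
  have "(\<Prod>i\<in>I. \<Sum>a\<in>A i. q i a * (if i = k then f a else 1))
      = (\<Prod>i\<in>I. if i = k then (\<Sum>a\<in>A k. q k a * f a) else 1)"
    by (rule prod.cong) (auto simp: sum1)
  also have "\<dots> = (\<Sum>a\<in>A k. q k a * f a)"
    using assms finI by (simp add: prod.delta)
  finally show ?thesis
    using sum_wt_prod[of "\<lambda>i a. if i = k then f a else 1"] 1 by simp
qed

lemma sum_wt_pair:
  assumes "k \<in> I" "l \<in> I" "k \<noteq> l"
  shows "(\<Sum>x\<in>PiE I A. wt x * (f (x k) * g (x l)))
       = (\<Sum>a\<in>A k. q k a * f a) * (\<Sum>a\<in>A l. q l a * g a)"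
proof -
  define F where "F = (\<lambda>i a. if i = k then f a else if i = l then g a else 1)"
  have split: "(\<Prod>i\<in>I. h i) = h k * h l" if "\<And>i. i \<in> I \<Longrightarrow> i \<noteq> k \<Longrightarrow> i \<noteq> l \<Longrightarrow> h i = 1"
    for h :: "'i \<Rightarrow> real"
  proof -
    have "(\<Prod>i\<in>I. h i) = (\<Prod>i\<in>{k,l}. h i)"
      using assms finI that by (intro prod.mono_neutral_right) auto
    then show ?thesis using assms by simp
  qed
  have "(\<Prod>i\<in>I. F i (x i)) = f (x k) * g (x l)" for x
    using assms by (subst split) (auto simp: F_def)
  moreover have "(\<Prod>i\<in>I. \<Sum>a\<in>A i. q i a * F i a)
      = (\<Sum>a\<in>A k. q k a * f a) * (\<Sum>a\<in>A l. q l a * g a)"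
    using assms by (subst split) (auto simp: F_def sum1)
  ultimately show ?thesis
    using sum_wt_prod[of F] by simp
qed

text \<open>After expanding the square, the off-diagonal terms factor by independence and vanish
  because the summands are centred.\<close>

lemma sum_wt_variance:
  assumes "\<And>i. i \<in> I \<Longrightarrow> (\<Sum>a\<in>A i. q i a * f i a) = 0"
  shows "(\<Sum>x\<in>PiE I A. wt x * (\<Sum>i\<in>I. f i (x i))\<^sup>2) = (\<Sum>i\<in>I. \<Sum>a\<in>A i. q i a * (f i a)\<^sup>2)"
proof -
  have "(\<Sum>x\<in>PiE I A. wt x * (\<Sum>i\<in>I. f i (x i))\<^sup>2)
      = (\<Sum>i\<in>I. \<Sum>j\<in>I. \<Sum>x\<in>PiE I A. wt x * (f i (x i) * f j (x j)))"
  proof -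
    have "(\<Sum>x\<in>PiE I A. wt x * (\<Sum>i\<in>I. f i (x i))\<^sup>2)
        = (\<Sum>x\<in>PiE I A. \<Sum>i\<in>I. \<Sum>j\<in>I. wt x * (f i (x i) * f j (x j)))"
      by (simp only: power2_eq_square sum_product) (simp only: sum_distrib_left)
    also have "\<dots> = (\<Sum>i\<in>I. \<Sum>x\<in>PiE I A. \<Sum>j\<in>I. wt x * (f i (x i) * f j (x j)))"
      by (rule sum.swap)
    also have "\<dots> = (\<Sum>i\<in>I. \<Sum>j\<in>I. \<Sum>x\<in>PiE I A. wt x * (f i (x i) * f j (x j)))"
      by (intro sum.cong refl sum.swap)
    finally show ?thesis .
  qed
  also have "\<dots> = (\<Sum>i\<in>I. \<Sum>j\<in>I. if j = i then \<Sum>a\<in>A i. q i a * (f i a)\<^sup>2 else 0)"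
  proof (intro sum.cong refl)
    fix i j assume "i \<in> I" "j \<in> I"
    then show "(\<Sum>x\<in>PiE I A. wt x * (f i (x i) * f j (x j)))
        = (if j = i then \<Sum>a\<in>A i. q i a * (f i a)\<^sup>2 else 0)"
      using sum_wt_marginal[of i "\<lambda>a. f i a * f i a"] sum_wt_pair[of i j "f i" "f j"] assms
      by (auto simp: power2_eq_square)
  qed
  also have "\<dots> = (\<Sum>i\<in>I. \<Sum>a\<in>A i. q i a * (f i a)\<^sup>2)"
    using finI by (simp add: sum.delta)
  finally show ?thesis .
qed

text \<open>Swapping coordinate \<open>k\<close> with an independent fresh copy \<open>u\<close> is
  an involution that preserves the joint weight. This exchangeability turns a correlation with a
  person's own data into one with data that the mechanism never saw.\<close>

lemma sum_wt_resample:
  fixes F :: "('i \<Rightarrow> 'a) \<Rightarrow> 'a \<Rightarrow> real"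
  assumes k: "k \<in> I"
  shows "(\<Sum>x\<in>PiE I A. \<Sum>u\<in>A k. wt x * q k u * F (x(k := u)) (x k))
       = (\<Sum>x\<in>PiE I A. \<Sum>u\<in>A k. wt x * q k u * F x u)"
proof -
  have wt_upd: "wt (x(k := u)) * q k (x k) = wt x * q k u" for x u
  proof -
    have "(\<Prod>i\<in>I - {k}. q i ((x(k := u)) i)) = (\<Prod>i\<in>I - {k}. q i (x i))"
      by (rule prod.cong) auto
    then show ?thesis
      unfolding wt_def using k finI by (simp add: prod.remove[of I k])
  qed
  have "(\<Sum>(x,u)\<in>PiE I A \<times> A k. wt x * q k u * F (x(k := u)) (x k))
      = (\<Sum>(x,u)\<in>PiE I A \<times> A k. wt x * q k u * F x u)"
    using k
    by (intro sum.reindex_bij_witness[where i = "\<lambda>(x,u). (x(k := u), x k)"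
          and j = "\<lambda>(x,u). (x(k := u), x k)"]) (auto simp: wt_upd PiE_def extensional_def Pi_def)
  then show ?thesis by (simp add: sum.cartesian_product)
qed

end

lemma weighted_mean_sq_le:
  fixes q f :: "'a \<Rightarrow> real"
  assumes "\<And>a. a \<in> A \<Longrightarrow> 0 \<le> q a" "(\<Sum>a\<in>A. q a) = 1"
  shows "(\<Sum>a\<in>A. q a * f a)\<^sup>2 \<le> (\<Sum>a\<in>A. q a * (f a)\<^sup>2)"
proof -
  define \<mu> where "\<mu> = (\<Sum>a\<in>A. q a * f a)"
  have "0 \<le> (\<Sum>a\<in>A. q a * (f a - \<mu>)\<^sup>2)"
    using assms by (intro sum_nonneg) auto
  also have "\<dots> = (\<Sum>a\<in>A. q a * (f a)\<^sup>2) - 2 * \<mu> * (\<Sum>a\<in>A. q a * f a) + \<mu>\<^sup>2 * (\<Sum>a\<in>A. q a)"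
    by (simp add: sum_distrib_left sum_distrib_right power2_eq_square algebra_simps
        sum.distrib sum_subtractf)
  finally show ?thesis
    using assms by (simp add: \<mu>_def power2_eq_square)
qed

lemma weighted_mean_abs_le_sqrt:
  fixes q f :: "'a \<Rightarrow> real"
  assumes "\<And>a. a \<in> A \<Longrightarrow> 0 \<le> q a" "(\<Sum>a\<in>A. q a) = 1" "(\<Sum>a\<in>A. q a * (f a)\<^sup>2) \<le> b"
  shows "(\<Sum>a\<in>A. q a * \<bar>f a\<bar>) \<le> sqrt b"
  using weighted_mean_sq_le[of A q "\<lambda>a. \<bar>f a\<bar>"] assms by (intro real_le_rsqrt) auto

text \<open>The space of \<open>N\<close> may be infinite: point masses adding up to 1 are what
  concentrates \<open>N\<close> on \<open>A\<close>. In this way \<open>N\<close> keeps the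
  sigma-algebra of \<open>euclid d\<close> while its integrals become finite sums.\<close>

definition finite_dist :: "'a measure \<Rightarrow> 'a set \<Rightarrow> ('a \<Rightarrow> real) \<Rightarrow> bool" where
  "finite_dist N A q \<longleftrightarrow> prob_space N \<and> finite A \<and> (\<forall>a\<in>A. {a} \<in> sets N \<and> measure N {a} = q a)
     \<and> sum q A = 1"

lemma finite_dist_integral:
  fixes f :: "'a \<Rightarrow> real"
  assumes N: "finite_dist N A q" and f: "f \<in> borel_measurable N"
  shows "(\<integral>x. f x \<partial>N) = (\<Sum>a\<in>A. q a * f a)"
proof -
  interpret prob_space N using N by (simp add: finite_dist_def)
  have fin: "finite A" and sing: "\<And>a. a \<in> A \<Longrightarrow> {a} \<in> sets N" "\<And>a. a \<in> A \<Longrightarrow> measure N {a} = q a"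
    using N by (auto simp: finite_dist_def)
  have A: "A \<in> sets N"
    using sets.finite_UN[OF fin, of "\<lambda>a. {a}"] sing by simp
  have "measure N A = 1"
    using finite_measure_eq_sum_singleton[OF fin] sing N by (simp add: finite_dist_def)
  then have AE: "AE x in N. x \<in> A"
    using prob_eq_1[OF A] by simp
  have eq: "(\<Sum>a\<in>A. indicator {a} x * f a) = f x" if "x \<in> A" for x
    using that fin by (simp add: indicator_def if_distrib[of "\<lambda>z. z * _"] sum.delta cong: if_cong)
  have "(\<integral>x. f x \<partial>N) = (\<integral>x. (\<Sum>a\<in>A. indicator {a} x * f a) \<partial>N)"
    using AE sing f by (intro integral_cong_AE) (auto elim!: eventually_mono simp: eq)
  also have "\<dots> = (\<Sum>a\<in>A. \<integral>x. indicator {a} x * f a \<partial>N)"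
    using sing by (intro Bochner_Integration.integral_sum integrable_mult_left)
      (auto simp: integrable_indicator_iff emeasure_eq_measure)
  also have "\<dots> = (\<Sum>a\<in>A. q a * f a)"
    using sing sets.sets_into_space by (intro sum.cong) (auto simp: Int_absorb2)
  finally show ?thesis .
qed

lemma finite_dist_PiM:
  assumes N: "finite_dist N A q" and I: "finite I"
  shows "finite_dist (PiM I (\<lambda>_. N)) (PiE I (\<lambda>_. A)) (\<lambda>x. \<Prod>i\<in>I. q (x i))"
proof -
  interpret N: prob_space N using N by (simp add: finite_dist_def)
  interpret finite_product_prob_space "\<lambda>_. N" I by unfold_locales (rule I)
  interpret P: prob_space "PiM I (\<lambda>_. N)" by (rule prob_space_PiM) (rule N.prob_space_axioms)
  have sing: "\<And>a. a \<in> A \<Longrightarrow> {a} \<in> sets N" "\<And>a. a \<in> A \<Longrightarrow> measure N {a} = q a"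
    using N by (auto simp: finite_dist_def)
  have "{x} \<in> sets (PiM I (\<lambda>_. N)) \<and> measure (PiM I (\<lambda>_. N)) {x} = (\<Prod>i\<in>I. q (x i))"
    if x: "x \<in> PiE I (\<lambda>_. A)" for x
  proof -
    have "{x} = PiE I (\<lambda>i. {x i})"
      using x PiE_singleton[of x I] by (auto simp: PiE_def)
    moreover have "measure (PiM I (\<lambda>_. N)) (PiE I (\<lambda>i. {x i})) = (\<Prod>i\<in>I. measure N {x i})"
      using x sing by (intro finite_measure_PiM_emb) auto
    ultimately show ?thesis
      using x sing I by (auto intro!: sets_PiM_I_finite prod.cong sing(2) dest: PiE_mem)
  qed
  moreover have "(\<Sum>x\<in>PiE I (\<lambda>_. A). \<Prod>i\<in>I. q (x i)) = 1"
    using N I prod_sum_PiE[of I "\<lambda>_. A" "\<lambda>_. q"] by (simp add: finite_dist_def)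
  ultimately show ?thesis
    using N I P.prob_space_axioms by (auto simp: finite_dist_def intro!: finite_PiE)
qed

section \<open>Approximate privacy and correlation\<close>

text \<open>A discrete layer-cake formula: the inequality for sets is applied to \<open>K\<close>
  equally spaced superlevel sets of \<open>f\<close>. Each level has weight \<open>T / K\<close>, so
  the additive errors sum to \<open>\<delta> * T\<close> for every \<open>K\<close>, and the
  rounding error \<open>T / K\<close> vanishes as \<open>K\<close> grows.\<close>

lemma DP_integral_nonneg:
  fixes f :: "'a \<Rightarrow> real"
  assumes P: "prob_space P" "sets P = sets R" and Q: "prob_space Q" "sets Q = sets R"
    and DP: "\<And>S. S \<in> sets R \<Longrightarrow> measure P S \<le> exp \<epsilon> * measure Q S + \<delta>"
    and f[measurable]: "f \<in> borel_measurable R" and f0: "\<And>y. 0 \<le> f y" and fT: "\<And>y. f y \<le> T"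
    and \<epsilon>: "0 \<le> \<epsilon>"
  shows "(\<integral>y. f y \<partial>P) \<le> exp \<epsilon> * (\<integral>y. f y \<partial>Q) + \<delta> * T"
proof -
  interpret P: prob_space P by fact
  interpret Q: prob_space Q by fact
  have [measurable]: "f \<in> borel_measurable P" "f \<in> borel_measurable Q"
    by (subst measurable_cong_sets[OF P(2) refl], rule f)
      (subst measurable_cong_sets[OF Q(2) refl], rule f)
  have intP: "integrable P f" and intQ: "integrable Q f"
    using f0 fT by (auto intro!: P.integrable_const_bound[of _ T] Q.integrable_const_bound[of _ T])
  have "0 \<le> T" using f0 fT order_trans by blast
  have "\<forall>y. f y = 0" if "T = 0" using f0 fT that by (metis antisym)
  moreover have ?thesis if "0 < T"
  proof -
    define S where "S = (\<lambda>K k. {y\<in>space R. real k * T / real K \<le> f y})"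
    have S[measurable]: "S K k \<in> sets R" for K k
      unfolding S_def by measurable
    define h where "h = (\<lambda>K y. \<Sum>k\<in>{1..K}. T / real K * indicator (S K k) y)"
    have h: "h K y \<le> f y \<and> f y \<le> h K y + T / real K" if "0 < K" "y \<in> space R" for K :: nat and y
    proof -
      \<comment> \<open>A point \<open>y\<close> lies in exactly the levels
        \<open>k \<le> z\<close>, so \<open>h K y\<close> is \<open>f y\<close> rounded down to a
        multiple of \<open>T / K\<close>.\<close>
      define z where "z = f y * real K / T"
      have z: "0 \<le> z" "z \<le> real K"
        using f0[of y] fT[of y] \<open>0 < T\<close> \<open>0 < K\<close> by (auto simp: z_def field_simps)
      have "(\<Sum>k\<in>{1..K}. indicator (S K k) y :: real) = real (card ({1..K} \<inter> {k. y \<in> S K k}))"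
        by (simp add: indicator_def sum.If_cases)
      also have "{1..K} \<inter> {k. y \<in> S K k} = {1..nat \<lfloor>z\<rfloor>}"
      proof -
        have "y \<in> S K k \<longleftrightarrow> real k \<le> z" for k
          using that \<open>0 < T\<close> by (auto simp: S_def z_def field_simps)
        moreover have "real k \<le> z \<longleftrightarrow> k \<le> nat \<lfloor>z\<rfloor>" for k
          using z by (simp add: le_nat_floor le_nat_iff le_floor_iff nat_le_iff)
        moreover have "k \<le> K" if "k \<le> nat \<lfloor>z\<rfloor>" for k
          using that z by linarith
        ultimately show ?thesis by auto
      qed
      finally have "(\<Sum>k\<in>{1..K}. indicator (S K k) y :: real) = real_of_int \<lfloor>z\<rfloor>"
        using z by simp
      then have "h K y = T / real K * real_of_int \<lfloor>z\<rfloor>"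
        by (simp only: h_def sum_distrib_left[symmetric])
      moreover have "f y = T / real K * z"
        using \<open>0 < T\<close> \<open>0 < K\<close> by (simp add: z_def)
      moreover have "T / real K * real_of_int \<lfloor>z\<rfloor> \<le> T / real K * z"
        "T / real K * z \<le> T / real K * (real_of_int \<lfloor>z\<rfloor> + 1)"
        using \<open>0 < T\<close> by (intro mult_left_mono; simp)+
      ultimately show ?thesis by (simp add: algebra_simps)
    qed
    have *: "(\<integral>y. f y \<partial>P) \<le> exp \<epsilon> * (\<integral>y. f y \<partial>Q) + \<delta> * T + T / real K" if "0 < K" for K
    proof -
      have SP[measurable]: "S K k \<in> sets P" "S K k \<in> sets Q" for k
        using S P Q by auto
      have hP: "integrable P (h K)" and hQ: "integrable Q (h K)"
        unfolding h_def by (auto intro!: integrable_real_mult_indicator simp: P.emeasure_eq_measure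
            Q.emeasure_eq_measure)
      have ihP: "(\<integral>y. h K y \<partial>P) = (\<Sum>k\<in>{1..K}. T / real K * measure P (S K k))"
        and ihQ: "(\<integral>y. h K y \<partial>Q) = (\<Sum>k\<in>{1..K}. T / real K * measure Q (S K k))"
        using sets.sets_into_space[OF SP(1)] sets.sets_into_space[OF SP(2)] unfolding h_def
        by (subst Bochner_Integration.integral_sum;
            auto simp: P.emeasure_eq_measure Q.emeasure_eq_measure Int_absorb1 Int_absorb2)+
      have "(\<integral>y. f y \<partial>P) \<le> (\<integral>y. h K y + T / real K \<partial>P)"
        using intP hP h[OF that] sets_eq_imp_space_eq[OF P(2)] by (intro integral_mono) auto
      also have "\<dots> = (\<Sum>k\<in>{1..K}. T / real K * measure P (S K k)) + T / real K"
        using hP by (simp add: ihP P.prob_space)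
      also have "\<dots> \<le> (\<Sum>k\<in>{1..K}. T / real K * (exp \<epsilon> * measure Q (S K k) + \<delta>)) + T / real K"
        using \<open>0 < T\<close> by (intro add_right_mono sum_mono mult_left_mono DP) auto
      also have "\<dots> = exp \<epsilon> * (\<integral>y. h K y \<partial>Q) + \<delta> * T + T / real K"
        using that by (simp add: ihQ sum.distrib sum_distrib_left algebra_simps)
      also have "(\<integral>y. h K y \<partial>Q) \<le> (\<integral>y. f y \<partial>Q)"
        using intQ hQ h[OF that] sets_eq_imp_space_eq[OF Q(2)] by (intro integral_mono) auto
      finally show ?thesis by simp
    qed
    have "(\<lambda>K. exp \<epsilon> * (\<integral>y. f y \<partial>Q) + \<delta> * T + T / real K)
        \<longlonglongrightarrow> exp \<epsilon> * (\<integral>y. f y \<partial>Q) + \<delta> * T + 0"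
      by (intro tendsto_intros lim_const_over_n)
    then show ?thesis
      using * by (intro LIMSEQ_le_const[of _ _ "\<integral>y. f y \<partial>P"]) (auto intro!: exI[of _ 1])
  qed
  ultimately show ?thesis using \<open>0 \<le> T\<close> by (cases "T = 0") auto
qed

text \<open>The positive part of \<open>f\<close> is moved from \<open>P\<close> to \<open>Q\<close>
  by \<open>PQ\<close>, the negative part by the reverse inequality \<open>QP\<close>. The
  \<open>\<epsilon>\<close> error is relative to the mean of the absolute value; only the
  \<open>\<delta>\<close> error sees the sup bound \<open>T\<close>, which may be far
  larger.\<close>

lemma DP_integral:
  fixes f :: "'a \<Rightarrow> real"
  assumes P: "prob_space P" "sets P = sets R" and Q: "prob_space Q" "sets Q = sets R"
    and PQ: "\<And>S. S \<in> sets R \<Longrightarrow> measure P S \<le> exp \<epsilon> * measure Q S + \<delta>"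
    and QP: "\<And>S. S \<in> sets R \<Longrightarrow> measure Q S \<le> exp \<epsilon> * measure P S + \<delta>"
    and f[measurable]: "f \<in> borel_measurable R" and fT: "\<And>y. \<bar>f y\<bar> \<le> T"
    and \<epsilon>: "0 \<le> \<epsilon>" "\<epsilon> \<le> 1" and \<delta>: "0 \<le> \<delta>"
  shows "(\<integral>y. f y \<partial>P) \<le> (\<integral>y. f y \<partial>Q) + 2 * \<epsilon> * (\<integral>y. \<bar>f y\<bar> \<partial>Q) + 2 * \<delta> * T"
proof -
  interpret P: prob_space P by fact
  interpret Q: prob_space Q by fact
  have [measurable]: "f \<in> borel_measurable P" "f \<in> borel_measurable Q"
    by (subst measurable_cong_sets[OF P(2) refl], rule f)
      (subst measurable_cong_sets[OF Q(2) refl], rule f)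
  define u where "u = (\<lambda>y. max 0 (f y))"
  define l where "l = (\<lambda>y. max 0 (- f y))"
  have ul: "f y = u y - l y" "\<bar>f y\<bar> = u y + l y" "0 \<le> u y" "0 \<le> l y" "u y \<le> T" "l y \<le> T" for y
    using fT[of y] by (auto simp: u_def l_def)
  have [measurable]: "u \<in> borel_measurable R" "l \<in> borel_measurable R"
    "u \<in> borel_measurable P" "l \<in> borel_measurable P" "u \<in> borel_measurable Q" "l \<in> borel_measurable Q"
    unfolding u_def l_def by measurable
  have int: "integrable P u" "integrable P l" "integrable Q u" "integrable Q l"
    using ul by (auto intro!: P.integrable_const_bound[of _ T] Q.integrable_const_bound[of _ T])
  define p1 where "p1 = (\<integral>y. u y \<partial>P)"
  define p2 where "p2 = (\<integral>y. l y \<partial>P)"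
  define q1 where "q1 = (\<integral>y. u y \<partial>Q)"
  define q2 where "q2 = (\<integral>y. l y \<partial>Q)"
  have T: "0 \<le> T" using fT abs_ge_zero order_trans by blast
  have pos: "0 \<le> q1" "0 \<le> q2" using ul by (auto simp: q1_def q2_def)
  have e1: "exp \<epsilon> \<le> 1 + 2 * \<epsilon>"
    using exp_bound[of \<epsilon>] \<epsilon> mult_left_le[of \<epsilon> \<epsilon>] by (simp add: power2_eq_square)
  have e2: "1 - exp (- \<epsilon>) \<le> 2 * \<epsilon>" "exp (- \<epsilon>) \<le> 1"
    using exp_ge_add_one_self[of "- \<epsilon>"] \<epsilon> by auto
  have a: "p1 \<le> exp \<epsilon> * q1 + \<delta> * T"
    unfolding p1_def q1_def using DP_integral_nonneg[OF P Q PQ, of u T] ul \<epsilon> by auto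
  have "q2 \<le> exp \<epsilon> * p2 + \<delta> * T"
    unfolding p2_def q2_def using DP_integral_nonneg[OF Q P QP, of l T] ul \<epsilon> by auto
  then have "exp (- \<epsilon>) * q2 \<le> exp (- \<epsilon>) * (exp \<epsilon> * p2 + \<delta> * T)"
    by (intro mult_left_mono) auto
  also have "\<dots> = p2 + exp (- \<epsilon>) * (\<delta> * T)"
    by (simp add: algebra_simps exp_minus)
  also have "\<dots> \<le> p2 + 1 * (\<delta> * T)"
    using e2 \<delta> T by (intro add_left_mono mult_right_mono) auto
  finally have b: "exp (- \<epsilon>) * q2 \<le> p2 + \<delta> * T" by simp
  have "(exp \<epsilon> - 1) * q1 \<le> 2 * \<epsilon> * q1" "(1 - exp (- \<epsilon>)) * q2 \<le> 2 * \<epsilon> * q2"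
    using pos e1 e2 by (auto intro!: mult_right_mono)
  with a b have "p1 - p2 \<le> q1 - q2 + 2 * \<epsilon> * (q1 + q2) + 2 * \<delta> * T"
    by (simp add: algebra_simps)
  moreover have "(\<integral>y. f y \<partial>P) = p1 - p2" "(\<integral>y. f y \<partial>Q) = q1 - q2" "(\<integral>y. \<bar>f y\<bar> \<partial>Q) = q1 + q2"
    unfolding ul(2) unfolding ul(1) using int by (auto simp: p1_def p2_def q1_def q2_def)
  ultimately show ?thesis by simp
qed

text \<open>Privacy bounds the price of replacing the data of person \<open>k\<close> by a fresh
  copy. After the exchange of \<open>sum_wt_resample\<close>, the statistic \<open>\<phi> u\<close>
  is independent of the data set and averages to 0 by \<open>\<phi>0\<close>, so only the two error
  terms of \<open>DP_integral\<close> survive.\<close>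

lemma (in finite_product) private_correlation:
  fixes K :: "('i \<Rightarrow> 'a) \<Rightarrow> 'y measure" and \<phi> :: "'a \<Rightarrow> 'y \<Rightarrow> real"
  assumes q0: "\<And>i a. i \<in> I \<Longrightarrow> a \<in> A i \<Longrightarrow> 0 \<le> q i a"
    and k: "k \<in> I"
    and K: "\<And>x. x \<in> PiE I A \<Longrightarrow> prob_space (K x) \<and> sets (K x) = sets R"
    and DP: "\<And>x x' S. \<lbrakk>x \<in> PiE I A; x' \<in> PiE I A; \<And>i. i \<noteq> k \<Longrightarrow> x i = x' i; S \<in> sets R\<rbrakk>
      \<Longrightarrow> measure (K x) S \<le> exp \<epsilon> * measure (K x') S + \<delta>"
    and \<phi>[measurable]: "\<And>u. u \<in> A k \<Longrightarrow> \<phi> u \<in> borel_measurable R"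
    and \<phi>T: "\<And>u y. u \<in> A k \<Longrightarrow> \<bar>\<phi> u y\<bar> \<le> T u"
    and \<phi>0: "\<And>y. (\<Sum>u\<in>A k. q k u * \<phi> u y) = 0"
    and \<phi>1: "\<And>y. (\<Sum>u\<in>A k. q k u * \<bar>\<phi> u y\<bar>) \<le> \<beta>"
    and \<epsilon>: "0 \<le> \<epsilon>" "\<epsilon> \<le> 1" and \<delta>: "0 \<le> \<delta>"
  shows "(\<Sum>x\<in>PiE I A. wt x * (\<integral>y. \<phi> (x k) y \<partial>K x)) \<le> 2 * \<epsilon> * \<beta> + 2 * \<delta> * (\<Sum>u\<in>A k. q k u * T u)"
proof -
  define F where "F = (\<lambda>x u. (\<integral>y. \<phi> u y \<partial>K x) + 2 * \<epsilon> * (\<integral>y. \<bar>\<phi> u y\<bar> \<partial>K x) + 2 * \<delta> * T u)"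
  have wt0: "0 \<le> wt x" if "x \<in> PiE I A" for x
    unfolding wt_def using that q0 by (intro prod_nonneg) auto
  have upd: "x(k := u) \<in> PiE I A" if "x \<in> PiE I A" "u \<in> A k" for x u
    using that k by (auto simp: PiE_def extensional_def)
  have int: "integrable (K x) (\<phi> u)" if "x \<in> PiE I A" "u \<in> A k" for x u
  proof -
    interpret prob_space "K x" using K that by auto
    have "sets (K x) = sets R" using K that by auto
    then have "\<phi> u \<in> borel_measurable (K x)"
      using \<phi>[OF that(2)] measurable_cong_sets[of "K x" R borel borel] by simp
    then show ?thesis using \<phi>T that by (intro integrable_const_bound[of _ "T u"]) auto
  qed
  have step: "(\<integral>y. \<phi> (x k) y \<partial>K x) \<le> F (x(k := u)) (x k)" if "x \<in> PiE I A" "u \<in> A k" for x u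
    unfolding F_def using that k K upd \<epsilon> \<delta> \<phi>T[of "x k"] \<phi>[of "x k"] PiE_mem[OF that(1) k]
    by (intro DP_integral[where R = R] DP) (auto split: if_splits)
  have inner: "(\<Sum>u\<in>A k. q k u * F x u) \<le> 2 * \<epsilon> * \<beta> + 2 * \<delta> * (\<Sum>u\<in>A k. q k u * T u)"
    if x: "x \<in> PiE I A" for x
  proof -
    interpret prob_space "K x" using K x by auto
    have "(\<Sum>u\<in>A k. q k u * F x u) = (\<integral>y. (\<Sum>u\<in>A k. q k u * \<phi> u y) \<partial>K x)
        + 2 * \<epsilon> * (\<integral>y. (\<Sum>u\<in>A k. q k u * \<bar>\<phi> u y\<bar>) \<partial>K x) + 2 * \<delta> * (\<Sum>u\<in>A k. q k u * T u)"
      using int[OF x] by (simp add: F_def sum.distrib sum_distrib_left algebra_simps)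
    also have "(\<integral>y. (\<Sum>u\<in>A k. q k u * \<phi> u y) \<partial>K x) = 0"
      by (simp add: \<phi>0)
    also have "(\<integral>y. (\<Sum>u\<in>A k. q k u * \<bar>\<phi> u y\<bar>) \<partial>K x) \<le> (\<integral>y. \<beta> \<partial>K x)"
      using \<phi>1 int[OF x] by (intro integral_mono) auto
    finally show ?thesis using \<epsilon> by (simp add: prob_space mult_left_mono)
  qed
  have "(\<Sum>x\<in>PiE I A. wt x * (\<integral>y. \<phi> (x k) y \<partial>K x))
      = (\<Sum>x\<in>PiE I A. \<Sum>u\<in>A k. wt x * q k u * (\<integral>y. \<phi> (x k) y \<partial>K x))"
    using sum1[OF k] by (simp add: sum_distrib_left[symmetric] sum_distrib_right[symmetric])
  also have "\<dots> \<le> (\<Sum>x\<in>PiE I A. \<Sum>u\<in>A k. wt x * q k u * F (x(k := u)) (x k))"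
    using wt0 q0 k step by (intro sum_mono mult_left_mono) auto
  also have "\<dots> = (\<Sum>x\<in>PiE I A. wt x * (\<Sum>u\<in>A k. q k u * F x u))"
    unfolding sum_wt_resample[OF k] by (simp add: sum_distrib_left mult.assoc)
  also have "\<dots> \<le> (\<Sum>x\<in>PiE I A. wt x * (2 * \<epsilon> * \<beta> + 2 * \<delta> * (\<Sum>u\<in>A k. q k u * T u)))"
    using wt0 inner by (intro sum_mono mult_left_mono) auto
  also have "\<dots> = 2 * \<epsilon> * \<beta> + 2 * \<delta> * (\<Sum>u\<in>A k. q k u * T u)"
    unfolding sum_distrib_right[symmetric] sum_wt by simp
  finally show ?thesis .
qed

section \<open>Integration by parts over the prior\<close>

text \<open>The integrand is the derivative of \<open>(r\<^sup>2 - t\<^sup>2) * F t\<close>, which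
  is 0 at both ends.\<close>

lemma integral_weighted_deriv_zero:
  fixes F F' :: "real \<Rightarrow> real"
  assumes r: "0 < r"
    and D: "\<And>t. t \<in> {-r..r} \<Longrightarrow> (F has_real_derivative F' t) (at t)"
    and [measurable]: "F \<in> borel_measurable borel" "F' \<in> borel_measurable borel"
    and bnd: "\<And>t. t \<in> {-r..r} \<Longrightarrow> \<bar>F t\<bar> \<le> C \<and> \<bar>F' t\<bar> \<le> C"
  shows "(\<integral>t. indicator {-r..r} t * ((r\<^sup>2 - t\<^sup>2) * F' t - 2 * t * F t) \<partial>lborel) = 0"
proof -
  define h where "h = (\<lambda>t. (r\<^sup>2 - t\<^sup>2) * F' t - 2 * t * F t)"
  have [measurable]: "h \<in> borel_measurable borel" unfolding h_def by measurable
  have hb: "\<bar>h t\<bar> \<le> r\<^sup>2 * C + 2 * r * C" if t: "t \<in> {-r..r}" for t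
  proof -
    have "t\<^sup>2 \<le> r\<^sup>2" using t r by (intro abs_le_square_iff[THEN iffD1]) auto
    then have "\<bar>(r\<^sup>2 - t\<^sup>2) * F' t\<bar> \<le> r\<^sup>2 * C"
      unfolding abs_mult using bnd[OF t] by (intro mult_mono) auto
    moreover have "\<bar>2 * t * F t\<bar> \<le> 2 * r * C"
      unfolding abs_mult using bnd[OF t] t r by (intro mult_mono) auto
    ultimately show ?thesis unfolding h_def by linarith
  qed
  have "(h has_integral ((r\<^sup>2 - r\<^sup>2) * F r - (r\<^sup>2 - (-r)\<^sup>2) * F (-r))) {-r..r}"
  proof (rule fundamental_theorem_of_calculus)
    fix t assume t: "t \<in> {-r..r}"
    have "((\<lambda>t. (r\<^sup>2 - t\<^sup>2) * F t) has_real_derivative h t) (at t)"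
      unfolding h_def by (rule derivative_eq_intros D[OF t] refl | simp add: algebra_simps)+
    then show "((\<lambda>t. (r\<^sup>2 - t\<^sup>2) * F t) has_vector_derivative h t) (at t within {-r..r})"
      by (simp add: has_real_derivative_iff_has_vector_derivative has_vector_derivative_at_within)
  qed (use r in auto)
  then have "integral {-r..r} h = 0" by (simp add: integral_unique)
  moreover have "set_integrable lborel {-r..r} h"
    unfolding set_integrable_def
  proof (rule Bochner_Integration.integrable_bound[where f = "\<lambda>t. indicator {-r..r} t * (r\<^sup>2 * C + 2 * r * C)"])
    show "integrable lborel (\<lambda>t. indicator {-r..r} t * (r\<^sup>2 * C + 2 * r * C))"
      by (intro integrable_mult_left integrable_real_indicator) (auto simp: emeasure_lborel_Icc_eq)
    show "AE t in lborel. norm (indicator {-r..r} t *\<^sub>R h t) \<le> norm (indicator {-r..r} t * (r\<^sup>2 * C + 2 * r * C))"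
      using hb by (intro AE_I2) (force simp: indicator_def)
  qed measurable
  ultimately show ?thesis
    using set_borel_integral_eq_integral(2)[of "{-r..r}" h]
    by (simp add: set_lebesgue_integral_def h_def)
qed

text \<open>Averaging over the uniform prior on the cube, each summand integrates to zero by parts: the
  weight \<open>r\<^sup>2 - (w j)\<^sup>2\<close> vanishes on the boundary.\<close>

lemma fingerprinting_point:
  fixes G G' :: "nat \<Rightarrow> (nat \<Rightarrow> real) \<Rightarrow> real"
  assumes r: "0 < r"
    and D: "\<And>j w. \<lbrakk>j < d; w \<in> PiE {..<d} (\<lambda>_. {-r..r})\<rbrakk>
      \<Longrightarrow> ((\<lambda>t. G j (w(j := t))) has_real_derivative G' j w) (at (w j))"
    and meas: "\<And>j. j < d \<Longrightarrow> G j \<in> borel_measurable (PiM {..<d} (\<lambda>_. borel))"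
      "\<And>j. j < d \<Longrightarrow> G' j \<in> borel_measurable (PiM {..<d} (\<lambda>_. borel))"
    and bnd: "\<And>j w. \<lbrakk>j < d; w \<in> PiE {..<d} (\<lambda>_. {-r..r})\<rbrakk> \<Longrightarrow> \<bar>G j w\<bar> \<le> C \<and> \<bar>G' j w\<bar> \<le> C"
  shows "\<exists>w\<in>PiE {..<d} (\<lambda>_. {-r..r}). 0 \<le> (\<Sum>j<d. (r\<^sup>2 - (w j)\<^sup>2) * G' j w - 2 * w j * G j w)"
proof (rule ccontr)
  define U where "U = density lborel (\<lambda>x. ennreal (indicator {-r..r} x / (2 * r)))"
  have sU[simp]: "sets U = sets borel" by (simp add: U_def)
  have spU[simp]: "space U = UNIV" by (simp add: U_def)
  have emU: "emeasure U {-r..r} = 1"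
  proof -
    have "emeasure U {-r..r} = (\<integral>\<^sup>+x. ennreal (1 / (2 * r)) * indicator {-r..r} x \<partial>lborel)"
      unfolding U_def by (subst emeasure_density) (auto intro!: nn_integral_cong simp: indicator_def)
    also have "\<dots> = ennreal (1 / (2 * r)) * ennreal (2 * r)"
      using r by (subst nn_integral_cmult_indicator) auto
    also have "\<dots> = 1" using r by (simp add: ennreal_mult[symmetric])
    finally show ?thesis .
  qed
  have "emeasure U (space U) = 1"
  proof -
    have "emeasure U UNIV = emeasure U {-r..r}"
      unfolding U_def by (simp add: emeasure_density) (auto intro!: nn_integral_cong simp: indicator_def)
    then show ?thesis using emU by simp
  qed
  then interpret U: prob_space U by (rule prob_spaceI)
  have AEU: "AE x in U. x \<in> {-r..r}"
    using U.prob_eq_1[of "{-r..r}"] emU by (simp add: U.emeasure_eq_measure)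
  interpret product_prob_space "\<lambda>_. U" "{..<d}" ..
  define Q where "Q = (\<lambda>J. PiM J (\<lambda>_::nat. U))"
  have AEQ: "AE w in Q J. w \<in> PiE J (\<lambda>_. {-r..r})" if "finite J" for J
  proof -
    have "AE w in Q J. \<forall>i\<in>J. w i \<in> {-r..r}"
      using that AEU unfolding Q_def
      by (intro AE_finite_allI AE_PiM_component[where P = "\<lambda>x. x \<in> {-r..r}"] U.prob_space_axioms) auto
    then show ?thesis
      using AE_space by eventually_elim (auto simp: Q_def space_PiM PiE_def)
  qed
  interpret Q: prob_space "Q {..<d}" unfolding Q_def by (rule prob_space_PiM) (rule U.prob_space_axioms)
  have setsQ: "sets (Q {..<d}) = sets (PiM {..<d} (\<lambda>_. borel))"
    unfolding Q_def by (rule sets_PiM_cong) auto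
  have mcong: "measurable (Q {..<d}) borel = measurable (PiM {..<d} (\<lambda>_. borel)) (borel :: real measure)"
    by (rule measurable_cong_sets[OF setsQ refl])
  have mG: "G j \<in> borel_measurable (Q {..<d})" if "j < d" for j
    unfolding mcong by (rule meas(1)[OF that])
  have mG': "G' j \<in> borel_measurable (Q {..<d})" if "j < d" for j
    unfolding mcong by (rule meas(2)[OF that])
  have mw: "(\<lambda>w. w j) \<in> borel_measurable (Q {..<d})" if "j < d" for j
    unfolding mcong by (rule measurable_component_singleton) (use that in simp)
  define f where "f = (\<lambda>j w. (r\<^sup>2 - (w j)\<^sup>2) * G' j w - 2 * w j * G j w)"
  have fb: "\<bar>f j w\<bar> \<le> r\<^sup>2 * C + 2 * r * C" if "j < d" "w \<in> PiE {..<d} (\<lambda>_. {-r..r})" for j w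
  proof -
    have t: "w j \<in> {-r..r}" by (rule PiE_mem[OF that(2)]) (use that(1) in simp)
    have "(w j)\<^sup>2 \<le> r\<^sup>2" using t r by (intro abs_le_square_iff[THEN iffD1]) auto
    then have "\<bar>(r\<^sup>2 - (w j)\<^sup>2) * G' j w\<bar> \<le> r\<^sup>2 * C"
      unfolding abs_mult using bnd[OF that] by (intro mult_mono) auto
    moreover have "\<bar>2 * w j * G j w\<bar> \<le> 2 * r * C"
      unfolding abs_mult using bnd[OF that] t r by (intro mult_mono) auto
    ultimately show ?thesis unfolding f_def by linarith
  qed
  have intf: "integrable (Q {..<d}) (f j)" if "j < d" for j
  proof (rule Q.integrable_const_bound)
    show "AE w in Q {..<d}. norm (f j w) \<le> r\<^sup>2 * C + 2 * r * C"
      using AEQ[of "{..<d}"] fb[OF that] by auto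
    show "f j \<in> borel_measurable (Q {..<d})"
      unfolding f_def using mG[OF that] mG'[OF that] mw[OF that]
      by (intro borel_measurable_diff borel_measurable_times borel_measurable_power) auto
  qed
  have zero: "(\<integral>w. f j w \<partial>Q {..<d}) = 0" if j: "j < d" for j
  proof -
    define J where "J = {..<d} - {j}"
    have ins: "insert j J = {..<d}" and J: "finite J" "j \<notin> J" using j by (auto simp: J_def)
    \<comment> \<open>Fubini with coordinate \<open>j\<close> innermost, so that the one-dimensional
      integration by parts applies on each line parallel to axis \<open>j\<close>.\<close>
    have "(\<integral>w. f j w \<partial>Q {..<d}) = (\<integral>x. (\<integral>t. f j (x(j := t)) \<partial>U) \<partial>Q J)"
      using product_integral_insert[OF J, of "f j"] intf[OF j] unfolding Q_def ins by simp
    also have "\<dots> = (\<integral>x. 0 \<partial>Q J)"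
    proof (rule Bochner_Integration.integral_cong_AE)
      have inn: "(\<integral>t. f j (x(j := t)) \<partial>U) = 0" if x: "x \<in> PiE J (\<lambda>_. {-r..r})" for x
      proof -
        have cube: "x(j := t) \<in> PiE {..<d} (\<lambda>_. {-r..r})" if "t \<in> {-r..r}" for t
          using x that ins by (auto simp: PiE_def extensional_def J_def Pi_def)
        have xs: "x(j := t) \<in> space (PiM {..<d} (\<lambda>_. borel))" for t
          using x ins by (auto simp: space_PiM PiE_def extensional_def J_def)
        have upd[measurable]: "(\<lambda>t. x(j := t)) \<in> borel \<rightarrow>\<^sub>M PiM {..<d} (\<lambda>_. borel)"
        proof (rule measurable_PiM_single')
          show "(\<lambda>t. (x(j := t)) i) \<in> borel_measurable borel" for i by (cases "i = j") auto
          show "(\<lambda>t i. (x(j := t)) i) \<in> space borel \<rightarrow> PiE {..<d} (\<lambda>_. space borel)"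
            using xs by (simp add: space_PiM fun_upd_def)
        qed
        have [measurable]: "(\<lambda>t. G j (x(j := t))) \<in> borel_measurable borel"
          "(\<lambda>t. G' j (x(j := t))) \<in> borel_measurable borel"
          using measurable_compose[OF upd meas(1)[OF j]] measurable_compose[OF upd meas(2)[OF j]] by auto
        have z: "(\<integral>t. indicator {-r..r} t * ((r\<^sup>2 - t\<^sup>2) * G' j (x(j := t)) - 2 * t * G j (x(j := t))) \<partial>lborel) = 0"
        proof (rule integral_weighted_deriv_zero[OF r])
          fix t assume "t \<in> {-r..r}"
          then show "((\<lambda>t. G j (x(j := t))) has_real_derivative G' j (x(j := t))) (at t)"
            using D[OF j cube[of t]] by simp
          show "\<bar>G j (x(j := t))\<bar> \<le> C \<and> \<bar>G' j (x(j := t))\<bar> \<le> C"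
            using bnd[OF j cube[OF \<open>t \<in> {-r..r}\<close>]] .
        qed measurable
        have "(\<integral>t. f j (x(j := t)) \<partial>U) = (\<integral>t. indicator {-r..r} t / (2 * r) * f j (x(j := t)) \<partial>lborel)"
          unfolding U_def using r by (subst integral_real_density) (auto simp: f_def)
        also have "\<dots> = (\<integral>t. 1 / (2 * r) * (indicator {-r..r} t * ((r\<^sup>2 - t\<^sup>2) * G' j (x(j := t)) - 2 * t * G j (x(j := t)))) \<partial>lborel)"
          by (intro Bochner_Integration.integral_cong) (auto simp: f_def)
        also have "\<dots> = 0" by (simp only: integral_mult_right_zero z mult_zero_right)
        finally show ?thesis .
      qed
      then show "AE x in Q J. (\<integral>t. f j (x(j := t)) \<partial>U) = 0"
        using AEQ[OF J(1)] by auto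
      have [measurable]: "f j \<in> borel_measurable (PiM (insert j J) (\<lambda>_. U))"
        using intf[OF j] unfolding ins Q_def by auto
      have "(\<lambda>(x, t). f j (x(j := t))) \<in> borel_measurable (PiM J (\<lambda>_. U) \<Otimes>\<^sub>M U)"
        using measurable_compose[OF measurable_add_dim[of j J "\<lambda>_. U"], of "f j" borel]
        by (simp add: case_prod_beta')
      then show "(\<lambda>x. \<integral>t. f j (x(j := t)) \<partial>U) \<in> borel_measurable (Q J)"
        unfolding Q_def by (rule U.borel_measurable_lebesgue_integral)
    qed simp
    finally show ?thesis by simp
  qed
  \<comment> \<open>Otherwise the sum is negative on the whole cube, that is almost everywhere under
    the prior, although its integral is 0.\<close>
  assume "\<not> ?thesis"
  then have neg: "(\<Sum>j<d. f j w) < 0" if "w \<in> PiE {..<d} (\<lambda>_. {-r..r})" for w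
    using that by (force simp: f_def not_le)
  have ints: "integrable (Q {..<d}) (\<lambda>w. - (\<Sum>j<d. f j w))" using intf by auto
  have "(\<integral>w. - (\<Sum>j<d. f j w) \<partial>Q {..<d}) = 0"
    using intf zero by (simp add: Bochner_Integration.integral_sum)
  moreover have AEneg: "AE w in Q {..<d}. (\<Sum>j<d. f j w) < 0"
    using AEQ[of "{..<d}"] by (auto elim!: eventually_mono intro: neg)
  moreover have "AE w in Q {..<d}. 0 \<le> - (\<Sum>j<d. f j w)"
    using AEneg by eventually_elim simp
  ultimately have "AE w in Q {..<d}. - (\<Sum>j<d. f j w) = 0"
    using integral_nonneg_eq_0_iff_AE[OF ints] by blast
  with AEneg have "AE w in Q {..<d}. False"
    by eventually_elim simp
  then show False by (simp add: Q.AE_False)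
qed

section \<open>The sign distributions\<close>

text \<open>Each derivative is given as the factor times \<open>g i\<close>, not through a
  logarithm. Thus the rule also covers factors equal to 0, such as the weight \<open>1 - p\<close>
  of the origin when \<open>p = 1\<close>.\<close>

lemma DERIV_prod_log:
  fixes f :: "'i \<Rightarrow> real \<Rightarrow> real"
  assumes "finite I" "\<And>i. i \<in> I \<Longrightarrow> (f i has_real_derivative f i t * g i) (at t)"
  shows "((\<lambda>t. \<Prod>i\<in>I. f i t) has_real_derivative (\<Prod>i\<in>I. f i t) * (\<Sum>i\<in>I. g i)) (at t)"
  using assms
proof (induction I rule: finite_induct)
  case (insert i I)
  have "((\<lambda>t. f i t * (\<Prod>i\<in>I. f i t)) has_real_derivative
      (f i t * g i) * (\<Prod>i\<in>I. f i t) + ((\<Prod>i\<in>I. f i t) * (\<Sum>i\<in>I. g i)) * f i t) (at t)"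
    using insert by (intro DERIV_mult) auto
  then show ?case using insert by (simp add: algebra_simps)
qed simp

definition origin :: "nat \<Rightarrow> nat \<Rightarrow> real" where
  "origin d = (\<lambda>i\<in>{..<d}. 0)"

definition cloud :: "nat \<Rightarrow> real \<Rightarrow> (nat \<Rightarrow> real) set" where
  "cloud d s = insert (origin d) (PiE {..<d} (\<lambda>_. {-s, s}))"

text \<open>On a sign vector the \<open>j\<close>-th factor is \<open>(1 + w j) / 2\<close> or
  \<open>(1 - w j) / 2\<close>. Written as a polynomial in \<open>w\<close>, it has two-sided
  derivatives even on the faces of the cube.\<close>

definition cloud_wt :: "nat \<Rightarrow> real \<Rightarrow> real \<Rightarrow> (nat \<Rightarrow> real) \<Rightarrow> (nat \<Rightarrow> real) \<Rightarrow> real" where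
  "cloud_wt d p s w y = (if y = origin d then 1 - p else p * (\<Prod>j<d. (1 + w j * y j / s) / 2))"

text \<open>The score of one sample (the derivative of its log weight in \<open>w j\<close>)
  multiplied by \<open>1 - (w j)\<^sup>2\<close>. It is 0 at the origin because the weight
  \<open>1 - p\<close> does not depend on \<open>w\<close>.\<close>

definition resid :: "nat \<Rightarrow> real \<Rightarrow> (nat \<Rightarrow> real) \<Rightarrow> (nat \<Rightarrow> real) \<Rightarrow> nat \<Rightarrow> real" where
  "resid d s w y j = (if y = origin d then 0 else y j / s - w j)"

text \<open>On the cube, \<open>r \<le> 1/2\<close> keeps all sign probabilities between 1/4 and 3/4
  and the denominators \<open>1 - (w j)\<^sup>2\<close> of the scores away from 0.\<close>

locale sign_cloud =
  fixes d :: nat and p s r :: real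
  assumes d: "1 \<le> d" and p: "0 < p" "p \<le> 1" and s: "0 < s" and r: "0 < r" "r \<le> 1/2"
begin

abbreviation "signs \<equiv> PiE {..<d} (\<lambda>_. {-s, s})"
abbreviation "cube \<equiv> PiE {..<d} (\<lambda>_. {-r..r})"
abbreviation "sgn_wt w j z \<equiv> (1 + w j * z / s) / (2 :: real)"

lemma cubeD: "w \<in> cube \<Longrightarrow> j < d \<Longrightarrow> \<bar>w j\<bar> \<le> r"
  by (drule PiE_mem[of w _ _ j]) (auto simp: abs_le_iff)

lemma cube_sq: "w \<in> cube \<Longrightarrow> j < d \<Longrightarrow> (w j)\<^sup>2 \<le> r\<^sup>2"
  using cubeD[of w j] r by (simp add: abs_le_square_iff[symmetric])

lemma r_sq: "r\<^sup>2 \<le> 1/4"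
  using power_mono[of r "1/2" 2] r by (simp add: power2_eq_square)

lemma origin_notin: "origin d \<notin> signs"
proof
  assume "origin d \<in> signs"
  then have "origin d 0 \<in> {-s, s}" by (rule PiE_mem) (use d in simp)
  then show False using d s by (auto simp: origin_def)
qed

lemma finite_signs: "finite signs" by (intro finite_PiE) auto
lemma finite_cloud: "finite (cloud d s)" using finite_signs by (simp add: cloud_def)

lemma signs_cases: "y \<in> signs \<Longrightarrow> j < d \<Longrightarrow> y j = s \<or> y j = - s"
  by (drule PiE_mem[of y _ _ j]) auto

lemma sgn_wt_nonneg: "w \<in> cube \<Longrightarrow> y \<in> signs \<Longrightarrow> j < d \<Longrightarrow> 0 \<le> sgn_wt w j (y j)"
proof -
  assume a: "w \<in> cube" "y \<in> signs" "j < d"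
  have "y j / s = 1 \<or> y j / s = -1" using signs_cases[OF a(2,3)] s by auto
  moreover have "\<bar>w j\<bar> \<le> 1" using cubeD[OF a(1,3)] r by simp
  ultimately have "0 \<le> 1 + w j * (y j / s)" by (elim disjE) (simp_all only: abs_le_iff, simp_all)
  then show ?thesis by simp
qed

sublocale signs: finite_product "{..<d}" "\<lambda>_. {-s, s}" "\<lambda>j z. sgn_wt w j z" for w
  using s by unfold_locales (auto simp: field_simps)

lemma sum_cloud:
  "(\<Sum>y\<in>cloud d s. cloud_wt d p s w y * F y)
    = (1 - p) * F (origin d) + p * (\<Sum>y\<in>signs. signs.wt w y * F y)"
proof -
  have "(\<Sum>y\<in>signs. cloud_wt d p s w y * F y) = (\<Sum>y\<in>signs. p * (signs.wt w y * F y))"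
    using origin_notin by (intro sum.cong refl) (auto simp: cloud_wt_def signs.wt_def)
  then show ?thesis
    using origin_notin finite_signs by (simp add: cloud_def cloud_wt_def sum_distrib_left)
qed

lemma signs_wt_nonneg:
  assumes "w \<in> cube" "y \<in> signs"
  shows "0 \<le> signs.wt w y"
  unfolding signs.wt_def
proof (rule prod_nonneg)
  fix j assume "j \<in> {..<d}"
  then show "0 \<le> sgn_wt w j (y j)" by (intro sgn_wt_nonneg assms) simp
qed

lemma cloud_wt_nonneg:
  assumes "w \<in> cube" "y \<in> cloud d s"
  shows "0 \<le> cloud_wt d p s w y"
proof (cases "y = origin d")
  case False
  then have "y \<in> signs" using assms by (simp add: cloud_def)
  then show ?thesis
    using signs_wt_nonneg[OF assms(1)] p False by (simp add: cloud_wt_def signs.wt_def)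
qed (use p in \<open>simp add: cloud_wt_def\<close>)

lemma sum_cloud_wt: "(\<Sum>y\<in>cloud d s. cloud_wt d p s w y) = 1"
  using sum_cloud[of w "\<lambda>_. 1"] signs.sum_wt[of w] by simp

lemma sign_mean: "(\<Sum>z\<in>{-s, s}. sgn_wt w j z * (v * (z / s - w j))) = 0"
  using s by (simp add: field_simps)

lemma sign_var: "(\<Sum>z\<in>{-s, s}. sgn_wt w j z * (v * (z / s - w j))\<^sup>2) = v\<^sup>2 * (1 - (w j)\<^sup>2)"
proof -
  have "(\<Sum>z\<in>{-s, s}. sgn_wt w j z * (v * (z / s - w j))\<^sup>2)
     = (1 - w j) / 2 * (v * (- 1 - w j))\<^sup>2 + (1 + w j) / 2 * (v * (1 - w j))\<^sup>2"
    using s by simp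
  also have "\<dots> = v\<^sup>2 * (1 - (w j)\<^sup>2)" by (simp add: power2_eq_square field_simps)
  finally show ?thesis .
qed

lemma resid_signs: "y \<in> signs \<Longrightarrow> resid d s w y j = y j / s - w j"
  using origin_notin by (auto simp: resid_def)

lemma resid_origin: "resid d s w (origin d) j = 0"
  by (simp add: resid_def)

lemma signs_resid_mean: "(\<Sum>y\<in>signs. signs.wt w y * (\<Sum>j<d. v j * resid d s w y j)) = 0"
proof -
  have "(\<Sum>y\<in>signs. signs.wt w y * (\<Sum>j<d. v j * resid d s w y j))
      = (\<Sum>j<d. \<Sum>y\<in>signs. signs.wt w y * (v j * (y j / s - w j)))"
    by (subst sum.swap) (simp add: sum_distrib_left resid_signs)
  also have "\<dots> = 0"
  proof (rule sum.neutral, rule ballI)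
    fix j assume "j \<in> {..<d}"
    then show "(\<Sum>y\<in>signs. signs.wt w y * (v j * (y j / s - w j))) = 0"
      using signs.sum_wt_marginal[of j w "\<lambda>z. v j * (z / s - w j)"] by (simp only: sign_mean)
  qed
  finally show ?thesis .
qed

lemma signs_resid_var:
  "(\<Sum>y\<in>signs. signs.wt w y * (\<Sum>j<d. v j * resid d s w y j)\<^sup>2) = (\<Sum>j<d. (v j)\<^sup>2 * (1 - (w j)\<^sup>2))"
proof -
  have "(\<Sum>y\<in>signs. signs.wt w y * (\<Sum>j<d. v j * resid d s w y j)\<^sup>2)
      = (\<Sum>y\<in>signs. signs.wt w y * (\<Sum>j<d. v j * (y j / s - w j))\<^sup>2)"
    by (simp add: resid_signs)
  also have "\<dots> = (\<Sum>j<d. (v j)\<^sup>2 * (1 - (w j)\<^sup>2))"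
    by (subst signs.sum_wt_variance[of w "\<lambda>j z. v j * (z / s - w j)"])
       (simp_all only: sign_var sign_mean)
  finally show ?thesis .
qed

lemma cloud_resid_mean: "(\<Sum>y\<in>cloud d s. cloud_wt d p s w y * (\<Sum>j<d. v j * resid d s w y j)) = 0"
  by (simp add: sum_cloud signs_resid_mean resid_origin)

lemma cloud_resid_var:
  "(\<Sum>y\<in>cloud d s. cloud_wt d p s w y * (\<Sum>j<d. v j * resid d s w y j)\<^sup>2)
    = p * (\<Sum>j<d. (v j)\<^sup>2 * (1 - (w j)\<^sup>2))"
  by (simp add: sum_cloud signs_resid_var resid_origin)

text \<open>The second moment is used only on the signs. The origin contributes nothing, so the
  factor is \<open>p\<close>, where the second moment of the whole cloud would give
  \<open>sqrt p\<close>. This gain is the source of the third term.\<close>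

lemma cloud_resid_abs:
  assumes "w \<in> cube"
  shows "(\<Sum>y\<in>cloud d s. cloud_wt d p s w y * \<bar>\<Sum>j<d. v j * resid d s w y j\<bar>)
    \<le> p * sqrt (\<Sum>j<d. (v j)\<^sup>2 * (1 - (w j)\<^sup>2))"
proof -
  have "(\<Sum>y\<in>signs. signs.wt w y * \<bar>\<Sum>j<d. v j * resid d s w y j\<bar>)
      \<le> sqrt (\<Sum>j<d. (v j)\<^sup>2 * (1 - (w j)\<^sup>2))"
    using assms signs_wt_nonneg signs.sum_wt signs_resid_var
    by (intro weighted_mean_abs_le_sqrt) auto
  then show ?thesis using p by (simp add: sum_cloud resid_origin)
qed

lemma cloud_mean: "k < d \<Longrightarrow> (\<Sum>y\<in>cloud d s. cloud_wt d p s w y * y k) = p * s * w k"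
proof -
  assume k: "k < d"
  have "(\<Sum>z\<in>{-s, s}. sgn_wt w k z * z) = s * w k"
    using s by (simp add: field_simps)
  then show ?thesis
    using signs.sum_wt_marginal[of k w "\<lambda>z. z"] k by (simp add: sum_cloud origin_def)
qed

lemma cloud_wt_deriv:
  assumes w: "w \<in> cube" and j: "j < d" and y: "y \<in> cloud d s"
  shows "((\<lambda>t. cloud_wt d p s (w(j := t)) y) has_real_derivative
    cloud_wt d p s w y * (resid d s w y j / (1 - (w j)\<^sup>2))) (at (w j))"
proof (cases "y = origin d")
  case True
  then show ?thesis by (simp add: cloud_wt_def resid_def)
next
  case False
  then have y: "y \<in> signs" using y by (simp add: cloud_def)
  have w1: "\<bar>w j\<bar> \<le> 1/2" using cubeD[OF w j] r by simp
  have w2: "(w j)\<^sup>2 \<noteq> 1" using cube_sq[OF w j] r_sq by simp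
  \<comment> \<open>For \<open>x = 1\<close> or \<open>x = -1\<close>, the log derivative
    \<open>x / (1 + w j * x)\<close> is rewritten with a centred numerator and a denominator that
    does not depend on the sample.\<close>
  have sc: "(y j / s) / (1 + w j * y j / s) = resid d s w y j / (1 - (w j)\<^sup>2)"
  proof -
    have "(x / (1 + w j * x)) = (x - w j) / (1 - (w j)\<^sup>2)" if "x = 1 \<or> x = -1" for x :: real
    proof -
      have "1 + w j * x \<noteq> 0" using that w1 by (elim disjE) (simp_all add: abs_le_iff)
      moreover have "x * (1 - (w j)\<^sup>2) = (x - w j) * (1 + w j * x)"
        using that by (elim disjE) (simp_all add: power2_eq_square algebra_simps)
      ultimately show ?thesis using w2 by (simp add: frac_eq_eq)
    qed
    moreover have "y j / s = 1 \<or> y j / s = -1" using signs_cases[OF y j] s by auto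
    ultimately have "(y j / s) / (1 + w j * (y j / s)) = (y j / s - w j) / (1 - (w j)\<^sup>2)" by blast
    then show ?thesis by (simp add: resid_signs[OF y])
  qed
  have pos: "1 + w j * y j / s \<noteq> 0"
    using signs_cases[OF y j] s w1 by (elim disjE) (simp_all add: abs_le_iff)
  have "((\<lambda>t. \<Prod>k<d. (1 + (w(j := t)) k * y k / s) / 2) has_real_derivative
      (\<Prod>k<d. (1 + (w(j := w j)) k * y k / s) / 2) *
      (\<Sum>k<d. if k = j then resid d s w y j / (1 - (w j)\<^sup>2) else 0)) (at (w j))"
  proof (rule DERIV_prod_log)
    fix k assume "k \<in> {..<d}"
    show "((\<lambda>t. (1 + (w(j := t)) k * y k / s) / 2) has_real_derivative
        (1 + (w(j := w j)) k * y k / s) / 2 * (if k = j then resid d s w y j / (1 - (w j)\<^sup>2) else 0)) (at (w j))"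
    proof (cases "k = j")
      case True
      have "((\<lambda>t. (1 + t * y j / s) / 2) has_real_derivative y j / s / 2) (at (w j))"
        using s by (auto intro!: derivative_eq_intros)
      moreover have "y j / s / 2 = (1 + w j * y j / s) / 2 * (resid d s w y j / (1 - (w j)\<^sup>2))"
        unfolding sc[symmetric] using pos by simp
      ultimately show ?thesis using True by simp
    qed simp
  qed simp
  then have "((\<lambda>t. p * (\<Prod>k<d. (1 + (w(j := t)) k * y k / s) / 2)) has_real_derivative
      p * ((\<Prod>k<d. (1 + w k * y k / s) / 2) * (resid d s w y j / (1 - (w j)\<^sup>2)))) (at (w j))"
    using j by (intro DERIV_cmult) (simp add: sum.delta)
  then show ?thesis using False by (simp add: cloud_wt_def mult.assoc)
qed

lemma prob_cloud_point: "w \<in> cube \<Longrightarrow> prob_space (point_measure (cloud d s) (cloud_wt d p s w))"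
  using finite_cloud cloud_wt_nonneg sum_cloud_wt
  by (intro prob_spaceI) (simp add: space_point_measure emeasure_point_measure_finite sum_ennreal)

end

section \<open>Persons with m samples each and data sets of n persons\<close>

locale sign_data = sign_cloud +
  fixes n m :: nat
begin

abbreviation "users \<equiv> PiE {..<m} (\<lambda>_. cloud d s)"
abbreviation "data \<equiv> PiE {..<n} (\<lambda>_. users)"

lemma finite_users: "finite users" using finite_cloud by (intro finite_PiE) auto

sublocale usr: finite_product "{..<m}" "\<lambda>_. cloud d s" "\<lambda>_. cloud_wt d p s w" for w
  using finite_cloud sum_cloud_wt by unfold_locales auto

sublocale dat: finite_product "{..<n}" "\<lambda>_. users" "\<lambda>_. usr.wt w" for w
  using finite_users usr.sum_wt by unfold_locales auto

definition uresid :: "(nat \<Rightarrow> real) \<Rightarrow> (nat \<Rightarrow> nat \<Rightarrow> real) \<Rightarrow> nat \<Rightarrow> real" where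
  "uresid w u j = (\<Sum>l<m. resid d s w (u l) j)"

lemma usr_wt_nonneg:
  assumes "w \<in> cube" "u \<in> users"
  shows "0 \<le> usr.wt w u"
  unfolding usr.wt_def
proof (rule prod_nonneg)
  fix l assume "l \<in> {..<m}"
  then show "0 \<le> cloud_wt d p s w (u l)" using assms by (intro cloud_wt_nonneg) (auto dest: PiE_mem)
qed

lemma dat_wt_nonneg:
  assumes "w \<in> cube" "x \<in> data"
  shows "0 \<le> dat.wt w x"
  unfolding dat.wt_def
proof (rule prod_nonneg)
  fix i assume "i \<in> {..<n}"
  then show "0 \<le> usr.wt w (x i)" using assms by (intro usr_wt_nonneg) (auto dest: PiE_mem)
qed

lemma dot_uresid: "(\<Sum>j<d. v j * uresid w u j) = (\<Sum>l<m. \<Sum>j<d. v j * resid d s w (u l) j)"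
  unfolding uresid_def by (simp only: sum_distrib_left) (rule sum.swap)

lemma uresid_mean: "(\<Sum>u\<in>users. usr.wt w u * (\<Sum>j<d. v j * uresid w u j)) = 0"
proof -
  have "(\<Sum>u\<in>users. usr.wt w u * (\<Sum>j<d. v j * uresid w u j))
      = (\<Sum>l<m. \<Sum>u\<in>users. usr.wt w u * (\<Sum>j<d. v j * resid d s w (u l) j))"
    unfolding dot_uresid by (simp only: sum_distrib_left[of _ _ "{..<m}"]) (rule sum.swap)
  also have "\<dots> = 0"
  proof (rule sum.neutral, rule ballI)
    fix l assume "l \<in> {..<m}"
    then show "(\<Sum>u\<in>users. usr.wt w u * (\<Sum>j<d. v j * resid d s w (u l) j)) = 0"
      using usr.sum_wt_marginal[of l w "\<lambda>y. \<Sum>j<d. v j * resid d s w y j"]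
      by (simp only: cloud_resid_mean)
  qed
  finally show ?thesis .
qed

lemma uresid_var:
  "(\<Sum>u\<in>users. usr.wt w u * (\<Sum>j<d. v j * uresid w u j)\<^sup>2)
    = real m * p * (\<Sum>j<d. (v j)\<^sup>2 * (1 - (w j)\<^sup>2))"
  unfolding dot_uresid
  by (subst usr.sum_wt_variance[of w "\<lambda>_ y. \<Sum>j<d. v j * resid d s w y j"])
     (simp_all only: cloud_resid_mean cloud_resid_var, simp)

lemma uresid_abs_sqrt:
  assumes "w \<in> cube"
  shows "(\<Sum>u\<in>users. usr.wt w u * \<bar>\<Sum>j<d. v j * uresid w u j\<bar>)
    \<le> sqrt (real m * p) * sqrt (\<Sum>j<d. (v j)\<^sup>2 * (1 - (w j)\<^sup>2))"
  unfolding real_sqrt_mult[symmetric]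
  using assms usr_wt_nonneg usr.sum_wt uresid_var by (intro weighted_mean_abs_le_sqrt) auto

text \<open>The triangle inequality over the samples. It beats \<open>uresid_abs_sqrt\<close> when
  \<open>m * p < 1\<close>, that is when fewer than one nonzero sample per person is
  expected.\<close>

lemma uresid_abs_linear:
  assumes w: "w \<in> cube"
  shows "(\<Sum>u\<in>users. usr.wt w u * \<bar>\<Sum>j<d. v j * uresid w u j\<bar>)
    \<le> real m * p * sqrt (\<Sum>j<d. (v j)\<^sup>2 * (1 - (w j)\<^sup>2))"
proof -
  have "(\<Sum>u\<in>users. usr.wt w u * \<bar>\<Sum>j<d. v j * uresid w u j\<bar>)
      \<le> (\<Sum>u\<in>users. usr.wt w u * (\<Sum>l<m. \<bar>\<Sum>j<d. v j * resid d s w (u l) j\<bar>))"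
    unfolding dot_uresid using usr_wt_nonneg[OF w] by (intro sum_mono mult_left_mono sum_abs) auto
  also have "\<dots> = (\<Sum>l<m. \<Sum>u\<in>users. usr.wt w u * \<bar>\<Sum>j<d. v j * resid d s w (u l) j\<bar>)"
    by (simp only: sum_distrib_left[of _ _ "{..<m}"]) (rule sum.swap)
  also have "\<dots> \<le> (\<Sum>l<m. p * sqrt (\<Sum>j<d. (v j)\<^sup>2 * (1 - (w j)\<^sup>2)))"
  proof (rule sum_mono)
    fix l assume "l \<in> {..<m}"
    then show "(\<Sum>u\<in>users. usr.wt w u * \<bar>\<Sum>j<d. v j * resid d s w (u l) j\<bar>)
        \<le> p * sqrt (\<Sum>j<d. (v j)\<^sup>2 * (1 - (w j)\<^sup>2))"
      using usr.sum_wt_marginal[of l w "\<lambda>y. \<bar>\<Sum>j<d. v j * resid d s w y j\<bar>"] cloud_resid_abs[OF w, of v]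
      by (simp only: )
  qed
  finally show ?thesis by (simp add: mult.assoc)
qed

lemma uresid_coord_var:
  assumes "j < d"
  shows "(\<Sum>u\<in>users. usr.wt w u * (c * uresid w u j)\<^sup>2) = real m * p * (c\<^sup>2 * (1 - (w j)\<^sup>2))"
proof -
  have *: "(\<Sum>k<d. (if k = j then c else 0) * f k) = c * f j" for f :: "nat \<Rightarrow> real"
    using assms by (simp add: if_distrib[of "\<lambda>z. z * _"] cong: if_cong)
  have "(\<Sum>k<d. (if k = j then c else 0)\<^sup>2 * (1 - (w k)\<^sup>2)) = c\<^sup>2 * (1 - (w j)\<^sup>2)"
    using assms by (simp add: if_distrib[of "\<lambda>z. z\<^sup>2 * _"] cong: if_cong)
  then show ?thesis
    using uresid_var[of w "\<lambda>k. if k = j then c else 0"] by (simp only: *)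
qed

lemma uresid_coord_mean:
  assumes "j < d"
  shows "(\<Sum>u\<in>users. usr.wt w u * (c * uresid w u j)) = 0"
proof -
  have *: "(\<Sum>k<d. (if k = j then c else 0) * f k) = c * f j" for f :: "nat \<Rightarrow> real"
    using assms by (simp add: if_distrib[of "\<lambda>z. z * _"] cong: if_cong)
  show ?thesis using uresid_mean[of w "\<lambda>k. if k = j then c else 0"] by (simp only: *)
qed

text \<open>The weight \<open>r\<^sup>2 - (w j)\<^sup>2\<close> of the integration by parts,
  combined with the denominator of the score; what remains of the score is
  \<open>uresid\<close>.\<close>

definition lam :: "(nat \<Rightarrow> real) \<Rightarrow> nat \<Rightarrow> real" where
  "lam w j = (r\<^sup>2 - (w j)\<^sup>2) / (1 - (w j)\<^sup>2)"

text \<open>The key point is \<open>r\<^sup>2 - (w j)\<^sup>2 \<le> r\<^sup>2 * (1 - (w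
  j)\<^sup>2)\<close>. The bounds extract a factor \<open>r\<^sup>2\<close>, which later cancels
  against the one in \<open>fingerprinting\<close>.\<close>

lemma lam_bounds:
  assumes "w \<in> cube" "j < d"
  shows "0 \<le> lam w j" "lam w j \<le> r\<^sup>2" "(lam w j)\<^sup>2 * (1 - (w j)\<^sup>2) \<le> (r\<^sup>2)\<^sup>2"
proof -
  have w: "(w j)\<^sup>2 \<le> r\<^sup>2" "r\<^sup>2 \<le> 1/4" using cube_sq[OF assms] r_sq by auto
  show 0: "0 \<le> lam w j" using w by (simp add: lam_def)
  have "r\<^sup>2 * (w j)\<^sup>2 \<le> 1 * (w j)\<^sup>2" using w by (intro mult_right_mono) auto
  then show 1: "lam w j \<le> r\<^sup>2" using w by (simp add: lam_def divide_simps algebra_simps)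
  have "(lam w j)\<^sup>2 * (1 - (w j)\<^sup>2) \<le> (r\<^sup>2)\<^sup>2 * 1"
    using 0 1 w by (intro mult_mono power_mono) auto
  then show "(lam w j)\<^sup>2 * (1 - (w j)\<^sup>2) \<le> (r\<^sup>2)\<^sup>2" by simp
qed

lemma lam_dot_var:
  assumes w: "w \<in> cube" and v: "(\<Sum>j<d. (v j)\<^sup>2) \<le> B\<^sup>2" and B: "0 \<le> B"
  shows "sqrt (\<Sum>j<d. (lam w j * v j)\<^sup>2 * (1 - (w j)\<^sup>2)) \<le> r\<^sup>2 * B"
proof (rule real_le_lsqrt)
  have "(\<Sum>j<d. (lam w j * v j)\<^sup>2 * (1 - (w j)\<^sup>2)) = (\<Sum>j<d. (v j)\<^sup>2 * ((lam w j)\<^sup>2 * (1 - (w j)\<^sup>2)))"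
    by (simp add: power_mult_distrib mult_ac)
  also have "\<dots> \<le> (\<Sum>j<d. (v j)\<^sup>2 * (r\<^sup>2)\<^sup>2)"
    using lam_bounds[OF w] by (intro sum_mono mult_left_mono) auto
  also have "\<dots> \<le> B\<^sup>2 * (r\<^sup>2)\<^sup>2"
    using v unfolding sum_distrib_right[symmetric] by (intro mult_right_mono) auto
  finally show "(\<Sum>j<d. (lam w j * v j)\<^sup>2 * (1 - (w j)\<^sup>2)) \<le> (r\<^sup>2 * B)\<^sup>2"
    by (simp add: power_mult_distrib mult_ac)
qed (use B in auto)

lemma sum_lam_sq: "w \<in> cube \<Longrightarrow> (\<Sum>j<d. (lam w j)\<^sup>2 * (1 - (w j)\<^sup>2)) \<le> real d * (r\<^sup>2)\<^sup>2"
  using sum_mono[of "{..<d}" "\<lambda>j. (lam w j)\<^sup>2 * (1 - (w j)\<^sup>2)" "\<lambda>_. (r\<^sup>2)\<^sup>2"] lam_bounds(3)[of w] by simp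

text \<open>Controls the mean of the sup bound \<open>T\<close> in
  \<open>private_correlation\<close>, hence the \<open>\<delta>\<close> term of
  \<open>private_bound\<close>.\<close>

lemma uresid_norm:
  assumes w: "w \<in> cube"
  shows "(\<Sum>u\<in>users. usr.wt w u * L2_set (\<lambda>j. lam w j * uresid w u j) {..<d}) \<le> r\<^sup>2 * sqrt (real m * p * real d)"
proof -
  have sq: "(L2_set f {..<d})\<^sup>2 = (\<Sum>j<d. (f j)\<^sup>2)" for f
    by (simp add: L2_set_def sum_nonneg)
  have "(\<Sum>u\<in>users. usr.wt w u * (L2_set (\<lambda>j. lam w j * uresid w u j) {..<d})\<^sup>2)
      = (\<Sum>j<d. \<Sum>u\<in>users. usr.wt w u * (lam w j * uresid w u j)\<^sup>2)"
    unfolding sq by (simp only: sum_distrib_left) (rule sum.swap)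
  also have "\<dots> = (\<Sum>j<d. real m * p * ((lam w j)\<^sup>2 * (1 - (w j)\<^sup>2)))"
    by (intro sum.cong refl uresid_coord_var) simp
  also have "\<dots> = real m * p * (\<Sum>j<d. (lam w j)\<^sup>2 * (1 - (w j)\<^sup>2))" by (rule sum_distrib_left[symmetric])
  also have "\<dots> \<le> real m * p * (real d * (r\<^sup>2)\<^sup>2)"
    using sum_lam_sq[OF w] p by (intro mult_left_mono) auto
  finally have "(\<Sum>u\<in>users. usr.wt w u * \<bar>L2_set (\<lambda>j. lam w j * uresid w u j) {..<d}\<bar>)
      \<le> sqrt (real m * p * (real d * (r\<^sup>2)\<^sup>2))"
    using usr_wt_nonneg[OF w] usr.sum_wt by (intro weighted_mean_abs_le_sqrt) auto
  moreover have "sqrt (real m * p * (real d * (r\<^sup>2)\<^sup>2)) = sqrt ((r\<^sup>2)\<^sup>2 * (real m * p * real d))"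
    by (simp only: mult_ac)
  ultimately show ?thesis
    by (simp only: real_sqrt_mult[of "(r\<^sup>2)\<^sup>2"] real_sqrt_abs abs_power2 abs_of_nonneg[OF L2_set_nonneg])
qed

text \<open>Scores of different persons are independent and centred, so their squared norms add up
  and the norm grows like \<open>sqrt n\<close> instead of \<open>n\<close>.\<close>

lemma dat_resid_norm:
  assumes w: "w \<in> cube"
  shows "(\<Sum>x\<in>data. dat.wt w x * L2_set (\<lambda>j. \<Sum>i<n. lam w j * uresid w (x i) j) {..<d})
    \<le> r\<^sup>2 * sqrt (real n * real m * p * real d)"
proof -
  have sq: "(L2_set f {..<d})\<^sup>2 = (\<Sum>j<d. (f j)\<^sup>2)" for f
    by (simp add: L2_set_def sum_nonneg)
  have "(\<Sum>x\<in>data. dat.wt w x * (L2_set (\<lambda>j. \<Sum>i<n. lam w j * uresid w (x i) j) {..<d})\<^sup>2)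
      = (\<Sum>j<d. \<Sum>x\<in>data. dat.wt w x * (\<Sum>i<n. lam w j * uresid w (x i) j)\<^sup>2)"
    unfolding sq by (simp only: sum_distrib_left[of _ _ "{..<d}"]) (rule sum.swap)
  also have "\<dots> = (\<Sum>j<d. \<Sum>i<n. real m * p * ((lam w j)\<^sup>2 * (1 - (w j)\<^sup>2)))"
  proof (rule sum.cong[OF refl])
    fix j assume "j \<in> {..<d}"
    then have j: "j < d" by simp
    show "(\<Sum>x\<in>data. dat.wt w x * (\<Sum>i<n. lam w j * uresid w (x i) j)\<^sup>2)
        = (\<Sum>i<n. real m * p * ((lam w j)\<^sup>2 * (1 - (w j)\<^sup>2)))"
      by (subst dat.sum_wt_variance[of w "\<lambda>_ u. lam w j * uresid w u j"])
         (simp_all only: uresid_coord_mean[OF j] uresid_coord_var[OF j])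
  qed
  also have "\<dots> = real n * real m * p * (\<Sum>j<d. (lam w j)\<^sup>2 * (1 - (w j)\<^sup>2))"
    by (simp add: sum_distrib_left mult_ac)
  also have "\<dots> \<le> real n * real m * p * (real d * (r\<^sup>2)\<^sup>2)"
    using sum_lam_sq[OF w] p by (intro mult_left_mono) auto
  finally have "(\<Sum>x\<in>data. dat.wt w x * \<bar>L2_set (\<lambda>j. \<Sum>i<n. lam w j * uresid w (x i) j) {..<d}\<bar>)
      \<le> sqrt (real n * real m * p * (real d * (r\<^sup>2)\<^sup>2))"
    using dat_wt_nonneg[OF w] dat.sum_wt by (intro weighted_mean_abs_le_sqrt) auto
  moreover have "sqrt (real n * real m * p * (real d * (r\<^sup>2)\<^sup>2))
      = sqrt ((r\<^sup>2)\<^sup>2 * (real n * real m * p * real d))"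
    by (simp only: mult_ac)
  ultimately show ?thesis
    by (simp only: real_sqrt_mult[of "(r\<^sup>2)\<^sup>2"] real_sqrt_abs abs_power2 abs_of_nonneg[OF L2_set_nonneg])
qed

lemma dat_wt_deriv:
  assumes w: "w \<in> cube" and j: "j < d" and x: "x \<in> data"
  shows "((\<lambda>t. dat.wt (w(j := t)) x) has_real_derivative
    dat.wt w x * (\<Sum>i<n. uresid w (x i) j / (1 - (w j)\<^sup>2))) (at (w j))"
proof -
  have "((\<lambda>t. usr.wt (w(j := t)) u) has_real_derivative
      usr.wt w u * (uresid w u j / (1 - (w j)\<^sup>2))) (at (w j))" if u: "u \<in> users" for u
  proof -
    have "((\<lambda>t. \<Prod>l<m. cloud_wt d p s (w(j := t)) (u l)) has_real_derivative
        (\<Prod>l<m. cloud_wt d p s (w(j := w j)) (u l)) * (\<Sum>l<m. resid d s w (u l) j / (1 - (w j)\<^sup>2))) (at (w j))"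
    proof (rule DERIV_prod_log)
      fix l assume "l \<in> {..<m}"
      then have "u l \<in> cloud d s" using u by (rule PiE_mem[rotated])
      from cloud_wt_deriv[OF w j this]
      show "((\<lambda>t. cloud_wt d p s (w(j := t)) (u l)) has_real_derivative
        cloud_wt d p s (w(j := w j)) (u l) * (resid d s w (u l) j / (1 - (w j)\<^sup>2))) (at (w j))" by simp
    qed simp
    then show ?thesis by (simp add: usr.wt_def uresid_def sum_divide_distrib)
  qed
  note usr_deriv = this
  have "((\<lambda>t. \<Prod>i<n. usr.wt (w(j := t)) (x i)) has_real_derivative
      (\<Prod>i<n. usr.wt (w(j := w j)) (x i)) * (\<Sum>i<n. uresid w (x i) j / (1 - (w j)\<^sup>2))) (at (w j))"
  proof (rule DERIV_prod_log)
    fix i assume "i \<in> {..<n}"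
    then have "x i \<in> users" using x by (rule PiE_mem[rotated])
    from usr_deriv[OF this]
    show "((\<lambda>t. usr.wt (w(j := t)) (x i)) has_real_derivative
      usr.wt (w(j := w j)) (x i) * (uresid w (x i) j / (1 - (w j)\<^sup>2))) (at (w j))" by simp
  qed simp
  then show ?thesis by (simp add: dat.wt_def)
qed

lemma measurable_dat_wt: "(\<lambda>w. dat.wt w x) \<in> borel_measurable (PiM {..<d} (\<lambda>_. borel))"
proof -
  have "(\<lambda>w. cloud_wt d p s w y) \<in> borel_measurable (PiM {..<d} (\<lambda>_. borel))" for y
  proof (cases "y = origin d")
    case False
    have "(\<lambda>w. p * (\<Prod>j<d. (1 + w j * y j / s) / 2)) \<in> borel_measurable (PiM {..<d} (\<lambda>_. borel))"
      by (intro borel_measurable_times borel_measurable_prod borel_measurable_divide borel_measurable_add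
          borel_measurable_const measurable_component_singleton) auto
    then show ?thesis using False by (simp add: cloud_wt_def)
  qed (simp add: cloud_wt_def)
  then show ?thesis
    unfolding dat.wt_def usr.wt_def by (intro borel_measurable_prod)
qed

lemma measurable_uresid: "j < d \<Longrightarrow> (\<lambda>w. uresid w u j) \<in> borel_measurable (PiM {..<d} (\<lambda>_. borel))"
  unfolding uresid_def resid_def
  by (intro borel_measurable_sum measurable_If borel_measurable_diff measurable_component_singleton) auto

lemma uresid_bound:
  assumes w: "w \<in> cube" and j: "j < d" and u: "u \<in> users"
  shows "\<bar>uresid w u j\<bar> \<le> 2 * real m"
proof -
  have "\<bar>resid d s w (u l) j\<bar> \<le> 2" if "l < m" for l
  proof (cases "u l = origin d")
    case False
    have "u l \<in> cloud d s" using u by (rule PiE_mem) (use that in simp)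
    then have "u l \<in> signs" using False by (simp add: cloud_def)
    from signs_cases[OF this j] have "u l j / s = 1 \<or> u l j / s = -1" using s by auto
    then show ?thesis using cubeD[OF w j] r False by (auto simp: resid_def)
  qed (simp add: resid_def)
  then have "(\<Sum>l<m. \<bar>resid d s w (u l) j\<bar>) \<le> (\<Sum>l<m. 2)" by (intro sum_mono) auto
  then show ?thesis unfolding uresid_def by (intro order_trans[OF sum_abs]) simp
qed

end

section \<open>Lower and upper bounds on the correlation\<close>

lemma singleton_sets_euclid:
  assumes "z \<in> space (euclid d)" shows "{z} \<in> sets (euclid d)"
proof -
  have "z \<in> extensional {..<d}" using assms by (simp add: euclid_def space_PiM PiE_iff)
  then have "{z} = PiE {..<d} (\<lambda>i. {z i})" using PiE_singleton by blast
  then show ?thesis unfolding euclid_def by (simp add: sets_PiM_I_finite)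
qed

lemma measurable_coord: "j < d \<Longrightarrow> (\<lambda>y. y j) \<in> borel_measurable (euclid d)"
  unfolding euclid_def by (rule measurable_component_singleton) simp

lemma measurable_norm2:
  assumes "\<And>j. j < d \<Longrightarrow> (\<lambda>y. f y j) \<in> borel_measurable N"
  shows "(\<lambda>y. norm2 d (f y)) \<in> borel_measurable N"
proof -
  have "(\<lambda>y. \<Sum>j<d. (f y j)\<^sup>2) \<in> borel_measurable N"
    using assms by (intro borel_measurable_sum borel_measurable_power) auto
  then show ?thesis unfolding L2_set_def by measurable
qed

lemma sets_ball_euclid: "{y \<in> space (euclid d). norm2 d (\<lambda>i. y i - z i) \<le> \<alpha>} \<in> sets (euclid d)"
proof -
  have "(\<lambda>y. norm2 d (\<lambda>i. y i - z i)) \<in> borel_measurable (euclid d)"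
    using measurable_coord by (intro measurable_norm2 borel_measurable_diff) auto
  then show ?thesis by measurable
qed

text \<open>The factor 100 makes the error, in the units of \<open>w\<close>, at most 1/100 of the
  largest norm \<open>r * sqrt d\<close> in the cube; it is then negligible in the balance of
  success and failure.\<close>

locale sign_mechanism = sign_data +
  fixes K :: "(nat \<Rightarrow> nat \<Rightarrow> nat \<Rightarrow> real) \<Rightarrow> (nat \<Rightarrow> real) measure" and \<alpha> :: real
  assumes K: "\<And>x. x \<in> data \<Longrightarrow> prob_space (K x)" "\<And>x. x \<in> data \<Longrightarrow> sets (K x) = sets (euclid d)"
    and \<alpha>: "0 < \<alpha>" "100 * \<alpha> \<le> p * s * r * sqrt (real d)"
    and success: "\<And>w. w \<in> cube \<Longrightarrow> 2 / 3 \<le> (\<Sum>x\<in>data. dat.wt w x *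
      measure (K x) {y \<in> space (euclid d). norm2 d (\<lambda>i. y i - p * s * w i) \<le> \<alpha>})"
begin

text \<open>In the units of \<open>w\<close>, where outputs are divided by \<open>p * s\<close>,
  \<open>a\<close> is the accuracy and \<open>B\<close> below bounds the norm of every accurate
  output.\<close>

definition a :: real where "a = \<alpha> / (p * s)"
definition B :: real where "B = r * sqrt (real d) + a"

text \<open>The cut-off leaves accurate outputs alone and makes every statistic of the output
  bounded. This limits the harm of a failing run and gives the \<open>\<delta>\<close> error a
  finite sup bound.\<close>

definition N :: "(nat \<Rightarrow> real) \<Rightarrow> nat \<Rightarrow> real" where
  "N y j = (if norm2 d y \<le> p * s * B then y j / (p * s) else 0)"

lemma ps: "0 < p * s" using p s by simp

lemma a_pos: "0 < a" using \<alpha> ps by (simp add: a_def)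

lemma a_le: "100 * a \<le> r * sqrt (real d)"
  using \<alpha> ps by (simp add: a_def field_simps)

lemma B_pos: "0 < B" unfolding B_def using a_pos r by (intro add_nonneg_pos) auto

lemma B_le: "B \<le> 2 * (r * sqrt (real d))" unfolding B_def using a_le a_pos by simp

lemma measurable_N: "j < d \<Longrightarrow> (\<lambda>y. N y j) \<in> borel_measurable (euclid d)"
  unfolding N_def using measurable_norm2[of d "\<lambda>y. y", OF measurable_coord] measurable_coord[of j]
  by (intro measurable_If borel_measurable_divide borel_measurable_const) auto

lemma L2_scale: "0 \<le> c \<Longrightarrow> norm2 d (\<lambda>j. c * f j) = c * norm2 d f"
  by (simp add: L2_set_def power_mult_distrib sum_distrib_left[symmetric] real_sqrt_mult)

lemma N_norm: "norm2 d (N y) \<le> B"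
proof (cases "norm2 d y \<le> p * s * B")
  case True
  have "N y = (\<lambda>j. (1 / (p * s)) * y j)" using True by (simp add: N_def fun_eq_iff)
  then have "norm2 d (N y) = norm2 d (\<lambda>j. (1 / (p * s)) * y j)" by simp
  also have "\<dots> = norm2 d y / (p * s)" using ps by (subst L2_scale) auto
  also have "\<dots> \<le> B" using True ps by (simp add: field_simps)
  finally show ?thesis .
next
  case False
  then have "N y = (\<lambda>j. 0)" by (simp add: N_def fun_eq_iff)
  then show ?thesis using B_pos by (simp add: L2_set_def)
qed

lemma N_sq: "(\<Sum>j<d. (N y j)\<^sup>2) \<le> B\<^sup>2"
  using N_norm[of y] unfolding L2_set_def by (intro sqrt_le_D)

lemma N_coord: "j < d \<Longrightarrow> \<bar>N y j\<bar> \<le> B"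
  using member_le_L2_set[of "{..<d}" j "\<lambda>j. \<bar>N y j\<bar>"] N_norm[of y] by (simp add: L2_set_def)

lemma N_dot: "\<bar>\<Sum>j<d. v j * N y j\<bar> \<le> norm2 d v * B"
proof -
  have "\<bar>\<Sum>j<d. v j * N y j\<bar> \<le> norm2 d v * norm2 d (N y)"
    by (rule order_trans[OF sum_abs]) (simp add: abs_mult L2_set_mult_ineq)
  also have "\<dots> \<le> norm2 d v * B" using N_norm by (intro mult_left_mono L2_set_nonneg)
  finally show ?thesis .
qed

definition G :: "(nat \<Rightarrow> nat \<Rightarrow> nat \<Rightarrow> real) \<Rightarrow> nat \<Rightarrow> real" where
  "G x j = (\<integral>y. N y j \<partial>K x)"

lemma integrable_N:
  assumes x: "x \<in> data" and j: "j < d"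
  shows "integrable (K x) (\<lambda>y. N y j)"
proof -
  interpret prob_space "K x" by (rule K(1)[OF x])
  have "(\<lambda>y. N y j) \<in> borel_measurable (K x)"
    by (subst measurable_cong_sets[OF K(2)[OF x] refl]) (rule measurable_N[OF j])
  then show ?thesis using N_coord[OF j] by (intro integrable_const_bound[of _ B]) auto
qed

lemma dot_G: "x \<in> data \<Longrightarrow> (\<Sum>j<d. v j * G x j) = (\<integral>y. (\<Sum>j<d. v j * N y j) \<partial>K x)"
  unfolding G_def using integrable_N by (subst Bochner_Integration.integral_sum) auto

lemma dot_G_le: "x \<in> data \<Longrightarrow> (\<Sum>j<d. v j * G x j) \<le> norm2 d v * B"
proof -
  assume x: "x \<in> data"
  interpret prob_space "K x" by (rule K(1)[OF x])
  have "(\<integral>y. (\<Sum>j<d. v j * N y j) \<partial>K x) \<le> (\<integral>y. norm2 d v * B \<partial>K x)"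
    using integrable_N[OF x] N_dot[of v] by (intro integral_mono) (auto simp: abs_le_iff)
  then show ?thesis using dot_G[OF x] by (simp add: prob_space)
qed

definition g :: "nat \<Rightarrow> (nat \<Rightarrow> real) \<Rightarrow> real" where
  "g j w = (\<Sum>x\<in>data. dat.wt w x * G x j)"

lemma norm2_cube:
  assumes "w \<in> cube" shows "norm2 d w \<le> r * sqrt (real d)"
proof -
  have "(\<Sum>j<d. (w j)\<^sup>2) \<le> (\<Sum>j<d. r\<^sup>2)" using cube_sq[OF assms] by (intro sum_mono) auto
  then have "norm2 d w \<le> sqrt (real d * r\<^sup>2)" by (simp add: L2_set_def)
  also have "\<dots> = r * sqrt (real d)" using r by (simp add: real_sqrt_mult)
  finally show ?thesis .
qed

text \<open>
  On success the output correlates with \<open>w\<close>; on failure the truncation bounds the loss. The failure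
  term \<open>R W / 3\<close> is split by AM-GM with weights tuned to the mean \<open>R\<^sup>2 / 3\<close> of \<open>W\<^sup>2\<close> over the cube; this
  keeps the balance positive for every \<open>d \<ge> 1\<close>.
\<close>

lemma dot_g_lower:
  assumes w: "w \<in> cube"
  shows "3 / 8 * (\<Sum>j<d. (w j)\<^sup>2) - (2 / 21 + 1 / 100) * (r\<^sup>2 * real d) \<le> (\<Sum>j<d. w j * g j w)"
proof -
  define W where "W = norm2 d w"
  define R where "R = r * sqrt (real d)"
  have W: "0 \<le> W" "W \<le> R" using norm2_cube[OF w] by (auto simp: W_def R_def L2_set_nonneg)
  have W2: "(\<Sum>j<d. (w j)\<^sup>2) = W\<^sup>2" by (simp add: W_def L2_set_def sum_nonneg)
  have R2: "r\<^sup>2 * real d = R\<^sup>2" by (simp add: R_def power_mult_distrib)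
  have aR: "0 < a" "100 * a \<le> R" "B = R + a" using a_pos a_le by (auto simp: R_def B_def)
  define S where "S = {y \<in> space (euclid d). norm2 d (\<lambda>i. y i - p * s * w i) \<le> \<alpha>}"
  \<comment> \<open>The gap between the value \<open>W\<^sup>2 - a * W\<close> guaranteed on success
    and the worst case \<open>- (B * W)\<close>. Because \<open>c\<close> is nonnegative, the
    success probability may be replaced by its lower bound 2/3.\<close>
  define c where "c = W\<^sup>2 - a * W + B * W"
  have c0: "0 \<le> c"
    using W aR by (auto simp: c_def algebra_simps intro!: add_nonneg_nonneg)
  have Smeas: "S \<in> sets (euclid d)" unfolding S_def by (rule sets_ball_euclid)
  have pt: "- (B * W) + c * indicator S y \<le> (\<Sum>j<d. w j * N y j)" for y
  proof (cases "y \<in> S")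
    case False
    have "- (norm2 d w * B) \<le> (\<Sum>j<d. w j * N y j)" using N_dot[of w y] by (simp add: abs_le_iff)
    then show ?thesis using False by (simp add: W_def mult.commute)
  next
    case True
    then have dist: "norm2 d (\<lambda>i. y i - p * s * w i) \<le> \<alpha>" by (simp add: S_def)
    have "norm2 d y = norm2 d (\<lambda>i. (y i - p * s * w i) + p * s * w i)" by simp
    also have "\<dots> \<le> norm2 d (\<lambda>i. y i - p * s * w i) + norm2 d (\<lambda>i. p * s * w i)" by (rule L2_set_triangle_ineq)
    also have "norm2 d (\<lambda>i. p * s * w i) = p * s * W" using ps by (simp add: L2_scale W_def)
    also have "norm2 d (\<lambda>i. y i - p * s * w i) + p * s * W \<le> \<alpha> + p * s * R"
      using dist W ps by (intro add_mono mult_left_mono) auto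
    also have "\<dots> = p * s * B" using p s aR by (simp add: a_def field_simps)
    finally have Ny: "N y j = y j / (p * s)" for j by (simp add: N_def)
    have "norm2 d (\<lambda>i. N y i - w i) = norm2 d (\<lambda>i. (1 / (p * s)) * (y i - p * s * w i))"
    proof -
      have "N y i - w i = (1 / (p * s)) * (y i - p * s * w i)" for i
        using p s by (simp add: Ny field_simps)
      then show ?thesis by simp
    qed
    also have "\<dots> = (1 / (p * s)) * norm2 d (\<lambda>i. y i - p * s * w i)" using ps by (intro L2_scale) simp
    also have "\<dots> \<le> a" using dist ps by (simp add: a_def divide_right_mono)
    finally have err: "norm2 d (\<lambda>i. N y i - w i) \<le> a" .
    have "(\<Sum>j<d. w j * N y j) = W\<^sup>2 + (\<Sum>j<d. w j * (N y j - w j))"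
      unfolding W2[symmetric] by (simp add: right_diff_distrib sum_subtractf power2_eq_square)
    moreover have "\<bar>\<Sum>j<d. w j * (N y j - w j)\<bar> \<le> W * norm2 d (\<lambda>i. N y i - w i)"
      unfolding W_def by (rule order_trans[OF sum_abs]) (simp add: abs_mult L2_set_mult_ineq)
    moreover have "W * norm2 d (\<lambda>i. N y i - w i) \<le> W * a" using err W by (intro mult_left_mono)
    ultimately show ?thesis using True by (simp add: c_def mult.commute)
  qed
  have each: "- (B * W) + c * measure (K x) S \<le> (\<Sum>j<d. w j * G x j)" if x: "x \<in> data" for x
  proof -
    interpret prob_space "K x" by (rule K(1)[OF x])
    have S: "S \<in> sets (K x)" using Smeas K(2)[OF x] by simp
    then have "- (B * W) + c * measure (K x) S = (\<integral>y. - (B * W) + c * indicator S y \<partial>K x)"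
      by (simp add: prob_space emeasure_eq_measure integrable_indicator_iff Int_absorb2 sets.sets_into_space)
    also have "\<dots> \<le> (\<integral>y. (\<Sum>j<d. w j * N y j) \<partial>K x)"
      using integrable_N[OF x] S pt
      by (intro integral_mono) (auto simp: emeasure_eq_measure integrable_indicator_iff)
    finally show ?thesis using dot_G[OF x] by simp
  qed
  have "- (B * W) + c * (2 / 3) \<le> - (B * W) + c * (\<Sum>x\<in>data. dat.wt w x * measure (K x) S)"
    using success[OF w] c0 unfolding S_def by (intro add_left_mono mult_left_mono)
  also have "\<dots> = - (B * W) * (\<Sum>x\<in>data. dat.wt w x) + c * (\<Sum>x\<in>data. dat.wt w x * measure (K x) S)"
    by (simp add: dat.sum_wt)
  also have "\<dots> = (\<Sum>x\<in>data. dat.wt w x * (- (B * W) + c * measure (K x) S))"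
    by (simp only: sum_distrib_left distrib_left sum.distrib) (simp add: mult_ac)
  also have "\<dots> \<le> (\<Sum>x\<in>data. dat.wt w x * (\<Sum>j<d. w j * G x j))"
    using dat_wt_nonneg[OF w] each by (intro sum_mono mult_left_mono)
  also have "\<dots> = (\<Sum>j<d. w j * g j w)"
    unfolding g_def sum_distrib_left by (subst sum.swap) (simp add: mult_ac)
  finally have main: "- (B * W) + c * (2 / 3) \<le> (\<Sum>j<d. w j * g j w)" .
  have "3 / 8 * W\<^sup>2 - (2 / 21 + 1 / 100) * R\<^sup>2 \<le> - (B * W) + c * (2 / 3)"
  proof -
    \<comment> \<open>The square vanishes at \<open>W = 4/7 * R\<close>, a rational close to
      \<open>R / sqrt 3\<close>, the root mean square of \<open>W\<close> over the cube. The
      coefficient 3/8 is \<open>2/3 - 7/24\<close>.\<close>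
    have "0 \<le> (7 / 24) * (W - 4 / 7 * R)\<^sup>2" by simp
    also have "\<dots> = 7 / 24 * W\<^sup>2 + 2 / 21 * R\<^sup>2 - 1 / 3 * (R * W)" by (simp add: power2_eq_square algebra_simps)
    finally have 1: "1 / 3 * (R * W) \<le> 7 / 24 * W\<^sup>2 + 2 / 21 * R\<^sup>2" by simp
    have "100 * a * W \<le> R * R" using aR W by (intro mult_mono) auto
    then have 2: "a * W \<le> R\<^sup>2 / 100" by (simp add: power2_eq_square)
    have "- (B * W) + c * (2 / 3) = 2 / 3 * W\<^sup>2 - 1 / 3 * (R * W) - a * W"
      by (simp add: c_def aR algebra_simps)
    then show ?thesis using 1 2 by (simp add: algebra_simps)
  qed
  then show ?thesis using main unfolding W2 R2 by linarith
qed

definition g' :: "nat \<Rightarrow> (nat \<Rightarrow> real) \<Rightarrow> real" where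
  "g' j w = (\<Sum>x\<in>data. dat.wt w x * (\<Sum>i<n. uresid w (x i) j / (1 - (w j)\<^sup>2)) * G x j)"

lemma G_bound: "x \<in> data \<Longrightarrow> j < d \<Longrightarrow> \<bar>G x j\<bar> \<le> B"
proof -
  assume x: "x \<in> data" and j: "j < d"
  interpret prob_space "K x" by (rule K(1)[OF x])
  have "\<bar>G x j\<bar> \<le> (\<integral>y. \<bar>N y j\<bar> \<partial>K x)" unfolding G_def by (rule integral_abs_bound)
  also have "\<dots> \<le> (\<integral>y. B \<partial>K x)" using integrable_N[OF x j] N_coord[OF j] by (intro integral_mono) auto
  finally show ?thesis by (simp add: prob_space)
qed

text \<open>Integration by parts for \<open>g j w - w j / 4\<close>, together with
  \<open>dot_g_lower\<close>, leaves the factor \<open>1/4 - 2 * (2/21 + 1/100)\<close>, about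
  0.0395, in front of \<open>r\<^sup>2 * d\<close>; 1/30 lies just below it.\<close>

lemma fingerprinting:
  "\<exists>w\<in>cube. r\<^sup>2 * real d / 30 \<le> (\<Sum>x\<in>data. dat.wt w x * (\<Sum>j<d. (\<Sum>i<n. lam w j * uresid w (x i) j) * G x j))"
proof -
  \<comment> \<open>A crude bound whose only purpose is to make the integrals over the prior
    exist.\<close>
  define C where "C = B + real n * (4 * real m) * B + 1"
  have gb: "\<bar>g j w\<bar> \<le> B" if w: "w \<in> cube" and j: "j < d" for w j
  proof -
    have "\<bar>g j w\<bar> \<le> (\<Sum>x\<in>data. dat.wt w x * B)"
      unfolding g_def using dat_wt_nonneg[OF w] G_bound[OF _ j]
      by (intro order_trans[OF sum_abs] sum_mono) (simp add: abs_mult mult_left_mono)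
    then show ?thesis by (simp only: sum_distrib_right[symmetric] dat.sum_wt mult_1)
  qed
  have g'b: "\<bar>g' j w\<bar> \<le> real n * (4 * real m) * B" if w: "w \<in> cube" and j: "j < d" for w j
  proof -
    have *: "\<bar>\<Sum>i<n. uresid w (x i) j / (1 - (w j)\<^sup>2)\<bar> \<le> real n * (4 * real m)" if x: "x \<in> data" for x
    proof -
      have "\<bar>uresid w (x i) j / (1 - (w j)\<^sup>2)\<bar> \<le> 4 * real m" if "i < n" for i
      proof -
        have "x i \<in> users" using x by (rule PiE_mem) (use that in simp)
        from uresid_bound[OF w j this] have u: "\<bar>uresid w (x i) j\<bar> \<le> 2 * real m" .
        have "1/2 \<le> 1 - (w j)\<^sup>2" using cube_sq[OF w j] r_sq by simp
        then have "\<bar>uresid w (x i) j / (1 - (w j)\<^sup>2)\<bar> \<le> 2 * real m / (1/2)"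
          using u by (simp only: abs_divide) (intro frac_le, auto)
        then show ?thesis by simp
      qed
      then have "(\<Sum>i<n. \<bar>uresid w (x i) j / (1 - (w j)\<^sup>2)\<bar>) \<le> (\<Sum>i<n. 4 * real m)"
        by (intro sum_mono) auto
      then show ?thesis by (intro order_trans[OF sum_abs]) simp
    qed
    have "\<bar>g' j w\<bar> \<le> (\<Sum>x\<in>data. dat.wt w x * (real n * (4 * real m) * B))"
      unfolding g'_def
    proof (intro order_trans[OF sum_abs] sum_mono)
      fix x assume x: "x \<in> data"
      have "\<bar>dat.wt w x * (\<Sum>i<n. uresid w (x i) j / (1 - (w j)\<^sup>2)) * G x j\<bar>
          = dat.wt w x * (\<bar>\<Sum>i<n. uresid w (x i) j / (1 - (w j)\<^sup>2)\<bar> * \<bar>G x j\<bar>)"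
        using dat_wt_nonneg[OF w x] by (simp only: abs_mult abs_of_nonneg mult.assoc)
      also have "\<dots> \<le> dat.wt w x * (real n * (4 * real m) * B)"
        using *[OF x] G_bound[OF x j] dat_wt_nonneg[OF w x] by (intro mult_left_mono mult_mono) auto
      finally show "\<bar>dat.wt w x * (\<Sum>i<n. uresid w (x i) j / (1 - (w j)\<^sup>2)) * G x j\<bar>
        \<le> dat.wt w x * (real n * (4 * real m) * B)" .
    qed
    then show ?thesis by (simp only: sum_distrib_right[symmetric] dat.sum_wt mult_1)
  qed
  \<comment> \<open>subtracting \<open>w j / 4\<close> cancels the \<open>(w j)\<^sup>2\<close> terms against the bound of \<open>dot_g_lower\<close>\<close>
  have "\<exists>w\<in>cube. 0 \<le> (\<Sum>j<d. (r\<^sup>2 - (w j)\<^sup>2) * (g' j w - 1 / 4) - 2 * w j * (g j w - w j / 4))"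
  proof (rule fingerprinting_point[where C = C])
    show "0 < r" by (rule r(1))
    fix j w assume j: "j < d" and w: "w \<in> cube"
    have "((\<lambda>t. g j (w(j := t))) has_real_derivative g' j w) (at (w j))"
      unfolding g_def g'_def using dat_wt_deriv[OF w j] by (intro DERIV_sum DERIV_cmult_right) auto
    then show "((\<lambda>t. g j (w(j := t)) - (w(j := t)) j / 4) has_real_derivative g' j w - 1 / 4) (at (w j))"
      by (auto intro!: derivative_eq_intros)
    have "0 \<le> real n * (4 * real m) * B" using B_pos by simp
    then show "\<bar>g j w - w j / 4\<bar> \<le> C \<and> \<bar>g' j w - 1 / 4\<bar> \<le> C"
      using gb[OF w j] g'b[OF w j] cubeD[OF w j] r B_pos unfolding C_def by linarith
  next
    fix j assume j: "j < d"
    have wj: "(\<lambda>w. w j) \<in> borel_measurable (PiM {..<d} (\<lambda>_. borel :: real measure))"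
      using j by (intro measurable_component_singleton) simp
    show "(\<lambda>w. g j w - w j / 4) \<in> borel_measurable (PiM {..<d} (\<lambda>_. borel))"
      unfolding g_def using measurable_dat_wt wj
      by (intro borel_measurable_diff borel_measurable_sum borel_measurable_times borel_measurable_divide
          borel_measurable_const)
    show "(\<lambda>w. g' j w - 1 / 4) \<in> borel_measurable (PiM {..<d} (\<lambda>_. borel))"
      unfolding g'_def using measurable_dat_wt wj measurable_uresid[OF j]
      by (intro borel_measurable_diff borel_measurable_sum borel_measurable_times borel_measurable_divide
          borel_measurable_power borel_measurable_const)
  qed
  then obtain w where w: "w \<in> cube"
    and pos: "0 \<le> (\<Sum>j<d. (r\<^sup>2 - (w j)\<^sup>2) * (g' j w - 1 / 4) - 2 * w j * (g j w - w j / 4))" by blast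
  define W2 where "W2 = (\<Sum>j<d. (w j)\<^sup>2)"
  have "(\<Sum>j<d. (r\<^sup>2 - (w j)\<^sup>2) * (g' j w - 1 / 4) - 2 * w j * (g j w - w j / 4))
      = (\<Sum>j<d. (r\<^sup>2 - (w j)\<^sup>2) * g' j w) - 1 / 4 * (r\<^sup>2 * real d - W2) - 2 * (\<Sum>j<d. w j * g j w) + 1 / 2 * W2"
  proof -
    have "r\<^sup>2 * real d - W2 = (\<Sum>j<d. r\<^sup>2 - (w j)\<^sup>2)" by (simp add: W2_def sum_subtractf mult.commute)
    then show ?thesis
      by (simp only: W2_def sum_distrib_left sum_subtractf[symmetric] sum.distrib[symmetric])
         (rule sum.cong, auto simp: algebra_simps power2_eq_square)
  qed
  then have "r\<^sup>2 * real d / 30 \<le> (\<Sum>j<d. (r\<^sup>2 - (w j)\<^sup>2) * g' j w)"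
  proof -
    assume "(\<Sum>j<d. (r\<^sup>2 - (w j)\<^sup>2) * (g' j w - 1 / 4) - 2 * w j * (g j w - w j / 4))
      = (\<Sum>j<d. (r\<^sup>2 - (w j)\<^sup>2) * g' j w) - 1 / 4 * (r\<^sup>2 * real d - W2) - 2 * (\<Sum>j<d. w j * g j w) + 1 / 2 * W2"
    moreover have "0 \<le> r\<^sup>2 * real d" by simp
    moreover have "X / 30 \<le> A"
      if "E = A - 1 / 4 * (X - W2) - 2 * D + 1 / 2 * W2" "0 \<le> X" "0 \<le> E"
        "3 / 8 * W2 - (2 / 21 + 1 / 100) * X \<le> D" for A D E X :: real
      using that by (simp add: field_simps)
    ultimately show ?thesis using pos dot_g_lower[OF w, folded W2_def] by blast
  qed
  also have "\<dots> = (\<Sum>x\<in>data. dat.wt w x * (\<Sum>j<d. (\<Sum>i<n. lam w j * uresid w (x i) j) * G x j))"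
  proof -
    have lam_sum: "(r\<^sup>2 - (w j)\<^sup>2) * (\<Sum>i<n. uresid w (x i) j / (1 - (w j)\<^sup>2)) = (\<Sum>i<n. lam w j * uresid w (x i) j)" for x j
      by (simp add: lam_def sum_distrib_left)
    have "(r\<^sup>2 - (w j)\<^sup>2) * g' j w = (\<Sum>x\<in>data. dat.wt w x * ((\<Sum>i<n. lam w j * uresid w (x i) j) * G x j))" for j
      unfolding g'_def sum_distrib_left[of "r\<^sup>2 - (w j)\<^sup>2" _ data] lam_sum[symmetric]
      by (intro sum.cong refl) (simp only: mult_ac)
    then show ?thesis by (simp only: sum_distrib_left[of "dat.wt w _"]) (rule sum.swap)
  qed
  finally show ?thesis using w by blast
qed

lemma nonprivate_bound: "real d / 30 \<le> B * sqrt (real n * real m * p * real d)"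
proof -
  obtain w where w: "w \<in> cube" and
    le: "r\<^sup>2 * real d / 30 \<le> (\<Sum>x\<in>data. dat.wt w x * (\<Sum>j<d. (\<Sum>i<n. lam w j * uresid w (x i) j) * G x j))"
    using fingerprinting by blast
  note le
  also have "\<dots> \<le> (\<Sum>x\<in>data. dat.wt w x * (norm2 d (\<lambda>j. \<Sum>i<n. lam w j * uresid w (x i) j) * B))"
    using dat_wt_nonneg[OF w] dot_G_le by (intro sum_mono mult_left_mono)
  also have "\<dots> = B * (\<Sum>x\<in>data. dat.wt w x * norm2 d (\<lambda>j. \<Sum>i<n. lam w j * uresid w (x i) j))"
    by (simp add: sum_distrib_left mult_ac)
  also have "\<dots> \<le> B * (r\<^sup>2 * sqrt (real n * real m * p * real d))"
    using dat_resid_norm[OF w] B_pos by (intro mult_left_mono) auto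
  finally have "r\<^sup>2 * (real d / 30) \<le> r\<^sup>2 * (B * sqrt (real n * real m * p * real d))" by (simp add: mult_ac)
  then show ?thesis using r by (simp add: mult_le_cancel_left)
qed

lemma private_bound:
  assumes \<epsilon>: "0 \<le> \<epsilon>" "\<epsilon> \<le> 1" and \<delta>: "0 \<le> \<delta>"
    and DP: "\<And>k x x' S. \<lbrakk>k < n; x \<in> data; x' \<in> data; \<And>i. i \<noteq> k \<Longrightarrow> x i = x' i; S \<in> sets (euclid d)\<rbrakk>
      \<Longrightarrow> measure (K x) S \<le> exp \<epsilon> * measure (K x') S + \<delta>"
  shows "real d / 30 \<le> 2 * real n * B * (\<epsilon> * min (real m * p) (sqrt (real m * p)) + \<delta> * sqrt (real m * p * real d))"
proof -
  obtain w where w: "w \<in> cube" and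
    le: "r\<^sup>2 * real d / 30 \<le> (\<Sum>x\<in>data. dat.wt w x * (\<Sum>j<d. (\<Sum>i<n. lam w j * uresid w (x i) j) * G x j))"
    using fingerprinting by blast
  define \<phi> where "\<phi> = (\<lambda>u y. \<Sum>j<d. (lam w j * uresid w u j) * N y j)"
  define \<tau> where "\<tau> = min (real m * p) (sqrt (real m * p))"
  define T where "T = (\<lambda>u. norm2 d (\<lambda>j. lam w j * uresid w u j) * B)"
  \<comment> \<open>With \<open>y\<close> fixed, \<open>\<phi>\<close> is a linear form in the
    person's score with the cut-off output in its coefficients; this reading gives the centring and
    the first moment. The sup bound \<open>T\<close> reads it the other way, with the score
    fixed.\<close>
  have \<phi>_alt: "\<phi> u y = (\<Sum>j<d. (lam w j * N y j) * uresid w u j)" for u y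
    unfolding \<phi>_def by (simp add: mult_ac)
  have abs1: "(\<Sum>u\<in>users. usr.wt w u * \<bar>\<phi> u y\<bar>) \<le> \<tau> * (r\<^sup>2 * B)" for y
  proof -
    define Z where "Z = sqrt (\<Sum>j<d. (lam w j * N y j)\<^sup>2 * (1 - (w j)\<^sup>2))"
    have Z: "Z \<le> r\<^sup>2 * B" unfolding Z_def using lam_dot_var[OF w N_sq] B_pos by simp
    have "0 \<le> \<tau>" using p by (simp add: \<tau>_def)
    moreover have "(\<Sum>u\<in>users. usr.wt w u * \<bar>\<phi> u y\<bar>) \<le> \<tau> * Z"
      unfolding \<phi>_alt \<tau>_def min_def Z_def using uresid_abs_linear[OF w] uresid_abs_sqrt[OF w] by simp
    ultimately show ?thesis using Z mult_left_mono by fastforce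
  qed
  have each: "(\<Sum>x\<in>data. dat.wt w x * (\<integral>y. \<phi> (x k) y \<partial>K x))
      \<le> 2 * \<epsilon> * (\<tau> * (r\<^sup>2 * B)) + 2 * \<delta> * (\<Sum>u\<in>users. usr.wt w u * T u)" if k: "k < n" for k
  proof (rule dat.private_correlation[where R = "euclid d"])
    show "k \<in> {..<n}" using k by simp
    show "0 \<le> usr.wt w u" if "u \<in> users" for u using that by (rule usr_wt_nonneg[OF w])
    show "prob_space (K x) \<and> sets (K x) = sets (euclid d)" if "x \<in> data" for x using K[OF that] by simp
    show "measure (K x) S \<le> exp \<epsilon> * measure (K x') S + \<delta>"
      if "x \<in> data" "x' \<in> data" "\<And>i. i \<noteq> k \<Longrightarrow> x i = x' i" "S \<in> sets (euclid d)" for x x' S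
      using DP[OF k that] .
    show "\<phi> u \<in> borel_measurable (euclid d)" for u
      unfolding \<phi>_def using measurable_N by (intro borel_measurable_sum borel_measurable_times) auto
    show "\<bar>\<phi> u y\<bar> \<le> T u" for u y unfolding \<phi>_def T_def by (rule N_dot)
    show "(\<Sum>u\<in>users. usr.wt w u * \<phi> u y) = 0" for y unfolding \<phi>_alt by (rule uresid_mean)
    show "(\<Sum>u\<in>users. usr.wt w u * \<bar>\<phi> u y\<bar>) \<le> \<tau> * (r\<^sup>2 * B)" for y by (rule abs1)
  qed (use \<epsilon> \<delta> in auto)
  have T: "(\<Sum>u\<in>users. usr.wt w u * T u) \<le> r\<^sup>2 * sqrt (real m * p * real d) * B"
    unfolding T_def mult.assoc[symmetric] sum_distrib_right[symmetric]
    using uresid_norm[OF w] B_pos by (intro mult_right_mono) auto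
  have "(\<Sum>x\<in>data. dat.wt w x * (\<Sum>j<d. (\<Sum>i<n. lam w j * uresid w (x i) j) * G x j))
      = (\<Sum>k<n. \<Sum>x\<in>data. dat.wt w x * (\<integral>y. \<phi> (x k) y \<partial>K x))"
  proof -
    have "(\<Sum>j<d. (\<Sum>i<n. lam w j * uresid w (x i) j) * G x j) = (\<Sum>k<n. \<integral>y. \<phi> (x k) y \<partial>K x)"
      if x: "x \<in> data" for x
    proof -
      have "(\<Sum>k<n. \<integral>y. \<phi> (x k) y \<partial>K x) = (\<Sum>k<n. \<Sum>j<d. lam w j * uresid w (x k) j * G x j)"
        unfolding \<phi>_def by (simp only: dot_G[OF x])
      then show ?thesis by (simp only: sum_distrib_right) (rule sum.swap)
    qed
    then show ?thesis by (simp only: sum_distrib_left cong: sum.cong) (rule sum.swap)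
  qed
  also have "\<dots> \<le> (\<Sum>k<n. 2 * \<epsilon> * (\<tau> * (r\<^sup>2 * B)) + 2 * \<delta> * (\<Sum>u\<in>users. usr.wt w u * T u))"
    using each by (intro sum_mono) auto
  also have "\<dots> \<le> (\<Sum>k<n. 2 * \<epsilon> * (\<tau> * (r\<^sup>2 * B)) + 2 * \<delta> * (r\<^sup>2 * sqrt (real m * p * real d) * B))"
    using T \<delta> by (intro sum_mono add_left_mono mult_left_mono) auto
  also have "\<dots> = r\<^sup>2 * (2 * real n * B * (\<epsilon> * \<tau> + \<delta> * sqrt (real m * p * real d)))"
    by (simp add: algebra_simps)
  finally have "r\<^sup>2 * (real d / 30) \<le> r\<^sup>2 * (2 * real n * B * (\<epsilon> * \<tau> + \<delta> * sqrt (real m * p * real d)))"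
    using le by simp
  then show ?thesis using r unfolding \<tau>_def by (simp add: mult_le_cancel_left)
qed

end

section \<open>Moments and the sampling model\<close>

text \<open>For negative \<open>x = - y\<close> the claim becomes
  \<open>1 \<le> (1 - y + y\<^sup>2) * exp y\<close>, which follows from the quadratic Taylor lower
  bound for \<open>exp y\<close>.\<close>

lemma exp_le_quadratic:
  fixes x :: real
  assumes "\<bar>x\<bar> \<le> 1" shows "exp x \<le> 1 + x + x\<^sup>2"
proof (cases "0 \<le> x")
  case True
  then show ?thesis using assms exp_bound[of x] by simp
next
  case False
  define y where "y = - x"
  have y: "0 < y" using False by (simp add: y_def)
  have "1 + y + y\<^sup>2 / 2 \<le> exp y" using y by (intro exp_lower_Taylor_quadratic) simp
  moreover have "1 \<le> (1 - y + y\<^sup>2) * (1 + y + y\<^sup>2 / 2)"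
  proof -
    have "(1 - y + y\<^sup>2) * (1 + y + y\<^sup>2 / 2) = 1 + y\<^sup>2 / 2 + y * y\<^sup>2 / 2 + y\<^sup>2 * y\<^sup>2 / 2"
      by (simp add: power2_eq_square field_simps)
    then show ?thesis using y by simp
  qed
  moreover have "0 \<le> 1 - y + y\<^sup>2"
  proof -
    have "0 \<le> (1 - y / 2)\<^sup>2 + 3 / 4 * y\<^sup>2" by simp
    then show ?thesis by (simp add: power2_eq_square algebra_simps)
  qed
  ultimately have "1 \<le> (1 - y + y\<^sup>2) * exp y"
    by (meson mult_left_mono order_trans)
  then have "exp (- y) * 1 \<le> exp (- y) * ((1 - y + y\<^sup>2) * exp y)" by (intro mult_left_mono) auto
  also have "\<dots> = 1 - y + y\<^sup>2" by (simp add: exp_minus)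
  finally show ?thesis by (simp add: y_def)
qed

text \<open>The inequality \<open>t \<le> exp t\<close> at \<open>t = u / (2 * k)\<close>, raised to
  the power \<open>k\<close>. It trades a moment of real order \<open>k\<close> for an exponential
  moment, which factorises over coordinates; the rate 1/2 meets the restriction on \<open>v\<close>
  in \<open>signs_mgf\<close>.\<close>

lemma powr_le_exp_half:
  fixes u k :: real
  assumes "0 \<le> u" "1 \<le> k"
  shows "u powr k \<le> (2 * k) powr k * exp (u / 2)"
proof -
  have "u / (2 * k) \<le> exp (u / (2 * k))"
    using exp_ge_add_one_self[of "u / (2 * k)"] by linarith
  then have "u \<le> 2 * k * exp (u / (2 * k))" using assms by (simp add: field_simps)
  then have "u powr k \<le> (2 * k * exp (u / (2 * k))) powr k" using assms by (intro powr_mono2) auto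
  also have "\<dots> = (2 * k) powr k * exp (u / 2)"
    using assms by (simp add: powr_mult exp_powr_real)
  finally show ?thesis .
qed

lemma success_prob_finite:
  assumes fin: "finite_dist (iid_data n m D) A q" and D: "sets D = sets (euclid d)" and M: "mechanism n m d M"
  shows "success_prob n m d \<alpha> M D = (\<Sum>x\<in>A. q x *
    measure (M x) {y \<in> space (euclid d). norm2 d (\<lambda>i. y i - mean D i) \<le> \<alpha>})"
proof -
  define S where "S = {y \<in> space (euclid d). norm2 d (\<lambda>i. y i - mean D i) \<le> \<alpha>}"
  have S: "S \<in> sets (euclid d)" unfolding S_def by (rule sets_ball_euclid)
  interpret I: prob_space "iid_data n m D" using fin by (simp add: finite_dist_def)
  have "sets (iid_data n m D) = sets (data_space n m d)"
    unfolding iid_data_def data_space_def by (intro sets_PiM_cong refl D)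
  then have iid: "measurable (iid_data n m D) (subprob_algebra (euclid d))
      = measurable (data_space n m d) (subprob_algebra (euclid d))"
    by (rule measurable_cong_sets) (rule refl)
  have M': "M \<in> iid_data n m D \<rightarrow>\<^sub>M subprob_algebra (euclid d)"
    unfolding iid by (rule measurable_prob_algebraD[OF M[unfolded mechanism_def]])
  have "success_prob n m d \<alpha> M D = (\<integral>x. measure (M x) S \<partial>iid_data n m D)"
    unfolding success_prob_def S_def[symmetric] by (rule I.measure_bind[OF M' S])
  also have "\<dots> = (\<Sum>x\<in>A. q x * measure (M x) S)"
    by (rule finite_dist_integral[OF fin])
       (rule measurable_compose[OF M' measurable_measure_subprob_algebra[OF S]])
  finally show ?thesis unfolding S_def .
qed

text \<open>The first summand covers the sign vectors, with \<open>2 * exp 2\<close> dominating the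
  two exponential moments in \<open>cloud_moment\<close>; the \<open>+ 1\<close> pays for the
  origin. No dependence on the dimension is allowed here.\<close>

definition moment_const :: "real \<Rightarrow> real" where
  "moment_const k = (2 * k) powr k * (2 * exp 2) + 1"

context sign_cloud
begin

text \<open>A sub-Gaussian bound from independent centred coordinates. Residuals are at most 2 in
  absolute value, so \<open>\<bar>v j\<bar> \<le> 1/2\<close> keeps the exponents within the range
  of \<open>exp_le_quadratic\<close>.\<close>

lemma signs_mgf:
  assumes w: "w \<in> cube" and v: "\<And>j. j < d \<Longrightarrow> \<bar>v j\<bar> \<le> 1 / 2"
  shows "(\<Sum>y\<in>signs. signs.wt w y * exp (\<Sum>j<d. v j * resid d s w y j)) \<le> exp (\<Sum>j<d. (v j)\<^sup>2)"
proof -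
  have "(\<Sum>y\<in>signs. signs.wt w y * exp (\<Sum>j<d. v j * resid d s w y j))
      = (\<Sum>y\<in>signs. signs.wt w y * (\<Prod>j<d. exp (v j * (y j / s - w j))))"
    by (simp add: resid_signs exp_sum)
  also have "\<dots> = (\<Prod>j<d. \<Sum>z\<in>{-s, s}. sgn_wt w j z * exp (v j * (z / s - w j)))"
    by (rule signs.sum_wt_prod[of w "\<lambda>j z. exp (v j * (z / s - w j))"])
  also have "\<dots> \<le> (\<Prod>j<d. exp ((v j)\<^sup>2))"
  proof (rule prod_mono)
    fix j assume "j \<in> {..<d}"
    then have j: "j < d" by simp
    have wj: "\<bar>w j\<bar> \<le> 1/2" using cubeD[OF w j] r by simp
    have nn: "0 \<le> sgn_wt w j z" if "z \<in> {-s, s}" for z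
      using that wj s by (auto simp: abs_le_iff)
    have "exp (v j * (z / s - w j)) \<le> 1 + v j * (z / s - w j) + (v j * (z / s - w j))\<^sup>2" if "z \<in> {-s, s}" for z
    proof (rule exp_le_quadratic)
      have "\<bar>z / s - w j\<bar> \<le> 2" using that wj s by (auto simp: abs_le_iff)
      then have "\<bar>v j\<bar> * \<bar>z / s - w j\<bar> \<le> 1/2 * 2" using v[OF j] by (intro mult_mono) auto
      then show "\<bar>v j * (z / s - w j)\<bar> \<le> 1" by (simp add: abs_mult)
    qed
    then have "(\<Sum>z\<in>{-s, s}. sgn_wt w j z * exp (v j * (z / s - w j)))
        \<le> (\<Sum>z\<in>{-s, s}. sgn_wt w j z * (1 + v j * (z / s - w j) + (v j * (z / s - w j))\<^sup>2))"
      using nn by (intro sum_mono mult_left_mono) auto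
    also have "\<dots> = (\<Sum>z\<in>{-s, s}. sgn_wt w j z) + (\<Sum>z\<in>{-s, s}. sgn_wt w j z * (v j * (z / s - w j)))
        + (\<Sum>z\<in>{-s, s}. sgn_wt w j z * (v j * (z / s - w j))\<^sup>2)"
      by (simp only: distrib_left sum.distrib mult_1_right)
    also have "\<dots> = 1 + (v j)\<^sup>2 * (1 - (w j)\<^sup>2)"
      unfolding sign_mean sign_var using signs.sum1[of j w] j by simp
    also have "\<dots> \<le> 1 + (v j)\<^sup>2 * 1" by (intro add_left_mono mult_left_mono) auto
    also have "\<dots> \<le> exp ((v j)\<^sup>2)" using exp_ge_add_one_self[of "(v j)\<^sup>2"] by simp
    finally have "(\<Sum>z\<in>{-s, s}. sgn_wt w j z * exp (v j * (z / s - w j))) \<le> exp ((v j)\<^sup>2)" .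
    moreover have "0 \<le> (\<Sum>z\<in>{-s, s}. sgn_wt w j z * exp (v j * (z / s - w j)))"
      using nn by (intro sum_nonneg mult_nonneg_nonneg) auto
    ultimately show "0 \<le> (\<Sum>z\<in>{-s, s}. sgn_wt w j z * exp (v j * (z / s - w j))) \<and>
      (\<Sum>z\<in>{-s, s}. sgn_wt w j z * exp (v j * (z / s - w j))) \<le> exp ((v j)\<^sup>2)" by blast
  qed
  also have "\<dots> = exp (\<Sum>j<d. (v j)\<^sup>2)" by (simp add: exp_sum)
  finally show ?thesis .
qed

text \<open>With \<open>z\<close> the inner product of \<open>w\<close> and \<open>v\<close>,
  centring shifts the scaled linear form on the signs by \<open>(1 - p) * z\<close> and moves the
  origin to \<open>- p * s * z\<close>. By \<open>pr\<close> either the atom is absent or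
  \<open>w\<close> has norm at most 1, so \<open>z\<close> is harmless;
  \<open>p powr k \<le> p\<close> brings the origin down to order
  \<open>p * s powr k\<close>.\<close>

lemma cloud_moment:
  assumes w: "w \<in> cube" and v: "(\<Sum>j<d. (v j)\<^sup>2) = 1" and k: "1 \<le> k"
    and pr: "p = 1 \<or> r * sqrt (real d) \<le> 1"
  shows "(\<Sum>y\<in>cloud d s. cloud_wt d p s w y * \<bar>\<Sum>i<d. (y i - p * s * w i) * v i\<bar> powr k)
    \<le> p * s powr k * moment_const k"
proof -
  define z where "z = (\<Sum>i<d. w i * v i)"
  have z: "(1 - p) * \<bar>z\<bar> \<le> 1" "p \<noteq> 1 \<Longrightarrow> \<bar>z\<bar> \<le> 1"
  proof -
    show "\<bar>z\<bar> \<le> 1" if "p \<noteq> 1"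
    proof -
      have "\<bar>z\<bar> \<le> norm2 d w * norm2 d v"
        unfolding z_def by (rule order_trans[OF sum_abs]) (simp add: abs_mult L2_set_mult_ineq)
      also have "norm2 d v = 1" using v by (simp add: L2_set_def)
      also have "norm2 d w \<le> 1"
      proof -
        have "(\<Sum>j<d. (w j)\<^sup>2) \<le> (\<Sum>j<d. r\<^sup>2)" using cube_sq[OF w] by (intro sum_mono) auto
        then have "norm2 d w \<le> sqrt (real d * r\<^sup>2)" by (simp add: L2_set_def)
        also have "\<dots> = r * sqrt (real d)" using r by (simp add: real_sqrt_mult)
        finally show ?thesis using pr that by simp
      qed
      finally show ?thesis by simp
    qed
    then show "(1 - p) * \<bar>z\<bar> \<le> 1"
      using p mult_le_one[of "1 - p" "\<bar>z\<bar>"] by (cases "p = 1") auto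
  qed
  have pk: "p powr k \<le> p" using p k powr_mono'[of 1 k p] by simp
  have org: "(1 - p) * \<bar>\<Sum>i<d. (origin d i - p * s * w i) * v i\<bar> powr k \<le> p * s powr k"
  proof (cases "p = 1")
    case False
    have "(\<Sum>i<d. (origin d i - p * s * w i) * v i) = - (p * s) * z"
      by (simp add: origin_def z_def sum_distrib_left mult_ac sum_negf)
    then have "\<bar>\<Sum>i<d. (origin d i - p * s * w i) * v i\<bar> = p * s * \<bar>z\<bar>"
      using p s by (simp add: abs_mult)
    also have "\<dots> \<le> p * s * 1" using z(2)[OF False] p s by (intro mult_left_mono) auto
    finally have "\<bar>\<Sum>i<d. (origin d i - p * s * w i) * v i\<bar> powr k \<le> (p * s) powr k"
      using k by (intro powr_mono2) auto
    also have "\<dots> \<le> p * s powr k" using p s pk by (simp add: powr_mult mult_right_mono)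
    finally have "(1 - p) * \<bar>\<Sum>i<d. (origin d i - p * s * w i) * v i\<bar> powr k \<le> 1 * (p * s powr k)"
      using p by (intro mult_mono) auto
    then show ?thesis by simp
  qed (use p in simp)
  define A where "A = (\<lambda>y. \<Sum>j<d. v j * resid d s w y j)"
  have pt: "\<bar>\<Sum>i<d. (y i - p * s * w i) * v i\<bar> powr k
      \<le> s powr k * ((2 * k) powr k * exp (1/2) * (exp (A y / 2) + exp (- A y / 2)))" if y: "y \<in> signs" for y
  proof -
    have "(\<Sum>i<d. (y i - p * s * w i) * v i) = s * (A y + (1 - p) * z)"
    proof -
      have "(y i - p * s * w i) * v i = s * (v i * (y i / s - w i)) + s * (1 - p) * (w i * v i)" for i
        using s by (simp add: field_simps)
      then have "(\<Sum>i<d. (y i - p * s * w i) * v i)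
          = (\<Sum>i<d. s * (v i * (y i / s - w i)) + s * (1 - p) * (w i * v i))" by simp
      also have "\<dots> = s * A y + s * (1 - p) * z"
        by (simp only: A_def z_def sum.distrib sum_distrib_left resid_signs[OF y])
      finally show ?thesis by (simp add: distrib_left)
    qed
    then have "\<bar>\<Sum>i<d. (y i - p * s * w i) * v i\<bar> = s * \<bar>A y + (1 - p) * z\<bar>"
      using s by (simp add: abs_mult)
    also have "\<dots> \<le> s * (\<bar>A y\<bar> + 1)"
    proof -
      have "\<bar>(1 - p) * z\<bar> \<le> 1" using z(1) p by (simp add: abs_mult)
      then show ?thesis using s by (intro mult_left_mono) auto
    qed
    finally have "\<bar>\<Sum>i<d. (y i - p * s * w i) * v i\<bar> powr k \<le> (s * (\<bar>A y\<bar> + 1)) powr k"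
      using k by (intro powr_mono2) auto
    also have "\<dots> = s powr k * (\<bar>A y\<bar> + 1) powr k" using s by (simp add: powr_mult)
    also have "(\<bar>A y\<bar> + 1) powr k \<le> (2 * k) powr k * exp ((\<bar>A y\<bar> + 1) / 2)"
      using k by (intro powr_le_exp_half) auto
    also have "exp ((\<bar>A y\<bar> + 1) / 2) = exp (1/2) * exp (\<bar>A y\<bar> / 2)"
      by (simp add: exp_add[symmetric] add_divide_distrib)
    also have "exp (\<bar>A y\<bar> / 2) \<le> exp (A y / 2) + exp (- A y / 2)"
      by (cases "0 \<le> A y") auto
    finally show ?thesis using s by (simp add: mult_left_mono mult.assoc)
  qed
  have vj: "\<bar>v j\<bar> \<le> 1" if "j < d" for j
    using member_le_L2_set[of "{..<d}" j "\<lambda>j. \<bar>v j\<bar>"] that v by (simp add: L2_set_def)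
  have mgf: "(\<Sum>y\<in>signs. signs.wt w y * exp (c * A y / 2)) \<le> exp 1" if "c = 1 \<or> c = -1" for c
  proof -
    have eq: "c * A y / 2 = (\<Sum>j<d. (c * v j / 2) * resid d s w y j)" for y
      by (simp add: A_def sum_distrib_left sum_divide_distrib mult_ac)
    have "(\<Sum>y\<in>signs. signs.wt w y * exp (c * A y / 2)) \<le> exp (\<Sum>j<d. (c * v j / 2)\<^sup>2)"
      unfolding eq using vj that by (intro signs_mgf[OF w]) auto
    also have "(\<Sum>j<d. (c * v j / 2)\<^sup>2) = (\<Sum>j<d. (v j)\<^sup>2) / 4"
      using that by (auto simp: power_divide sum_divide_distrib)
    finally show ?thesis using v by (simp add: order_trans)
  qed
  have e: "exp (1/2) * (exp 1 + exp 1) \<le> 2 * exp (2::real)"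
    by (simp add: exp_add[symmetric])
  define Ck where "Ck = (2 * k) powr k * exp (1/2)"
  have "(\<Sum>y\<in>signs. signs.wt w y * \<bar>\<Sum>i<d. (y i - p * s * w i) * v i\<bar> powr k)
      \<le> (\<Sum>y\<in>signs. signs.wt w y * (s powr k * (Ck * (exp (A y / 2) + exp (- A y / 2)))))"
    unfolding Ck_def using pt signs_wt_nonneg[OF w] by (intro sum_mono mult_left_mono)
  also have "\<dots> = s powr k * (Ck * ((\<Sum>y\<in>signs. signs.wt w y * exp (1 * A y / 2)) + (\<Sum>y\<in>signs. signs.wt w y * exp ((-1) * A y / 2))))"
    by (simp add: sum_distrib_left sum.distrib[symmetric] distrib_left mult_ac)
  also have "\<dots> \<le> s powr k * (Ck * (exp 1 + exp 1))"
    using mgf[of 1] mgf[of "-1"] s by (intro mult_left_mono add_mono) (auto simp: Ck_def)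
  also have "\<dots> = s powr k * ((2 * k) powr k * (exp (1/2) * (exp 1 + exp 1)))" by (simp add: Ck_def)
  also have "\<dots> \<le> s powr k * ((2 * k) powr k * (2 * exp 2))"
    using s e by (intro mult_left_mono) auto
  finally have "p * (\<Sum>y\<in>signs. signs.wt w y * \<bar>\<Sum>i<d. (y i - p * s * w i) * v i\<bar> powr k)
      \<le> p * (s powr k * ((2 * k) powr k * (2 * exp 2)))"
    using p by (intro mult_left_mono) auto
  then show ?thesis unfolding sum_cloud using org by (simp add: moment_const_def algebra_simps)
qed

text \<open>The push-forward along the identity serves to replace the discrete sigma-algebra of
  \<open>point_measure\<close> by the one of \<open>euclid d\<close>.\<close>

definition sign_dist :: "(nat \<Rightarrow> real) \<Rightarrow> (nat \<Rightarrow> real) measure" where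
  "sign_dist w = distr (point_measure (cloud d s) (cloud_wt d p s w)) (euclid d) (\<lambda>y. y)"

lemma cloud_space: "cloud d s \<subseteq> space (euclid d)"
  by (auto simp: cloud_def origin_def euclid_def space_PiM)

lemma sets_sign_dist: "sets (sign_dist w) = sets (euclid d)" by (simp add: sign_dist_def)

lemma measurable_id_cloud: "(\<lambda>y. y) \<in> point_measure (cloud d s) (cloud_wt d p s w) \<rightarrow>\<^sub>M euclid d"
  using cloud_space by auto

lemma singleton_euclid: "y \<in> cloud d s \<Longrightarrow> {y} \<in> sets (euclid d)"
  using cloud_space by (intro singleton_sets_euclid) auto

lemma finite_dist_sign_dist:
  assumes w: "w \<in> cube"
  shows "finite_dist (sign_dist w) (cloud d s) (cloud_wt d p s w)"
proof -
  interpret P: prob_space "point_measure (cloud d s) (cloud_wt d p s w)" by (rule prob_cloud_point[OF w])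
  have "measure (sign_dist w) {y} = cloud_wt d p s w y" if y: "y \<in> cloud d s" for y
  proof -
    have "measure (sign_dist w) {y} = measure (point_measure (cloud d s) (cloud_wt d p s w)) ({y} \<inter> cloud d s)"
      unfolding sign_dist_def
      by (subst measure_distr[OF measurable_id_cloud singleton_euclid[OF y]])
         (simp add: space_point_measure vimage_def)
    also have "\<dots> = cloud_wt d p s w y"
      using y cloud_wt_nonneg[OF w y] finite_cloud
      by (simp add: measure_def emeasure_point_measure_finite)
    finally show ?thesis .
  qed
  moreover have "prob_space (sign_dist w)" unfolding sign_dist_def by (rule P.prob_space_distr[OF measurable_id_cloud])
  ultimately show ?thesis
    unfolding finite_dist_def using finite_cloud singleton_euclid sum_cloud_wt by (simp add: sets_sign_dist)
qed

lemma integrable_sign_dist: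
  fixes f :: "_ \<Rightarrow> real"
  assumes "f \<in> borel_measurable (euclid d)"
  shows "integrable (sign_dist w) f"
  unfolding sign_dist_def using measurable_id_cloud assms
  by (subst integrable_distr_eq) (auto intro!: integrable_point_measure_finite finite_cloud)

lemma integral_sign_dist:
  fixes f :: "_ \<Rightarrow> real"
  assumes "w \<in> cube" "f \<in> borel_measurable (euclid d)"
  shows "(\<integral>y. f y \<partial>sign_dist w) = (\<Sum>y\<in>cloud d s. cloud_wt d p s w y * f y)"
proof (rule finite_dist_integral[OF finite_dist_sign_dist[OF assms(1)]])
  show "f \<in> borel_measurable (sign_dist w)"
    by (subst measurable_cong_sets[OF sets_sign_dist refl]) (rule assms(2))
qed

lemma mean_sign_dist: "w \<in> cube \<Longrightarrow> j < d \<Longrightarrow> mean (sign_dist w) j = p * s * w j"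
  unfolding mean_def by (subst integral_sign_dist[OF _ measurable_coord]) (simp_all add: cloud_mean)

lemma sign_dist_prob_algebra: "w \<in> cube \<Longrightarrow> sign_dist w \<in> space (prob_algebra (euclid d))"
  using finite_dist_sign_dist[of w] by (simp add: space_prob_algebra sets_sign_dist finite_dist_def)

lemma bounded_moment_sign_dist:
  assumes w: "w \<in> cube" and k: "1 \<le> k" and pr: "p = 1 \<or> r * sqrt (real d) \<le> 1"
    and C: "p * s powr k * moment_const k \<le> C"
  shows "bounded_moment d k C (sign_dist w)"
  unfolding bounded_moment_def
proof (intro conjI ballI allI impI)
  show "sign_dist w \<in> space (prob_algebra (euclid d))" by (rule sign_dist_prob_algebra[OF w])
  show "integrable (sign_dist w) (\<lambda>y. y i)" if "i < d" for i
    by (rule integrable_sign_dist[OF measurable_coord[OF that]])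
  fix v assume "v \<in> unit_sphere d"
  then have v: "(\<Sum>j<d. (v j)\<^sup>2) = 1" by (simp add: unit_sphere_def L2_set_def)
  have eq: "dot d (\<lambda>i. y i - mean (sign_dist w) i) v = (\<Sum>i<d. (y i - p * s * w i) * v i)" for y
    unfolding dot_def using mean_sign_dist[OF w] by simp
  have meas: "(\<lambda>y. \<bar>\<Sum>i<d. (y i - p * s * w i) * v i\<bar> powr k) \<in> borel_measurable (euclid d)"
  proof -
    have "(\<lambda>y. \<Sum>i<d. (y i - p * s * w i) * v i) \<in> borel_measurable (euclid d)"
      using measurable_coord
      by (intro borel_measurable_sum borel_measurable_times borel_measurable_diff borel_measurable_const) auto
    then show ?thesis by measurable
  qed
  show "integrable (sign_dist w) (\<lambda>y. \<bar>dot d (\<lambda>i. y i - mean (sign_dist w) i) v\<bar> powr k)"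
    unfolding eq by (rule integrable_sign_dist[OF meas])
  show "(\<integral>y. \<bar>dot d (\<lambda>i. y i - mean (sign_dist w) i) v\<bar> powr k \<partial>sign_dist w) \<le> C"
    unfolding eq integral_sign_dist[OF w meas] using cloud_moment[OF w v k pr] C by simp
qed

end

section \<open>Accuracy and privacy on data drawn from the sign distributions\<close>

context sign_data
begin

lemma finite_dist_iid:
  assumes w: "w \<in> cube"
  shows "finite_dist (iid_data n m (sign_dist w)) data (dat.wt w)"
proof -
  have "finite_dist (PiM {..<m} (\<lambda>_. sign_dist w)) users (usr.wt w)"
    using finite_dist_PiM[OF finite_dist_sign_dist[OF w], of "{..<m}"] unfolding usr.wt_def by simp
  from finite_dist_PiM[OF this, of "{..<n}"] show ?thesis
    unfolding iid_data_def dat.wt_def by simp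
qed

lemma data_in_space: "x \<in> data \<Longrightarrow> x \<in> space (data_space n m d)"
  unfolding data_space_def space_PiM
  using PiE_mono[of "{..<n}" "\<lambda>_. users" "\<lambda>_. PiE {..<m} (\<lambda>_. space (euclid d))"]
    PiE_mono[of "{..<m}" "\<lambda>_. cloud d s" "\<lambda>_. space (euclid d)"] cloud_space
  by blast

lemma success_prob_eq:
  assumes w: "w \<in> cube" and M: "mechanism n m d M"
  shows "success_prob n m d \<alpha> M (sign_dist w) = (\<Sum>x\<in>data. dat.wt w x *
    measure (M x) {y \<in> space (euclid d). norm2 d (\<lambda>i. y i - p * s * w i) \<le> \<alpha>})"
proof -
  have "norm2 d (\<lambda>i. y i - mean (sign_dist w) i) = norm2 d (\<lambda>i. y i - p * s * w i)" for y
    using mean_sign_dist[OF w] by (intro L2_set_cong) auto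
  then show ?thesis
    using success_prob_finite[OF finite_dist_iid[OF w] sets_sign_dist M] by simp
qed

end

lemma mechanism_prob:
  assumes "mechanism n m d M" "x \<in> space (data_space n m d)"
  shows "prob_space (M x)" "sets (M x) = sets (euclid d)"
  using measurable_space[OF assms(1)[unfolded mechanism_def] assms(2)] by (auto simp: space_prob_algebra)

lemma sign_mechanismI:
  assumes "sign_cloud d p s r" and M: "mechanism n m d M"
    and \<alpha>: "0 < \<alpha>" "100 * \<alpha> \<le> p * s * r * sqrt (real d)"
    and k: "1 \<le> k" and pr: "p = 1 \<or> r * sqrt (real d) \<le> 1" and C: "p * s powr k * moment_const k \<le> C"
    and succ: "\<And>D. bounded_moment d k C D \<Longrightarrow> success_prob n m d \<alpha> M D \<ge> 2 / 3"
  shows "sign_mechanism d p s r n m M \<alpha>"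
proof -
  interpret sign_data d p s r n m using assms(1) by (simp add: sign_data_def)
  show ?thesis
  proof (rule sign_mechanism.intro[OF sign_data_axioms], rule sign_mechanism_axioms.intro)
    fix x assume "x \<in> data"
    note xs = data_in_space[OF this]
    show "prob_space (M x)" by (rule mechanism_prob(1)[OF M xs])
    show "sets (M x) = sets (euclid d)" by (rule mechanism_prob(2)[OF M xs])
  next
    show "0 < \<alpha>" by (rule \<alpha>(1))
    show "100 * \<alpha> \<le> p * s * r * sqrt (real d)" by (rule \<alpha>(2))
  next
    fix w assume w: "w \<in> cube"
    show "2 / 3 \<le> (\<Sum>x\<in>data. dat.wt w x *
      measure (M x) {y \<in> space (euclid d). norm2 d (\<lambda>i. y i - p * s * w i) \<le> \<alpha>})"
      using succ[OF bounded_moment_sign_dist[OF w k pr C]] unfolding success_prob_eq[OF w M] .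
  qed
qed

lemma (in sign_data) DP_data:
  assumes DP: "person_level_DP n m d \<epsilon> \<delta> M" and x: "x \<in> data" "x' \<in> data"
    and nb: "\<And>i. i \<noteq> k \<Longrightarrow> x i = x' i" and S: "S \<in> sets (euclid d)"
  shows "measure (M x) S \<le> exp \<epsilon> * measure (M x') S + \<delta>"
proof -
  have "card {i. i < n \<and> x i \<noteq> x' i} \<le> card {k}"
    using nb by (intro card_mono) auto
  then show ?thesis
    using DP data_in_space[OF x(1)] data_in_space[OF x(2)] S unfolding person_level_DP_def by auto
qed

section \<open>Point masses and the choice of parameters\<close>

text \<open>A hybrid argument: \<open>h k\<close> takes the first \<open>k\<close> persons from
  \<open>x'\<close>, so consecutive hybrids differ in at most one person.\<close>

lemma group_privacy:
  assumes DP: "person_level_DP n m d \<epsilon> \<delta> M" and \<epsilon>: "0 \<le> \<epsilon>" and \<delta>: "0 \<le> \<delta>"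
    and x: "x \<in> space (data_space n m d)" "x' \<in> space (data_space n m d)"
    and S: "S \<in> sets (euclid d)"
  shows "measure (M x) S \<le> exp (real n * \<epsilon>) * (measure (M x') S + real n * \<delta>)"
proof -
  define h where "h = (\<lambda>k i. if i < k then x' i else x i)"
  have hs: "h k \<in> space (data_space n m d)" for k
    using x unfolding h_def data_space_def space_PiM by (auto simp: PiE_iff extensional_def)
  have "measure (M x) S \<le> exp (real k * \<epsilon>) * (measure (M (h k)) S + real k * \<delta>)" for k
  proof (induction k)
    case 0
    have "h 0 = x" by (simp add: h_def)
    then show ?case by simp
  next
    case (Suc k)
    have "card {i. i < n \<and> h k i \<noteq> h (Suc k) i} \<le> card {k}"
      by (intro card_mono) (auto simp: h_def)
    then have "measure (M (h k)) S \<le> exp \<epsilon> * measure (M (h (Suc k))) S + \<delta>"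
      using DP hs S unfolding person_level_DP_def by auto
    moreover have "\<delta> + real k * \<delta> \<le> exp \<epsilon> * (real (Suc k) * \<delta>)"
    proof -
      have "1 * (real (Suc k) * \<delta>) \<le> exp \<epsilon> * (real (Suc k) * \<delta>)"
        using \<epsilon> \<delta> by (intro mult_right_mono) auto
      then show ?thesis by (simp add: algebra_simps)
    qed
    ultimately have "measure (M (h k)) S + real k * \<delta>
        \<le> exp \<epsilon> * (measure (M (h (Suc k))) S + real (Suc k) * \<delta>)"
      by (simp add: distrib_left)
    then have "exp (real k * \<epsilon>) * (measure (M (h k)) S + real k * \<delta>)
        \<le> exp (real k * \<epsilon>) * (exp \<epsilon> * (measure (M (h (Suc k))) S + real (Suc k) * \<delta>))"
      by (intro mult_left_mono) auto
    also have "\<dots> = exp (real (Suc k) * \<epsilon>) * (measure (M (h (Suc k))) S + real (Suc k) * \<delta>)"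
      by (simp add: algebra_simps exp_add)
    finally show ?case using Suc by simp
  qed
  from this[of n] have "measure (M x) S \<le> exp (real n * \<epsilon>) * (measure (M (h n)) S + real n * \<delta>)" .
  moreover have "h n = x'"
    using x unfolding h_def data_space_def space_PiM by (auto simp: PiE_iff extensional_def)
  ultimately show ?thesis by simp
qed

definition const_data :: "nat \<Rightarrow> nat \<Rightarrow> (nat \<Rightarrow> real) \<Rightarrow> nat \<Rightarrow> nat \<Rightarrow> nat \<Rightarrow> real" where
  "const_data n m z = (\<lambda>i\<in>{..<n}. \<lambda>l\<in>{..<m}. z)"

lemma finite_dist_return:
  assumes "z \<in> space (euclid d)"
  shows "finite_dist (iid_data n m (return (euclid d) z)) {const_data n m z} (\<lambda>_. 1)"
proof -
  have r: "finite_dist (return (euclid d) z) {z} (\<lambda>_. 1)"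
    using assms singleton_sets_euclid[OF assms]
    by (simp add: finite_dist_def prob_space_return measure_return)
  have "PiE {..<m} (\<lambda>_. {z}) = {\<lambda>l\<in>{..<m}. z}"
    using PiE_singleton[of "\<lambda>l\<in>{..<m}. z" "{..<m}"] by (simp cong: PiE_cong)
  with finite_dist_PiM[OF r, of "{..<m}"]
  have u: "finite_dist (PiM {..<m} (\<lambda>_. return (euclid d) z)) {\<lambda>l\<in>{..<m}. z} (\<lambda>_. 1)" by simp
  have "PiE {..<n} (\<lambda>_. {\<lambda>l\<in>{..<m}. z}) = {const_data n m z}"
    using PiE_singleton[of "const_data n m z" "{..<n}"] by (simp add: const_data_def cong: PiE_cong)
  with finite_dist_PiM[OF u, of "{..<n}"] show ?thesis by (simp add: iid_data_def)
qed

lemma mean_return: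
  assumes "z \<in> space (euclid d)" "i < d"
  shows "mean (return (euclid d) z) i = z i"
  unfolding mean_def using assms by (intro integral_return measurable_coord)

lemma integrable_return_bounded:
  fixes f :: "_ \<Rightarrow> real"
  assumes z: "z \<in> space (euclid d)" and f: "f \<in> borel_measurable (euclid d)"
  shows "integrable (return (euclid d) z) f"
proof -
  interpret prob_space "return (euclid d) z" by (rule prob_space_return[OF z])
  have m: "f \<in> borel_measurable (return (euclid d) z)"
    by (subst measurable_cong_sets[OF sets_return refl]) (rule f)
  have "AE y in return (euclid d) z. y = z"
    by (subst AE_return[OF z]) (use singleton_sets_euclid[OF z] z in \<open>auto simp: pred_def conj_commute Collect_conv_if\<close>)
  then show ?thesis using m by (intro integrable_const_bound[of _ "\<bar>f z\<bar>"]) auto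
qed

text \<open>A point mass has zero central moments, so the moment bound does not limit the distance
  between two such instances. This rescues the case in which the sign distributions cannot reach
  scale \<open>\<alpha>\<close>.\<close>

lemma bounded_moment_return:
  assumes z: "z \<in> space (euclid d)" and C: "0 \<le> C"
  shows "bounded_moment d k C (return (euclid d) z)"
  unfolding bounded_moment_def
proof (intro conjI ballI allI impI)
  show "return (euclid d) z \<in> space (prob_algebra (euclid d))"
    using prob_space_return[OF z] by (simp add: space_prob_algebra)
  show "integrable (return (euclid d) z) (\<lambda>y. y i)" if "i < d" for i
    by (rule integrable_return_bounded[OF z measurable_coord[OF that]])
  fix v :: "nat \<Rightarrow> real"
  have eq: "dot d (\<lambda>i. y i - mean (return (euclid d) z) i) v = (\<Sum>i<d. (y i - z i) * v i)" for y
    unfolding dot_def using mean_return[OF z] by simp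
  have "(\<lambda>y. \<Sum>i<d. (y i - z i) * v i) \<in> borel_measurable (euclid d)"
    using measurable_coord
    by (intro borel_measurable_sum borel_measurable_times borel_measurable_diff borel_measurable_const) auto
  then have meas: "(\<lambda>y. \<bar>\<Sum>i<d. (y i - z i) * v i\<bar> powr k) \<in> borel_measurable (euclid d)"
    by measurable
  show "integrable (return (euclid d) z) (\<lambda>y. \<bar>dot d (\<lambda>i. y i - mean (return (euclid d) z) i) v\<bar> powr k)"
    unfolding eq by (rule integrable_return_bounded[OF z meas])
  show "(\<integral>y. \<bar>dot d (\<lambda>i. y i - mean (return (euclid d) z) i) v\<bar> powr k \<partial>return (euclid d) z) \<le> C"
    unfolding eq by (subst integral_return[OF z meas]) (simp add: C)
qed

lemma const_data_space: "z \<in> space (euclid d) \<Longrightarrow> const_data n m z \<in> space (data_space n m d)"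
  by (simp add: const_data_def data_space_def space_PiM)

text \<open>Two point masses with disjoint accuracy balls: the ball of the first has probability at
  least 2/3 under its own data and at most 1/3 under the data of the second. Changing all
  \<open>n\<close> persons forces
  \<open>exp (n * \<epsilon>) \<ge> (2/3) / (1/3 + 1/9) = 3/2\<close>, whereas
  \<open>exp (1/3) < 3/2\<close>.\<close>

lemma size_lower_bound_pure:
  assumes M: "mechanism n m d M" and DP: "person_level_DP n m d \<epsilon> \<delta> M"
    and d: "1 \<le> d" and \<alpha>: "0 < \<alpha>" and \<epsilon>: "0 \<le> \<epsilon>" and \<delta>: "0 \<le> \<delta>" "real n * \<delta> \<le> 1 / 9" and C: "0 \<le> C"
    and succ: "\<And>D. bounded_moment d k C D \<Longrightarrow> success_prob n m d \<alpha> M D \<ge> 2 / 3"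
  shows "1 / 3 \<le> real n * \<epsilon>"
proof -
  define S where "S = (\<lambda>z :: nat \<Rightarrow> real. {y \<in> space (euclid d). norm2 d (\<lambda>i. y i - z i) \<le> \<alpha>})"
  define P where "P = (\<lambda>z :: nat \<Rightarrow> real. M (const_data n m z))"
  define z0 :: "nat \<Rightarrow> real" where "z0 = (\<lambda>i\<in>{..<d}. 0)"
  \<comment> \<open>Any distance above \<open>2 * \<alpha>\<close> separates the two balls.\<close>
  define z1 :: "nat \<Rightarrow> real" where "z1 = (\<lambda>i\<in>{..<d}. if i = 0 then 3 * \<alpha> else 0)"
  have z: "z0 \<in> space (euclid d)" "z1 \<in> space (euclid d)"
    by (auto simp: z0_def z1_def euclid_def space_PiM)
  have S: "S z \<in> sets (euclid d)" for z unfolding S_def by (rule sets_ball_euclid)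
  have good: "2 / 3 \<le> measure (P z) (S z)" if z: "z \<in> space (euclid d)" for z
  proof -
    have "norm2 d (\<lambda>i. y i - mean (return (euclid d) z) i) = norm2 d (\<lambda>i. y i - z i)" for y
      using mean_return[OF z] by (intro L2_set_cong) auto
    then show ?thesis
      using success_prob_finite[OF finite_dist_return[OF z, of n m] sets_return M, of \<alpha>]
        succ[OF bounded_moment_return[OF z C]]
      by (simp add: S_def P_def)
  qed
  have "S z0 \<inter> S z1 = {}"
  proof (rule ccontr)
    assume "S z0 \<inter> S z1 \<noteq> {}"
    then obtain y where y: "norm2 d (\<lambda>i. y i - z0 i) \<le> \<alpha>" "norm2 d (\<lambda>i. y i - z1 i) \<le> \<alpha>"
      by (auto simp: S_def)
    have "\<bar>y 0 - z0 0\<bar> \<le> \<alpha>" "\<bar>y 0 - z1 0\<bar> \<le> \<alpha>"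
      using y member_le_L2_set[of "{..<d}" 0 "\<lambda>i. \<bar>y i - z0 i\<bar>"]
        member_le_L2_set[of "{..<d}" 0 "\<lambda>i. \<bar>y i - z1 i\<bar>"] d by (simp_all add: L2_set_def)
    then show False using d \<alpha> by (simp add: z0_def z1_def abs_le_iff)
  qed
  moreover have "prob_space (P z1)" "sets (P z1) = sets (euclid d)"
    unfolding P_def using mechanism_prob[OF M const_data_space[OF z(2)]] by auto
  ultimately have "measure (P z1) (S z0) + measure (P z1) (S z1) \<le> 1"
    using S finite_measure.finite_measure_Union[of "P z1" "S z0" "S z1"] prob_space.prob_le_1[of "P z1"]
    by (metis prob_space.finite_measure)
  then have "measure (P z1) (S z0) \<le> 1 / 3" using good[OF z(2)] by simp
  moreover have "2 / 3 \<le> exp (real n * \<epsilon>) * (measure (P z1) (S z0) + real n * \<delta>)"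
    using good[OF z(1)] group_privacy[OF DP \<epsilon> \<delta>(1) const_data_space[OF z(1)] const_data_space[OF z(2)] S]
    unfolding P_def by (rule order_trans)
  ultimately have "2 / 3 \<le> exp (real n * \<epsilon>) * (1 / 3 + 1 / 9)"
    using \<delta> by (meson add_mono exp_ge_zero mult_left_mono order_trans)
  then have e: "3 / 2 \<le> exp (real n * \<epsilon>)" by simp
  show ?thesis
  proof (rule ccontr)
    assume "\<not> ?thesis"
    then have "exp (real n * \<epsilon>) \<le> exp (1 / 3)" by simp
    also have "\<dots> \<le> 1 + 1 / 3 + (1 / 3)\<^sup>2" by (rule exp_le_quadratic) simp
    also have "\<dots> < 3 / 2" by (simp add: power2_eq_square)
    finally show False using e by simp
  qed
qed

section \<open>Choice of the parameters p, s, r and the three terms of the bound\<close>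

lemma moment_const_ge_1: "1 \<le> moment_const k"
  by (simp add: moment_const_def)

text \<open>The scale \<open>c\<close> normalises the moments: whenever
  \<open>p * s powr k = c powr k\<close>, the bound of \<open>cloud_moment\<close> equals 1, which
  \<open>C\<close> allows.\<close>

locale estimation =
  fixes n m d :: nat and \<alpha> \<epsilon> \<delta> k C c :: real and M
  assumes nmd: "1 \<le> n" "1 \<le> m" "1 \<le> d" and \<alpha>: "0 < \<alpha>" "\<alpha> \<le> 1" and \<epsilon>: "0 < \<epsilon>" "\<epsilon> \<le> 1"
    and \<delta>: "0 \<le> \<delta>" "\<delta> * (real n * sqrt (real m)) \<le> 1 / 120"
    and k: "2 \<le> k" and c: "0 < c" "c \<le> 1" "c powr k * moment_const k = 1" and C: "1 \<le> C"
    and M: "mechanism n m d M" and DP: "person_level_DP n m d \<epsilon> \<delta> M"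
    and succ: "\<And>D. bounded_moment d k C D \<Longrightarrow> success_prob n m d \<alpha> M D \<ge> 2 / 3"
begin

lemma sd: "1 \<le> sqrt (real d)" "sqrt (real d) * sqrt (real d) = real d"
  using nmd by auto

text \<open>The value \<open>d / 60\<close> is half of the left side \<open>d / 30\<close> of
  \<open>private_bound\<close>, so the \<open>\<delta>\<close> term can be absorbed there; the 1/120
  in the locale is chosen for this.\<close>

lemma delta_term:
  assumes "0 \<le> b" "b \<le> sqrt (real d)" "0 \<le> p" "p \<le> 1"
  shows "2 * real n * b * (\<delta> * sqrt (real m * p * real d)) \<le> real d / 60"
proof -
  have "sqrt (real m * p * real d) \<le> sqrt (real m * 1 * real d)"
    using assms by (intro real_sqrt_le_mono mult_right_mono mult_left_mono) auto
  then have "sqrt (real m * p * real d) \<le> sqrt (real m) * sqrt (real d)" by (simp add: real_sqrt_mult)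
  then have "2 * real n * b * (\<delta> * sqrt (real m * p * real d))
      \<le> 2 * real n * sqrt (real d) * (\<delta> * (sqrt (real m) * sqrt (real d)))"
    using assms \<delta> by (intro mult_mono mult_nonneg_nonneg) auto
  also have "\<dots> = 2 * (sqrt (real d) * sqrt (real d)) * (\<delta> * (real n * sqrt (real m)))" by (simp only: mult_ac)
  also have "\<dots> \<le> 2 * (sqrt (real d) * sqrt (real d)) * (1 / 120)"
    using \<delta> by (intro mult_left_mono) auto
  finally show ?thesis by simp
qed

text \<open>These are \<open>private_bound\<close>, after absorbing the \<open>\<delta>\<close>
  term, and \<open>nonprivate_bound\<close>, both with \<open>B\<close> replaced by
  \<open>2 * r * sqrt d\<close>. Since \<open>r \<le> 1/2\<close>, this is at most
  \<open>sqrt d\<close>, as \<open>delta_term\<close> requires.\<close>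

lemma private_sample_bound:
  assumes cl: "sign_cloud d p s r" and \<alpha>r: "100 * \<alpha> \<le> p * s * r * sqrt (real d)"
    and pr: "p = 1 \<or> r * sqrt (real d) \<le> 1" and ps: "p * s powr k * moment_const k \<le> C"
  shows "real d \<le> 240 * real n * \<epsilon> * (r * sqrt (real d)) * min (real m * p) (sqrt (real m * p))"
    and "real d \<le> 3600 * (r * sqrt (real d))\<^sup>2 * (real n * real m * p)"
proof -
  have k1: "1 \<le> k" using k by simp
  interpret sign_mechanism d p s r n m M \<alpha>
    by (rule sign_mechanismI[OF cl M \<alpha>(1) \<alpha>r k1 pr ps succ])
  define R where "R = r * sqrt (real d)"
  have R0: "0 \<le> R" using r by (simp add: R_def)
  have B0: "0 \<le> B" "B \<le> 2 * R" using B_pos B_le by (auto simp: R_def)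
  have "2 * R \<le> sqrt (real d)" using r mult_right_mono[of "2 * r" 1 "sqrt (real d)"] by (simp add: R_def)
  then have "2 * real n * B * (\<delta> * sqrt (real m * p * real d)) \<le> real d / 60"
    using B0 p by (intro delta_term) auto
  moreover have "real d / 30 \<le> 2 * real n * B * (\<epsilon> * min (real m * p) (sqrt (real m * p)) + \<delta> * sqrt (real m * p * real d))"
    using \<epsilon> \<delta> DP_data[OF DP] by (intro private_bound) auto
  ultimately have "real d / 60 \<le> 2 * real n * B * (\<epsilon> * min (real m * p) (sqrt (real m * p)))"
    by (simp add: distrib_left)
  also have "\<dots> \<le> 2 * real n * (2 * R) * (\<epsilon> * min (real m * p) (sqrt (real m * p)))"
    using B0 \<epsilon> p by (intro mult_right_mono mult_left_mono mult_nonneg_nonneg) auto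
  finally show "real d \<le> 240 * real n * \<epsilon> * (r * sqrt (real d)) * min (real m * p) (sqrt (real m * p))"
    by (simp add: R_def mult_ac)
  have "real d / 30 \<le> 2 * R * sqrt (real n * real m * p * real d)"
    using nonprivate_bound B0 by (meson mult_right_mono order_trans real_sqrt_ge_zero mult_nonneg_nonneg of_nat_0_le_iff less_imp_le p(1))
  also have "\<dots> = 2 * R * sqrt (real n * real m * p) * sqrt (real d)"
    by (subst real_sqrt_mult[of "real n * real m * p" "real d"]) (simp only: mult.assoc)
  finally have "sqrt (real d) * (sqrt (real d) / 30) \<le> sqrt (real d) * (2 * R * sqrt (real n * real m * p))"
    using sd(2) by (simp add: mult_ac)
  then have "sqrt (real d) / 30 \<le> 2 * R * sqrt (real n * real m * p)"
    by (rule mult_left_le_imp_le) (use nmd in simp)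
  then have "sqrt (real d) \<le> 60 * R * sqrt (real n * real m * p)" by simp
  then have "(sqrt (real d))\<^sup>2 \<le> (60 * R * sqrt (real n * real m * p))\<^sup>2" by (intro power_mono) auto
  then show "real d \<le> 3600 * (r * sqrt (real d))\<^sup>2 * (real n * real m * p)"
    using p by (simp add: R_def power_mult_distrib mult_ac)
qed

text \<open>In both choices of parameters below,
  \<open>p * s * r * sqrt d = c * L * \<alpha> / 2\<close>. The value of \<open>L\<close> makes this
  \<open>100 * \<alpha>\<close>, the weakest signal that \<open>sign_mechanism\<close>
  admits.\<close>

definition L :: real where "L = 200 / c"

lemma L: "200 \<le> L" using c by (simp add: L_def field_simps)

text \<open>Without an atom and at the fixed scale \<open>s = c\<close>, the signal is tuned by the
  side of the cube alone; the assumption says exactly that \<open>r \<le> 1/2\<close>.\<close>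

lemma first_second_concentrated:
  assumes "L * \<alpha> \<le> sqrt (real d)"
  shows "real d / (real m * \<alpha>\<^sup>2) \<le> 900 * L\<^sup>2 * real n"
    and "real d / (sqrt (real m) * \<alpha> * \<epsilon>) \<le> 120 * L * real n"
proof -
  define r where "r = L * \<alpha> / (2 * sqrt (real d))"
  have sd0: "0 < sqrt (real d)" using sd by simp
  have r: "r * sqrt (real d) = L * \<alpha> / 2" using sd0 by (simp add: r_def)
  have cl: "sign_cloud d 1 c r"
    using nmd c \<alpha> L assms sd0 by unfold_locales (auto simp: r_def field_simps)
  have "100 * \<alpha> \<le> 1 * c * r * sqrt (real d)"
    using c by (simp add: mult.assoc r) (simp add: L_def)
  from private_sample_bound[OF cl this] c C
  have 1: "real d \<le> 240 * real n * \<epsilon> * (L * \<alpha> / 2) * min (real m * 1) (sqrt (real m * 1))"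
    and 2: "real d \<le> 3600 * (L * \<alpha> / 2)\<^sup>2 * (real n * real m * 1)"
    unfolding r by auto
  have "real d \<le> 240 * real n * \<epsilon> * (L * \<alpha> / 2) * sqrt (real m)"
    using \<epsilon> \<alpha> L by (intro order_trans[OF 1] mult_left_mono) auto
  then show "real d / (sqrt (real m) * \<alpha> * \<epsilon>) \<le> 120 * L * real n"
    using nmd \<alpha> \<epsilon> by (simp add: divide_le_eq mult_ac)
  show "real d / (real m * \<alpha>\<^sup>2) \<le> 900 * L\<^sup>2 * real n"
    using 2 nmd \<alpha> by (simp add: divide_le_eq power_mult_distrib power_divide mult_ac)
qed

text \<open>The cube now has fixed radius \<open>r * sqrt d = 1/2\<close> and \<open>p\<close> makes
  the mean small. Using up the moment budget, \<open>p * s powr k = c powr k\<close>, leaves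
  \<open>p * s = c * p powr (1 - 1/k)\<close>; equating this with \<open>c * L * \<alpha>\<close>
  determines \<open>p\<close>, and the assumption gives \<open>p \<le> 1\<close>.\<close>

lemma third_concentrated:
  assumes "L * \<alpha> \<le> 1"
  shows "real d / (real m * \<alpha> powr (k / (k - 1)) * \<epsilon>) \<le> 120 * L\<^sup>2 * real n"
proof -
  define \<kappa> where "\<kappa> = k / (k - 1)"
  define p where "p = (L * \<alpha>) powr \<kappa>"
  define s where "s = c * p powr (- 1 / k)"
  define r where "r = 1 / (2 * sqrt (real d))"
  have \<kappa>: "1 \<le> \<kappa>" "\<kappa> \<le> 2" using k by (auto simp: \<kappa>_def field_simps)
  have La: "0 < L * \<alpha>" using L \<alpha> by simp
  have p: "0 < p" "p \<le> 1" using La assms \<kappa> by (auto simp: p_def intro!: powr_le1)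
  have sd0: "0 < sqrt (real d)" using sd by simp
  have cl: "sign_cloud d p s r"
    using nmd c p sd by unfold_locales (auto simp: s_def r_def field_simps)
  have r: "r * sqrt (real d) = 1 / 2" using sd0 by (simp add: r_def)
  have "p * s = c * (p powr 1 * p powr (- 1 / k))" using p by (simp add: s_def)
  also have "\<dots> = c * (L * \<alpha>) powr (\<kappa> * (1 - 1 / k))"
    unfolding powr_add[symmetric] by (simp add: p_def powr_powr)
  also have "\<kappa> * (1 - 1 / k) = 1" using k by (simp add: \<kappa>_def field_simps)
  finally have ps: "p * s = 200 * \<alpha>" using \<alpha> c by (simp add: L_def abs_of_pos)
  have "s powr k = c powr k * p powr (- 1)" using c k p by (simp add: s_def powr_mult powr_powr)
  then have "p * s powr k = c powr k" using p by (simp add: powr_minus)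
  then have "p * s powr k * moment_const k \<le> C" using c C by simp
  moreover have "100 * \<alpha> \<le> p * s * r * sqrt (real d)"
  proof -
    have "p * s * r * sqrt (real d) = (p * s) * (r * sqrt (real d))" by (simp only: mult.assoc)
    then show ?thesis by (simp add: r ps)
  qed
  ultimately have 1: "real d \<le> 240 * real n * \<epsilon> * (1 / 2) * min (real m * p) (sqrt (real m * p))"
    using private_sample_bound(1)[OF cl] unfolding r by simp
  have "real d \<le> 240 * real n * \<epsilon> * (1 / 2) * (real m * p)"
    using \<epsilon> by (intro order_trans[OF 1] mult_left_mono) auto
  also have "p = L powr \<kappa> * \<alpha> powr \<kappa>" using L \<alpha> by (simp add: p_def powr_mult)
  also have "240 * real n * \<epsilon> * (1 / 2) * (real m * (L powr \<kappa> * \<alpha> powr \<kappa>))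
      \<le> 240 * real n * \<epsilon> * (1 / 2) * (real m * (L\<^sup>2 * \<alpha> powr \<kappa>))"
    using L \<kappa> \<epsilon> powr_mono[of \<kappa> 2 L] by (intro mult_left_mono mult_right_mono) auto
  finally show ?thesis
    using nmd \<alpha> \<epsilon> unfolding \<kappa>_def[symmetric] by (simp add: divide_le_eq mult_ac)
qed

text \<open>Three ranges of \<open>L * \<alpha>\<close>: up to 1 both constructions apply; from 1 to
  \<open>sqrt d\<close> the third term is at most \<open>L\<close> times the second; beyond
  \<open>sqrt d\<close> the dimension is at most \<open>(L * \<alpha>)\<^sup>2\<close> and
  \<open>n * \<epsilon> \<ge> 1/3\<close> is enough. The factor \<open>900 * L ^ 4\<close> dominates
  the constants of all cases.\<close>

lemma terms_bounds:
  shows "real d / (real m * \<alpha>\<^sup>2) \<le> 900 * L ^ 4 * real n"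
    and "real d / (sqrt (real m) * \<alpha> * \<epsilon>) \<le> 900 * L ^ 4 * real n"
    and "real d / (real m * \<alpha> powr (k / (k - 1)) * \<epsilon>) \<le> 900 * L ^ 4 * real n"
proof -
  define \<kappa> where "\<kappa> = k / (k - 1)"
  have \<kappa>: "1 \<le> \<kappa>" "\<kappa> \<le> 2" using k by (auto simp: \<kappa>_def field_simps)
  have L1: "1 \<le> L" using L by simp
  have sm: "1 \<le> sqrt (real m)" "sqrt (real m) \<le> real m"
    using nmd by (auto intro!: real_le_lsqrt simp: power2_eq_square)
  have pw: "L ^ i \<le> L ^ 4" if "i \<le> 4" for i using that L1 by (rule power_increasing)
  have up: "x \<le> 900 * L ^ 4 * real n" if "x \<le> a * L ^ i * real n" "a \<le> 900" "i \<le> 4" "0 \<le> a" for x a i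
  proof -
    have "a * L ^ i * real n \<le> 900 * L ^ 4 * real n"
      using that pw L1 by (intro mult_right_mono mult_mono) auto
    then show ?thesis using that by simp
  qed
  \<comment> \<open>Once \<open>L * \<alpha> \<ge> 1\<close>, the powers \<open>\<alpha>\<close> and
    \<open>\<alpha> powr \<kappa>\<close> agree up to a factor \<open>L\<close>, because
    \<open>0 \<le> \<kappa> - 1 \<le> 1\<close>; the rest is \<open>sqrt m \<le> m\<close>.\<close>
  have third: "real d / (real m * \<alpha> powr \<kappa> * \<epsilon>) \<le> L * (real d / (sqrt (real m) * \<alpha> * \<epsilon>))" if "1 \<le> L * \<alpha>"
  proof -
    have "1 \<le> (L * \<alpha>) powr (\<kappa> - 1)" using that \<kappa> by (intro ge_one_powr_ge_zero) auto
    also have "\<dots> = L powr (\<kappa> - 1) * \<alpha> powr (\<kappa> - 1)" using L \<alpha> by (simp add: powr_mult)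
    also have "\<dots> \<le> L powr 1 * \<alpha> powr (\<kappa> - 1)"
      using L1 \<kappa> by (intro mult_right_mono powr_mono) auto
    finally have "\<alpha> * 1 \<le> \<alpha> * (L * \<alpha> powr (\<kappa> - 1))" using L1 \<alpha> by (intro mult_left_mono) auto
    also have "\<dots> = L * \<alpha> powr \<kappa>" using \<alpha> by (simp add: powr_diff)
    finally have "sqrt (real m) * \<alpha> \<le> real m * (L * \<alpha> powr \<kappa>)"
      using sm \<alpha> by (intro mult_mono) auto
    then have "real d * \<epsilon> * (sqrt (real m) * \<alpha>) \<le> real d * \<epsilon> * (real m * (L * \<alpha> powr \<kappa>))"
      using \<epsilon> by (intro mult_left_mono) auto
    then show ?thesis using nmd \<alpha> \<epsilon> by (simp add: frac_le_eq divide_simps mult_ac)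
  qed
  have "real d / (real m * \<alpha>\<^sup>2) \<le> 900 * L ^ 4 * real n \<and>
    real d / (sqrt (real m) * \<alpha> * \<epsilon>) \<le> 900 * L ^ 4 * real n \<and>
    real d / (real m * \<alpha> powr \<kappa> * \<epsilon>) \<le> 900 * L ^ 4 * real n"
  proof (cases "L * \<alpha> \<le> sqrt (real d)")
    case True
    note 12 = first_second_concentrated[OF True]
    have "real d / (real m * \<alpha> powr \<kappa> * \<epsilon>) \<le> 120 * L ^ 2 * real n"
    proof (cases "L * \<alpha> \<le> 1")
      case True
      from third_concentrated[OF this] show ?thesis unfolding \<kappa>_def .
    next
      case False
      have "L * (real d / (sqrt (real m) * \<alpha> * \<epsilon>)) \<le> L * (120 * L * real n)"
        using 12(2) L1 by (intro mult_left_mono) auto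
      then show ?thesis using third False by (simp add: power2_eq_square mult_ac)
    qed
    from up[OF this] up[OF 12(1)] up[of _ 120 1] 12(2) show ?thesis by simp
  next
    case False
    then have La: "sqrt (real d) < L * \<alpha>" by simp
    then have La1: "1 \<le> L * \<alpha>" using sd(1) by linarith
    have "(sqrt (real d))\<^sup>2 \<le> (L * \<alpha>)\<^sup>2" using La by (intro power_mono) auto
    then have dl: "real d \<le> L\<^sup>2 * \<alpha>\<^sup>2" by (simp add: power_mult_distrib)
    have "real d / (real m * \<alpha>\<^sup>2) \<le> L\<^sup>2 * \<alpha>\<^sup>2 / (1 * \<alpha>\<^sup>2)"
      using dl nmd \<alpha> by (intro frac_le mult_right_mono) auto
    also have "\<dots> \<le> 1 * L\<^sup>2 * real n"
      using \<alpha> nmd mult_left_mono[of 1 "real n" "L\<^sup>2"] by simp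
    finally have 1: "real d / (real m * \<alpha>\<^sup>2) \<le> 1 * L\<^sup>2 * real n" .
    have n\<delta>: "real n * \<delta> \<le> 1 / 9"
    proof -
      have "real n * 1 * \<delta> \<le> real n * sqrt (real m) * \<delta>"
        using sm \<delta> by (intro mult_right_mono mult_left_mono) auto
      then show ?thesis using \<delta> by (simp add: mult_ac)
    qed
    have ne: "1 / 3 \<le> real n * \<epsilon>"
      by (rule size_lower_bound_pure[OF M DP nmd(3) \<alpha>(1) _ \<delta>(1) n\<delta> _ succ])
         (use \<epsilon> C in simp_all)
    have "real d / (sqrt (real m) * \<alpha> * \<epsilon>) \<le> L\<^sup>2 * \<alpha>\<^sup>2 / (1 * \<alpha> * \<epsilon>)"
      using dl sm \<alpha> \<epsilon> by (intro frac_le mult_right_mono) auto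
    also have "\<dots> = L\<^sup>2 * \<alpha> / \<epsilon>" using \<alpha> by (simp add: power2_eq_square)
    also have "\<dots> \<le> L\<^sup>2 * 1 / \<epsilon>" using \<alpha> \<epsilon> by (intro divide_right_mono mult_left_mono) auto
    also have "\<dots> \<le> L\<^sup>2 * (3 * (real n * \<epsilon>)) / \<epsilon>"
      using ne \<epsilon> by (intro divide_right_mono mult_left_mono) auto
    also have "\<dots> = 3 * L ^ 2 * real n" using \<epsilon> by simp
    finally have 2: "real d / (sqrt (real m) * \<alpha> * \<epsilon>) \<le> 3 * L ^ 2 * real n" .
    have "real d / (real m * \<alpha> powr \<kappa> * \<epsilon>) \<le> L * (3 * L ^ 2 * real n)"
      using third[OF La1] 2 L1 by (meson mult_left_mono order_trans zero_le_one)
    also have "\<dots> = 3 * L ^ 3 * real n" by (simp add: power2_eq_square power3_eq_cube)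
    finally have 3: "real d / (real m * \<alpha> powr \<kappa> * \<epsilon>) \<le> 3 * L ^ 3 * real n" .
    from up[OF 1] up[OF 2] up[OF 3] show ?thesis by simp
  qed
  then show "real d / (real m * \<alpha>\<^sup>2) \<le> 900 * L ^ 4 * real n"
    "real d / (sqrt (real m) * \<alpha> * \<epsilon>) \<le> 900 * L ^ 4 * real n"
    "real d / (real m * \<alpha> powr (k / (k - 1)) * \<epsilon>) \<le> 900 * L ^ 4 * real n"
    unfolding \<kappa>_def by auto
qed

lemma sample_size:
  "1 / (2700 * L ^ 4) * (real d / (real m * \<alpha>\<^sup>2) + real d / (sqrt (real m) * \<alpha> * \<epsilon>)
    + real d / (real m * \<alpha> powr (k / (k - 1)) * \<epsilon>)) \<le> real n"
proof -
  have "0 < 2700 * L ^ 4" using L by simp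
  then show ?thesis using terms_bounds by (simp add: pos_divide_le_eq mult_ac)
qed

end

lemma delta_bound_le: "delta_bound n m d \<le> 1 / (real n * sqrt (real m))"
  by (simp add: delta_bound_def Let_def)

text \<open>Evaluation at the standard normal law, where the right side is \<open>C0\<close> itself.
  It yields \<open>1 \<le> C\<close>, the room that the normalised family needs.\<close>

lemma gaussian_moment_const_nonneg:
  assumes "gaussian_moment_const k C0" shows "0 \<le> C0"
proof -
  have "(\<integral>x. \<bar>x\<bar> powr k \<partial>density lborel (\<lambda>x. ennreal (normal_density 0 1 x))) \<le> C0 * (\<bar>0\<bar> + 1) powr k"
    using assms unfolding gaussian_moment_const_def by (metis zero_less_one)
  moreover have "0 \<le> (\<integral>x. \<bar>x\<bar> powr k \<partial>density lborel (\<lambda>x. ennreal (normal_density 0 1 x)))"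
    by (rule integral_nonneg_AE) simp
  moreover have "C0 * (\<bar>0\<bar> + 1) powr k = C0" by simp
  ultimately show ?thesis by linarith
qed

theorem theorem6p1:
  shows "\<exists>T>1::real. \<forall>C1\<ge>T. \<forall>k\<ge>2::real. \<forall>C0::real. gaussian_moment_const k C0 \<longrightarrow>
    (\<exists>(c1::real) (c2::real) (c3::real) (p1::nat) (p3::nat). c1 > 0 \<and> c2 > 0 \<and> c3 > 0 \<and>
      (\<forall>(n::nat) (m::nat) (d::nat) (\<alpha>::real) (\<epsilon>::real) (\<delta>::real) M.
        1 \<le> n \<and> 1 \<le> m \<and> 1 \<le> d \<and> 0 < \<alpha> \<and> \<alpha> \<le> 1 \<and> 0 < \<epsilon> \<and> \<epsilon> \<le> 1 \<and> 0 \<le> \<delta> \<and>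
        \<delta> \<le> min ((c1 * (\<alpha> * \<epsilon> / real d) / log_factor d \<alpha> \<epsilon> ^ p1) powr C1)
                (c2 * delta_bound n m d) \<and>
        mechanism n m d M \<and> person_level_DP n m d \<epsilon> \<delta> M \<and>
        (\<forall>D. bounded_moment d k (2 powr k * C0 + 1) D \<longrightarrow> success_prob n m d \<alpha> M D \<ge> 2 / 3) \<longrightarrow>
        real n \<ge> c3 * (real d / (real m * \<alpha>\<^sup>2) + real d / (sqrt (real m) * \<alpha> * \<epsilon>)
                        + real d / (real m * \<alpha> powr (k / (k - 1)) * \<epsilon>))
                  / log_factor d \<alpha> \<epsilon> ^ p3))"
proof (rule exI[of _ 2], intro conjI allI impI)
  fix C1 k C0 :: real
  assume k: "2 \<le> k" and C0: "gaussian_moment_const k C0"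
  define C where "C = 2 powr k * C0 + 1"
  have C: "1 \<le> C" using gaussian_moment_const_nonneg[OF C0] by (simp add: C_def)
  define c where "c = (1 / moment_const k) powr (1 / k)"
  have mc: "1 \<le> moment_const k" by (rule moment_const_ge_1)
  have c: "0 < c" "c \<le> 1" "c powr k * moment_const k = 1"
    using mc k by (auto simp: c_def powr_powr intro!: powr_le1)
  define c3 where "c3 = 1 / (2700 * (200 / c) ^ 4)"
  have c3: "0 < c3" using c by (simp add: c3_def)
  have main: "c3 * (real d / (real m * \<alpha>\<^sup>2) + real d / (sqrt (real m) * \<alpha> * \<epsilon>)
                + real d / (real m * \<alpha> powr (k / (k - 1)) * \<epsilon>)) \<le> real n"
    if A: "1 \<le> n" "1 \<le> m" "1 \<le> d" "0 < \<alpha>" "\<alpha> \<le> 1" "0 < \<epsilon>" "\<epsilon> \<le> 1" "0 \<le> \<delta>"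
      and \<delta>: "\<delta> \<le> 1 / 120 * delta_bound n m d"
      and M: "mechanism n m d M" "person_level_DP n m d \<epsilon> \<delta> M"
      and succ: "\<And>D. bounded_moment d k C D \<Longrightarrow> success_prob n m d \<alpha> M D \<ge> 2 / 3"
    for n m d :: nat and \<alpha> \<epsilon> \<delta> :: real and M
  proof -
    define N where "N = real n * sqrt (real m)"
    have N: "0 < N" using A by (simp add: N_def)
    have "\<delta> \<le> 1 / 120 * (1 / N)"
      using \<delta> delta_bound_le[of n m d] unfolding N_def by linarith
    then have "\<delta> * N \<le> 1 / 120" using N by (simp add: field_simps)
    then interpret estimation n m d \<alpha> \<epsilon> \<delta> k C c M
      using A k c C M succ unfolding N_def by unfold_locales auto
    show ?thesis using sample_size unfolding L_def c3_def .
  qed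
  show "\<exists>c1 c2 c3 p1 p3. c1 > 0 \<and> c2 > 0 \<and> c3 > 0 \<and>
      (\<forall>n m d \<alpha> \<epsilon> \<delta> M.
        1 \<le> n \<and> 1 \<le> m \<and> 1 \<le> d \<and> 0 < \<alpha> \<and> \<alpha> \<le> 1 \<and> 0 < \<epsilon> \<and> \<epsilon> \<le> 1 \<and> 0 \<le> \<delta> \<and>
        \<delta> \<le> min ((c1 * (\<alpha> * \<epsilon> / real d) / log_factor d \<alpha> \<epsilon> ^ p1) powr C1)
                (c2 * delta_bound n m d) \<and>
        mechanism n m d M \<and> person_level_DP n m d \<epsilon> \<delta> M \<and>
        (\<forall>D. bounded_moment d k (2 powr k * C0 + 1) D \<longrightarrow> success_prob n m d \<alpha> M D \<ge> 2 / 3) \<longrightarrow>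
        real n \<ge> c3 * (real d / (real m * \<alpha>\<^sup>2) + real d / (sqrt (real m) * \<alpha> * \<epsilon>)
                        + real d / (real m * \<alpha> powr (k / (k - 1)) * \<epsilon>))
                  / log_factor d \<alpha> \<epsilon> ^ p3)"
    \<comment> \<open>The witness 1/120 for \<open>c2\<close> is the bound on
      \<open>\<delta> * n * sqrt m\<close> required by \<open>estimation\<close>; both exponents of
      the logarithmic factor are 0.\<close>
    using main c3
    by (intro exI[of _ "1 :: real"] exI[of _ "1 / 120 :: real"] exI[of _ c3] exI[of _ "0 :: nat"])
       (auto simp: C_def)
qed simp

end
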